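(* Let $\alpha\in(0,1]$, let $P\in\mathcal{A}$ be a self-adjoint projection with $\tau(P)=\alpha$, and let $(Y_t)_{t\ge0}$ be a free unitary Brownian motion in $(\mathcal{A},\tau)$ such that $P$ and $(Y_t)_{t\ge0}$ are $\star$-free. Let $R^{(\alpha)}_{m,n}(t)=e^{t(m+n)/2}\tau[(PY_t)^m(PY_t^\star)^n]$ for $m,n\ge0$, $(m,n)\ne(0,0)$, $R^{(\alpha)}_{0,0}(t):=\alpha$, and, for $(y,z)$ near $(0,0)$, $$\phi^{(\alpha)}(t,y,z)=\sum_{m,n\ge0}R^{(\alpha)}_{m,n}(t)\,y^mz^n,\qquad f^{(\alpha)}(t,y,z)=\frac{-1}{\phi^{(\alpha)}(t,y,z)},$$ $$g^{(\alpha)}(t,y,z):=f^{(\alpha)}\Big(t,\frac{y\,e^{\alpha ty}}{1+y},\frac{z\,e^{\alpha tz}}{1+z}\Big).$$ Then, in a neighborhood of $(y,z)=(0,0)$, $$g^{(\alpha)}(t,y,z)=\frac{yz\,(e^{t(1+\alpha y+\alpha z)}-1)}{(1+\alpha y+\alpha z)(1+y)(1+z)}-\frac{1}{\alpha(1+y)(1+z)}.$$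
   Context: $(\mathcal{A},\tau)$ is a non-commutative $\star$-probability space: $\mathcal{A}$ is a unital von Neumann algebra with a faithful tracial state $\tau$. A free unitary Brownian motion $(Y_t)_{t\ge0}$ is the unitary-valued solution of the free stochastic differential equation $dY_t=iY_t\,dX_t-\frac12Y_t\,dt$, $Y_0=\mathbf 1$, where $(X_t)_{t\ge0}$ is a free additive Brownian motion in $\mathcal{A}$. When $n=0$ (resp. $m=0$), the factor $(PY_t^\star)^n$ (resp. $(PY_t)^m$) is omitted. The series $\phi^{(\alpha)}$ converges absolutely, for each fixed $t\ge0$, in some neighborhood of $(0,0)$, with $\phi^{(\alpha)}(t,0,0)=\alpha\neq0$, so $f^{(\alpha)}$ is well defined near $(0,0)$. *)

theory Defs
  imports "HOL-Analysis.Analysis"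
begin

section \<open>Complex Hilbert spaces\<close>

class complex_vector = real_vector +
  fixes scaleC :: "complex \<Rightarrow> 'a \<Rightarrow> 'a"  (infixr "*\<^sub>C" 75)
  assumes scaleC_add_right: "c *\<^sub>C (x + y) = c *\<^sub>C x + c *\<^sub>C y"
    and scaleC_add_left: "(c + d) *\<^sub>C x = c *\<^sub>C x + d *\<^sub>C x"
    and scaleC_scaleC: "c *\<^sub>C (d *\<^sub>C x) = (c * d) *\<^sub>C x"
    and scaleC_of_real: "complex_of_real r *\<^sub>C x = r *\<^sub>R x"

class complex_inner = complex_vector + real_normed_vector +
  fixes cinner :: "'a \<Rightarrow> 'a \<Rightarrow> complex"
  assumes cinner_commute: "cinner x y = cnj (cinner y x)"
    and cinner_add_left: "cinner (x + y) z = cinner x z + cinner y z"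
    and cinner_scaleC_left: "cinner (c *\<^sub>C x) y = c * cinner x y"
    and cinner_self: "cinner x x = complex_of_real ((norm x)\<^sup>2)"
      \<comment> \<open>this also gives positive definiteness, as \<^term>\<open>norm\<close> is a norm\<close>

class chilbert_space = complex_inner + complete_space

lemma cinner_add_right: "cinner x (y + z) = cinner x y + cinner x (z :: 'h::complex_inner)"
  by (metis cinner_add_left cinner_commute complex_cnj_add)

lemma cinner_scaleC_right: "cinner x (c *\<^sub>C y) = cnj c * cinner x (y :: 'h::complex_inner)"
  by (metis cinner_scaleC_left cinner_commute complex_cnj_mult)

lemma cinner_scaleR_left: "cinner (r *\<^sub>R x) y = of_real r * cinner x (y :: 'h::complex_inner)"
  by (metis cinner_scaleC_left scaleC_of_real)

lemma cinner_scaleR_right: "cinner x (r *\<^sub>R y) = of_real r * cinner x (y :: 'h::complex_inner)"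
  by (metis cinner_scaleC_right scaleC_of_real complex_cnj_complex_of_real)

lemma cinner_minus_left: "cinner (- x) y = - cinner x (y :: 'h::complex_inner)"
  using cinner_scaleR_left[of "-1" x y] by simp

lemma cinner_minus_right: "cinner x (- y) = - cinner x (y :: 'h::complex_inner)"
  using cinner_scaleR_right[of x "-1" y] by simp

lemma cinner_diff_left: "cinner (x - y) z = cinner x z - cinner y (z :: 'h::complex_inner)"
  using cinner_add_left[of x "-y" z] by (simp add: cinner_minus_left)

lemma cinner_diff_right: "cinner x (y - z) = cinner x y - cinner x (z :: 'h::complex_inner)"
  using cinner_add_right[of x y "-z"] by (simp add: cinner_minus_right)

lemmas cinner_algebra = cinner_add_left cinner_add_right cinner_diff_left cinner_diff_right
  cinner_scaleR_left cinner_scaleR_right cinner_minus_left cinner_minus_right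

lemma norm_sq_cinner: "(norm x)\<^sup>2 = Re (cinner x (x :: 'h::complex_inner))"
  by (simp add: cinner_self)

lemma cinner_Re_commute: "Re (cinner x y) = Re (cinner y (x :: 'h::complex_inner))"
  by (metis cinner_commute complex_cnj(1) cnj.sel(1))

lemma cinner_eqI:
  fixes z w :: "'h::complex_inner"
  assumes "\<And>x. cinner x z = cinner x w"
  shows "z = w"
proof -
  have "cinner (z - w) (z - w) = 0"
    using assms[of "z - w"] by (simp add: cinner_diff_right)
  then have "norm (z - w) = 0" unfolding cinner_self by simp
  then show ?thesis by simp
qed

lemma norm_add_sq_cinner:
  fixes x y :: "'h::complex_inner"
  shows "(norm (x + y))\<^sup>2 = (norm x)\<^sup>2 + (norm y)\<^sup>2 + 2 * Re (cinner x y)"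
  using cinner_Re_commute[of x y] by (simp add: norm_sq_cinner cinner_add_left cinner_add_right)

lemma norm_diff_sq_cinner:
  fixes x y :: "'h::complex_inner"
  shows "(norm (x - y))\<^sup>2 = (norm x)\<^sup>2 + (norm y)\<^sup>2 - 2 * Re (cinner x y)"
  using cinner_Re_commute[of x y] by (simp add: norm_sq_cinner cinner_diff_left cinner_diff_right)

lemma real_quadratic_lemma:
  fixes a b :: real
  assumes "\<And>t. 0 \<le> t\<^sup>2 * a + 2 * t * b" "0 \<le> a"
  shows "b = 0"
proof (rule ccontr)
  assume "b \<noteq> 0"
  have "0 \<le> (b / (a+1))\<^sup>2 * a - 2 * (b / (a+1)) * b"
    using assms(1)[of "- b / (a+1)"] by simp
  also have "\<dots> = - (b\<^sup>2 * (a + 2) / (a+1)\<^sup>2)"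
    using assms(2) by (simp add: field_simps power2_eq_square add_nonneg_eq_0_iff)
  finally have "b\<^sup>2 * (a + 2) / (a+1)\<^sup>2 \<le> 0" by simp
  moreover have "0 < b\<^sup>2 * (a + 2) / (a+1)\<^sup>2"
    using \<open>b \<noteq> 0\<close> assms(2) by (intro divide_pos_pos mult_pos_pos) auto
  ultimately show False by simp
qed

lemma Re_cinner_le:
  fixes x y :: "'h::complex_inner"
  shows "Re (cinner x y) \<le> norm x * norm y"
proof -
  have "(norm (x + y))\<^sup>2 \<le> (norm x + norm y)\<^sup>2"
    by (intro power_mono norm_triangle_ineq) auto
  then show ?thesis unfolding norm_add_sq_cinner by (simp add: power2_eq_square algebra_simps)
qed

text \<open>The Riesz representation theorem, by minimising \<open>(norm x)\<^sup>2 - 2 * Re (f x)\<close>.\<close>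

lemma riesz_representation:
  fixes f :: "'h::chilbert_space \<Rightarrow> complex"
  assumes bl: "bounded_linear f" and cl: "\<And>c x. f (c *\<^sub>C x) = c * f x"
  shows "\<exists>z. \<forall>x. f x = cinner x z"
proof -
  define r where "r = (\<lambda>x. Re (f x))"
  have blr: "bounded_linear r"
    unfolding r_def by (rule bounded_linear_compose[OF bounded_linear_Re bl])
  interpret r: bounded_linear r by (rule blr)
  define J where "J = (\<lambda>x. (norm x)\<^sup>2 - 2 * r x)"
  obtain K where K: "\<And>x. norm (r x) \<le> norm x * K" using r.bounded by blast
  have Jlow: "- K\<^sup>2 \<le> J x" for x
  proof -
    have "r x \<le> norm x * K" using K[of x] by simp
    moreover have "0 \<le> (norm x - K)\<^sup>2" by simp
    ultimately show ?thesis unfolding J_def by (simp add: power2_eq_square algebra_simps)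
  qed
  then have bdd: "bdd_below (range J)" by (auto intro!: bdd_belowI)
  define m where "m = Inf (range J)"
  have mle: "m \<le> J x" for x unfolding m_def by (rule cInf_lower[OF _ bdd]) simp
  have "\<exists>x. J x < m + 1 / (real n + 1)" for n
  proof -
    have "Inf (range J) < m + 1 / (real n + 1)" unfolding m_def by simp
    then show ?thesis using cInf_less_iff[OF _ bdd] by auto
  qed
  then obtain x where x: "\<And>n. J (x n) < m + 1 / (real n + 1)" by metis
  have para: "(norm (a - b))\<^sup>2 = 2 * (J a + J b) - 4 * J ((1/2) *\<^sub>R (a + b))" for a b
    unfolding J_def
    by (simp add: r.scaleR r.add norm_add_sq_cinner norm_diff_sq_cinner power_mult_distrib
        power_divide cinner_scaleR_left cinner_scaleR_right algebra_simps)
  have "Cauchy x"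
  proof (rule metric_CauchyI)
    fix e :: real assume e: "0 < e"
    obtain N :: nat where N: "4 / e\<^sup>2 < real N" using reals_Archimedean2 by blast
    have "dist (x i) (x j) < e" if ij: "i \<ge> N" "j \<ge> N" for i j
    proof -
      have s: "1 / (real k + 1) < e\<^sup>2 / 4" if "k \<ge> N" for k
      proof -
        have "4 / e\<^sup>2 < real k + 1" using N that by linarith
        then show ?thesis using e by (simp add: field_simps)
      qed
      have "(norm (x i - x j))\<^sup>2 \<le> 2 * (J (x i) + J (x j)) - 4 * m"
        using para mle by simp
      also have "\<dots> < e\<^sup>2"
        using order.strict_trans[OF x add_strict_left_mono[OF s[OF ij(1)]]]
          order.strict_trans[OF x add_strict_left_mono[OF s[OF ij(2)]]] by simp
      finally show ?thesis using e by (simp add: dist_norm power2_less_imp_less)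
    qed
    then show "\<exists>M. \<forall>i\<ge>M. \<forall>j\<ge>M. dist (x i) (x j) < e" by blast
  qed
  then obtain z where z: "x \<longlonglongrightarrow> z" using Cauchy_convergent_iff convergent_def by blast
  have "(\<lambda>n. J (x n)) \<longlonglongrightarrow> J z" unfolding J_def
    by (intro tendsto_intros z r.tendsto)
  moreover have "(\<lambda>n. m + 1 / (real n + 1)) \<longlonglongrightarrow> m + 0"
    using LIMSEQ_inverse_real_of_nat
    by (intro tendsto_intros) (simp add: inverse_eq_divide add.commute)
  ultimately have "J z \<le> m + 0"
    by (rule LIMSEQ_le) (use x less_imp_le in blast)
  then have Jz: "J z \<le> J w" for w using mle[of w] by simp
  have Re_eq: "r w = Re (cinner w z)" for w
  proof -
    have "0 \<le> t\<^sup>2 * (norm w)\<^sup>2 + 2 * t * (Re (cinner w z) - r w)" for t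
      using Jz[of "z + t *\<^sub>R w"] cinner_Re_commute[of z w]
      by (simp add: J_def norm_add_sq_cinner r.add r.scaleR power_mult_distrib
          cinner_scaleR_right algebra_simps)
    from real_quadratic_lemma[OF this] show ?thesis by simp
  qed
  have "f w = cinner w z" for w
  proof (rule complex_eqI)
    show "Re (f w) = Re (cinner w z)" using Re_eq r_def by simp
    have "Re (f (\<i> *\<^sub>C w)) = Re (cinner (\<i> *\<^sub>C w) z)" using Re_eq r_def by metis
    then show "Im (f w) = Im (cinner w z)" by (simp add: cl cinner_scaleC_left)
  qed
  then show ?thesis by blast
qed


section \<open>Bounded operators on a complex Hilbert space\<close>

lemma scaleC_zero_right [simp]: "c *\<^sub>C (0 :: 'a::complex_vector) = 0"
  using scaleC_add_right[of c 0 "0::'a"] by simp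

lemma scaleC_scaleR_commute: "c *\<^sub>C (r *\<^sub>R x) = r *\<^sub>R (c *\<^sub>C (x :: 'a::complex_vector))"
  by (metis scaleC_of_real scaleC_scaleC mult.commute)

lemma scaleC_minus_right: "c *\<^sub>C (- x) = - (c *\<^sub>C (x :: 'a::complex_vector))"
  using scaleC_scaleR_commute[of c "-1" x] by simp

lemma scaleC_diff_right: "c *\<^sub>C (x - y) = c *\<^sub>C x - c *\<^sub>C (y :: 'a::complex_vector)"
  using scaleC_add_right[of c x "- y"] by (simp add: scaleC_minus_right)

lemma norm_scaleC: "norm (c *\<^sub>C (x :: 'a::complex_inner)) = cmod c * norm x"
proof -
  have "complex_of_real ((norm (c *\<^sub>C x))\<^sup>2) = of_real ((cmod c * norm x)\<^sup>2)"
    unfolding cinner_self[symmetric] cinner_scaleC_left cinner_scaleC_right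
    by (simp add: cinner_self power_mult_distrib complex_norm_square del: of_real_power)
  then have "(norm (c *\<^sub>C x))\<^sup>2 = (cmod c * norm x)\<^sup>2" using of_real_eq_iff by blast
  then show ?thesis by (simp add: power2_eq_iff_nonneg)
qed

text \<open>\<^typ>\<open>'h \<Rightarrow>\<^sub>L 'h\<close> consists of the bounded real-linear maps.\<close>

typedef (overloaded) 'h bop =
  "{T :: 'h::complex_inner \<Rightarrow>\<^sub>L 'h. \<forall>c x. blinfun_apply T (c *\<^sub>C x) = c *\<^sub>C blinfun_apply T x}"
  by (intro exI[of _ 0]) simp

setup_lifting type_definition_bop

lift_definition bop_apply :: "'h::complex_inner bop \<Rightarrow> 'h \<Rightarrow> 'h" is blinfun_apply .

instantiation bop :: (complex_inner) real_normed_algebra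
begin
lift_definition zero_bop :: "'a bop" is 0 by simp
lift_definition plus_bop :: "'a bop \<Rightarrow> 'a bop \<Rightarrow> 'a bop" is plus
  by (simp add: blinfun.add_left scaleC_add_right)
lift_definition uminus_bop :: "'a bop \<Rightarrow> 'a bop" is uminus
  by (simp add: blinfun.minus_left scaleC_minus_right)
lift_definition minus_bop :: "'a bop \<Rightarrow> 'a bop \<Rightarrow> 'a bop" is minus
  by (simp add: blinfun.diff_left scaleC_diff_right)
lift_definition scaleR_bop :: "real \<Rightarrow> 'a bop \<Rightarrow> 'a bop" is scaleR
  by (simp add: blinfun.scaleR_left scaleC_scaleR_commute)
lift_definition times_bop :: "'a bop \<Rightarrow> 'a bop \<Rightarrow> 'a bop" is blinfun_compose by simp
lift_definition norm_bop :: "'a bop \<Rightarrow> real" is norm .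
definition dist_bop :: "'a bop \<Rightarrow> 'a bop \<Rightarrow> real" where "dist_bop S T = norm (S - T)"
definition sgn_bop :: "'a bop \<Rightarrow> 'a bop" where "sgn_bop T = inverse (norm T) *\<^sub>R T"
definition uniformity_bop :: "('a bop \<times> 'a bop) filter" where
  "uniformity_bop = (INF e\<in>{0 <..}. principal {(S, T). dist S T < e})"
definition open_bop :: "'a bop set \<Rightarrow> bool" where
  "open_bop U = (\<forall>S\<in>U. eventually (\<lambda>(S', T). S' = S \<longrightarrow> T \<in> U) uniformity)"
instance
proof
  fix S T U :: "'a bop" and a b :: real
  show "dist S T = norm (S - T)" by (rule dist_bop_def)
  show "sgn T = inverse (norm T) *\<^sub>R T" by (rule sgn_bop_def)
  show "(uniformity :: ('a bop \<times> 'a bop) filter) = (INF e\<in>{0 <..}. principal {(S, T). dist S T < e})"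
    by (rule uniformity_bop_def)
  show "open V = (\<forall>S\<in>V. \<forall>\<^sub>F (S', T) in uniformity. S' = S \<longrightarrow> T \<in> V)" for V :: "'a bop set"
    by (rule open_bop_def)
  show "S + T + U = S + (T + U)" by transfer simp
  show "S + T = T + S" by transfer simp
  show "0 + T = T" by transfer simp
  show "- T + T = 0" by transfer simp
  show "S - T = S + - T" by transfer simp
  show "a *\<^sub>R (S + T) = a *\<^sub>R S + a *\<^sub>R T" by transfer (simp add: scaleR_add_right)
  show "(a + b) *\<^sub>R T = a *\<^sub>R T + b *\<^sub>R T" by transfer (simp add: scaleR_add_left)
  show "a *\<^sub>R b *\<^sub>R T = (a * b) *\<^sub>R T" by transfer simp
  show "1 *\<^sub>R T = T" by transfer simp
  show "(norm T = 0) = (T = 0)" by transfer simp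
  show "norm (S + T) \<le> norm S + norm T" by transfer (rule norm_triangle_ineq)
  show "norm (a *\<^sub>R T) = \<bar>a\<bar> * norm T" by transfer simp
  show "S * T * U = S * (T * U)" by transfer (simp add: blinfun_eqI)
  show "(S + T) * U = S * U + T * U"
    by transfer (simp add: blinfun_eqI blinfun.add_left)
  show "S * (T + U) = S * T + S * U"
    by transfer (simp add: blinfun_eqI blinfun.add_left blinfun.add_right)
  show "a *\<^sub>R S * T = a *\<^sub>R (S * T)"
    by transfer (simp add: blinfun_eqI blinfun.scaleR_left)
  show "S * a *\<^sub>R T = a *\<^sub>R (S * T)"
    by transfer (simp add: blinfun_eqI blinfun.scaleR_left blinfun.scaleR_right)
  show "norm (S * T) \<le> norm S * norm T" by transfer (rule norm_blinfun_compose)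
qed
end

instantiation bop :: (complex_inner) monoid_mult
begin
lift_definition one_bop :: "'a bop" is id_blinfun by simp
instance by standard (transfer, simp add: blinfun_eqI)+
end

lemma bounded_linear_scaleC:
  "bounded_linear (\<lambda>x :: 'a::complex_inner. c *\<^sub>C x)"
  by (rule bounded_linear_intro[of _ "cmod c"])
    (simp_all add: scaleC_add_right scaleC_scaleR_commute norm_scaleC mult.commute)

instantiation bop :: (complex_inner) complex_vector
begin
lift_definition scaleC_bop :: "complex \<Rightarrow> 'a bop \<Rightarrow> 'a bop" is
  "\<lambda>c T. Blinfun (\<lambda>x. c *\<^sub>C x) o\<^sub>L T"
  by (simp add: bounded_linear_Blinfun_apply bounded_linear_scaleC scaleC_scaleC mult.commute)
instance
  by standard (transfer, simp add: blinfun_eqI blinfun.add_left blinfun.scaleR_left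
      bounded_linear_Blinfun_apply bounded_linear_scaleC scaleC_add_right scaleC_add_left
      scaleC_scaleC scaleC_of_real)+
end

lemma bop_apply_simps [simp]:
  fixes S T :: "'h::complex_inner bop"
  shows "bop_apply 1 x = x"
    and "bop_apply (S * T) x = bop_apply S (bop_apply T x)"
    and "bop_apply (S + T) x = bop_apply S x + bop_apply T x"
    and "bop_apply (S - T) x = bop_apply S x - bop_apply T x"
    and "bop_apply (c *\<^sub>C T) x = c *\<^sub>C bop_apply T x"
    and "bop_apply (r *\<^sub>R T) x = r *\<^sub>R bop_apply T x"
  by (transfer, simp add: blinfun.add_left blinfun.diff_left blinfun.scaleR_left
      bounded_linear_Blinfun_apply bounded_linear_scaleC)+

lemma bop_eqI: "(\<And>x. bop_apply S x = bop_apply T x) \<Longrightarrow> S = T"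
  by transfer (rule blinfun_eqI)

lemma bounded_linear_bop_apply: "bounded_linear (bop_apply T)"
  by transfer (rule blinfun.bounded_linear_right)

lemma bop_apply_scaleC: "bop_apply T (c *\<^sub>C x) = c *\<^sub>C bop_apply T x"
  by transfer simp

lemma bop_exists:
  assumes "bounded_linear f" and "\<And>c x. f (c *\<^sub>C x) = c *\<^sub>C f x"
  shows "\<exists>T :: 'h::complex_inner bop. \<forall>x. bop_apply T x = f x"
proof -
  have "Blinfun f \<in> {T. \<forall>c x. blinfun_apply T (c *\<^sub>C x) = c *\<^sub>C blinfun_apply T x}"
    using assms by (simp add: bounded_linear_Blinfun_apply)
  then have "bop_apply (Abs_bop (Blinfun f)) x = f x" for x
    by (simp add: bop_apply.rep_eq Abs_bop_inverse bounded_linear_Blinfun_apply assms(1))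
  then show ?thesis by blast
qed

definition adj :: "'h::chilbert_space bop \<Rightarrow> 'h bop" where
  "adj T = (THE S. \<forall>x y. cinner (bop_apply T x) y = cinner x (bop_apply S y))"

lemma adj_exists:
  fixes T :: "'h::chilbert_space bop"
  shows "\<exists>S. \<forall>x y. cinner (bop_apply T x) y = cinner x (bop_apply S y)"
proof -
  interpret T: bounded_linear "bop_apply T" by (rule bounded_linear_bop_apply)
  have cs: "cmod (cinner x y) \<le> 2 * (norm x * norm y)" for x y :: 'h
  proof -
    have "\<bar>Re (cinner u y)\<bar> \<le> norm u * norm y" for u
      using Re_cinner_le[of u y] Re_cinner_le[of "- u" y] by (simp add: cinner_minus_left)
    from this[of x] this[of "\<i> *\<^sub>C x"] have "\<bar>Re (cinner x y)\<bar> \<le> norm x * norm y"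
        "\<bar>Im (cinner x y)\<bar> \<le> norm x * norm y"
      by (simp_all add: cinner_scaleC_left norm_scaleC)
    then show ?thesis using cmod_le[of "cinner x y"] by linarith
  qed
  have "\<exists>z. \<forall>x. cinner (bop_apply T x) y = cinner x z" for y
  proof (rule riesz_representation)
    have "bounded_linear (\<lambda>x. cinner x y)"
      by (rule bounded_linear_intro[of _ "2 * norm y"])
        (use cs[of _ y] in \<open>simp_all add: cinner_add_left cinner_scaleR_left scaleR_conv_of_real
          algebra_simps\<close>)
    from bounded_linear_compose[OF this bounded_linear_bop_apply]
    show "bounded_linear (\<lambda>x. cinner (bop_apply T x) y)" .
  qed (simp add: bop_apply_scaleC cinner_scaleC_left)
  then obtain g where g: "\<And>x y. cinner (bop_apply T x) y = cinner x (g y)" by metis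
  obtain K where K: "0 \<le> K" "\<And>x. norm (bop_apply T x) \<le> norm x * K"
    using T.nonneg_bounded by blast
  have "bounded_linear g"
  proof (rule bounded_linear_intro)
    show "g (x + y) = g x + g y" for x y
      by (rule cinner_eqI) (simp add: g[symmetric] cinner_add_right)
    show "g (r *\<^sub>R x) = r *\<^sub>R g x" for r x
      by (rule cinner_eqI) (simp add: g[symmetric] cinner_scaleR_right)
    show "norm (g y) \<le> norm y * K" for y
    proof (cases "g y = 0")
      case False
      have "(norm (g y))\<^sup>2 = Re (cinner (bop_apply T (g y)) y)"
        by (simp add: norm_sq_cinner g)
      also have "\<dots> \<le> norm (bop_apply T (g y)) * norm y" by (rule Re_cinner_le)
      also have "\<dots> \<le> norm (g y) * K * norm y" by (intro mult_right_mono K(2)) simp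
      finally show ?thesis using False by (simp add: power2_eq_square mult.commute)
    qed (simp add: K(1))
  qed
  moreover have "g (c *\<^sub>C x) = c *\<^sub>C g x" for c x
    by (rule cinner_eqI) (simp add: g[symmetric] cinner_scaleC_right)
  ultimately obtain S where "\<forall>x. bop_apply S x = g x" using bop_exists by blast
  then show ?thesis using g by (intro exI[of _ S]) simp
qed

lemma cinner_adj:
  fixes T :: "'h::chilbert_space bop"
  shows "cinner (bop_apply T x) y = cinner x (bop_apply (adj T) y)"
proof -
  obtain S where S: "\<forall>x y. cinner (bop_apply T x) y = cinner x (bop_apply S y)"
    using adj_exists by blast
  have "adj T = S"
    unfolding adj_def
  proof (rule the_equality[where P = "\<lambda>S. \<forall>x y. cinner (bop_apply T x) y = cinner x (bop_apply S y)"])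
    show "U = S" if "\<forall>x y. cinner (bop_apply T x) y = cinner x (bop_apply U y)" for U
      by (rule bop_eqI, rule cinner_eqI) (use S that in metis)
  qed (rule S)
  then show ?thesis using S by simp
qed


section \<open>Tracial von Neumann algebras and freeness\<close>

definition commutant :: "'h::chilbert_space bop set \<Rightarrow> 'h bop set" where
  "commutant S = {T. \<forall>A\<in>S. A * T = T * A}"

definition von_neumann_algebra :: "'h::chilbert_space bop set \<Rightarrow> bool" where
  "von_neumann_algebra M \<longleftrightarrow> (\<forall>T\<in>M. adj T \<in> M) \<and> commutant (commutant M) = M"

definition faithful_tracial_state ::
    "'h::chilbert_space bop set \<Rightarrow> ('h bop \<Rightarrow> complex) \<Rightarrow> bool" where
  "faithful_tracial_state M \<tau> \<longleftrightarrow>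
     (\<forall>a\<in>M. \<forall>b\<in>M. \<tau> (a + b) = \<tau> a + \<tau> b) \<and>
     (\<forall>a\<in>M. \<forall>c. \<tau> (c *\<^sub>C a) = c * \<tau> a) \<and>
     \<tau> 1 = 1 \<and>
     (\<forall>a\<in>M. \<tau> (adj a * a) \<in> \<real>\<^sub>\<ge>\<^sub>0) \<and>
     (\<forall>a\<in>M. \<forall>b\<in>M. \<tau> (a * b) = \<tau> (b * a)) \<and>
     (\<forall>a\<in>M. \<tau> (adj a * a) = 0 \<longrightarrow> a = 0)"

definition L2_norm :: "('h::chilbert_space bop \<Rightarrow> complex) \<Rightarrow> 'h bop \<Rightarrow> real" where
  "L2_norm \<tau> a = sqrt (Re (\<tau> (adj a * a)))"

definition unital_star_subalgebra :: "'h::chilbert_space bop set \<Rightarrow> bool" where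
  "unital_star_subalgebra B \<longleftrightarrow>
     1 \<in> B \<and>
     (\<forall>a\<in>B. \<forall>b\<in>B. a + b \<in> B \<and> a * b \<in> B) \<and>
     (\<forall>a\<in>B. adj a \<in> B \<and> (\<forall>c. c *\<^sub>C a \<in> B))"

text \<open>
  A family of unital subalgebras \<open>B i\<close> is free if \<open>\<tau> (a\<^sub>1 \<cdots> a\<^sub>k) = 0\<close> for all
  \<open>k \<ge> 1\<close> and all centred \<open>a\<^sub>j \<in> B (i\<^sub>j)\<close> with \<open>i\<^sub>j \<noteq> i\<^sub>j\<^sub>+\<^sub>1\<close>. A word is the list of the
  pairs \<open>(i\<^sub>j, a\<^sub>j)\<close>.
\<close>

definition free_family ::
    "('h::chilbert_space bop \<Rightarrow> complex) \<Rightarrow> 'i set \<Rightarrow> ('i \<Rightarrow> 'h bop set) \<Rightarrow> bool" where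
  "free_family \<tau> I B \<longleftrightarrow>
     (\<forall>w. w \<noteq> [] \<and> (\<forall>(i, a)\<in>set w. i \<in> I \<and> a \<in> B i \<and> \<tau> a = 0) \<and>
          successively (\<lambda>(i, a) (j, b). i \<noteq> j) w
        \<longrightarrow> \<tau> (prod_list (map snd w)) = 0)"

definition star_free ::
    "('h::chilbert_space bop \<Rightarrow> complex) \<Rightarrow> 'h bop set \<Rightarrow> 'h bop set \<Rightarrow> bool" where
  "star_free \<tau> S T \<longleftrightarrow>
     free_family \<tau> UNIV (\<lambda>i. unital_star_subalgebra hull (if i then S else T))"


section \<open>Free additive Brownian motion and free stochastic integrals\<close>

definition semicircular :: "('h::chilbert_space bop \<Rightarrow> complex) \<Rightarrow> real \<Rightarrow> 'h bop \<Rightarrow> bool" where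
  "semicircular \<tau> v a \<longleftrightarrow> adj a = a \<and>
     (\<forall>k. \<tau> (a ^ k) = complex_of_real
        (integral {- 2 * sqrt v .. 2 * sqrt v} (\<lambda>x. x ^ k * (sqrt (4 * v - x\<^sup>2) / (2 * pi * v)))))"

text \<open>Processes and filtrations are indexed by \<^typ>\<open>real\<close>; only times \<open>t \<ge> 0\<close> are relevant.\<close>

definition filtration ::
    "'h::chilbert_space bop set \<Rightarrow> (real \<Rightarrow> 'h bop set) \<Rightarrow> bool" where
  "filtration M F \<longleftrightarrow>
     (\<forall>t\<ge>0. von_neumann_algebra (F t) \<and> F t \<subseteq> M) \<and>
     (\<forall>s t. 0 \<le> s \<and> s \<le> t \<longrightarrow> F s \<subseteq> F t)"

definition free_additive_BM ::
    "('h::chilbert_space bop \<Rightarrow> complex) \<Rightarrow> (real \<Rightarrow> 'h bop set) \<Rightarrow> (real \<Rightarrow> 'h bop) \<Rightarrow> bool" where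
  "free_additive_BM \<tau> F X \<longleftrightarrow>
     X 0 = 0 \<and>
     (\<forall>t\<ge>0. X t \<in> F t \<and> adj (X t) = X t) \<and>
     (\<forall>s t. 0 \<le> s \<and> s < t \<longrightarrow>
        semicircular \<tau> (t - s) (X t - X s) \<and> star_free \<tau> (F s) {X t - X s})"

text \<open>
  A simple adapted process on \<open>[0, t]\<close> is given by a subdivision \<open>0 = p 0 < \<dots> < p N = t\<close>
  and values \<open>A j \<in> F (p j)\<close>, taken on \<open>[p j, p (j + 1))\<close>.
\<close>

definition simple_adapted ::
    "(real \<Rightarrow> 'h::chilbert_space bop set) \<Rightarrow> real \<Rightarrow> nat \<Rightarrow> (nat \<Rightarrow> real) \<Rightarrow> (nat \<Rightarrow> 'h bop) \<Rightarrow> bool" where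
  "simple_adapted F t N p A \<longleftrightarrow>
     p 0 = 0 \<and> p N = t \<and> (\<forall>j<N. p j < p (Suc j) \<and> A j \<in> F (p j))"

definition simple_process ::
    "nat \<Rightarrow> (nat \<Rightarrow> real) \<Rightarrow> (nat \<Rightarrow> 'h::chilbert_space bop) \<Rightarrow> real \<Rightarrow> 'h bop" where
  "simple_process N p A s = (\<Sum>j<N. indicat_real {p j ..< p (Suc j)} s *\<^sub>R A j)"

definition simple_integral ::
    "nat \<Rightarrow> (nat \<Rightarrow> real) \<Rightarrow> (nat \<Rightarrow> 'h::chilbert_space bop) \<Rightarrow> (real \<Rightarrow> 'h bop) \<Rightarrow> 'h bop" where
  "simple_integral N p A X = (\<Sum>j<N. A j * (X (p (Suc j)) - X (p j)))"

text \<open>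
  \<open>I\<close> is the free stochastic integral of \<open>U\<^sub>s dX\<^sub>s\<close> over \<open>[0, t]\<close>, i.e. the value at \<open>U\<close> of
  the \<open>L\<^sup>2\<close>-isometric extension of \<^const>\<open>simple_integral\<close>: there are simple adapted processes
  converging to \<open>U\<close> in \<open>L\<^sup>2([0, t]; L\<^sup>2(\<tau>))\<close> whose integrals converge to \<open>I\<close> in \<open>L\<^sup>2(\<tau>)\<close>.
\<close>

definition has_free_stochastic_integral ::
    "'h::chilbert_space bop set \<Rightarrow> ('h bop \<Rightarrow> complex) \<Rightarrow> (real \<Rightarrow> 'h bop set) \<Rightarrow> (real \<Rightarrow> 'h bop) \<Rightarrow>
     (real \<Rightarrow> 'h bop) \<Rightarrow> real \<Rightarrow> 'h bop \<Rightarrow> bool" where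
  "has_free_stochastic_integral M \<tau> F X U t I \<longleftrightarrow> I \<in> M \<and>
     (\<exists>N p A e.
        (\<forall>n. simple_adapted F t (N n) (p n) (A n)) \<and>
        (\<forall>n. ((\<lambda>s. (L2_norm \<tau> (U s - simple_process (N n) (p n) (A n) s))\<^sup>2) has_integral e n) {0..t}) \<and>
        e \<longlonglongrightarrow> 0 \<and>
        (\<lambda>n. L2_norm \<tau> (simple_integral (N n) (p n) (A n) X - I)) \<longlonglongrightarrow> 0)"

text \<open>
  The equation \<open>dY\<^sub>t = i Y\<^sub>t dX\<^sub>t - Y\<^sub>t dt / 2\<close>, \<open>Y\<^sub>0 = 1\<close>, in integrated form. The drift
  integral is taken with respect to the operator norm.
\<close>

definition free_unitary_BM ::
    "'h::chilbert_space bop set \<Rightarrow> ('h bop \<Rightarrow> complex) \<Rightarrow> (real \<Rightarrow> 'h bop) \<Rightarrow> bool" where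
  "free_unitary_BM M \<tau> Y \<longleftrightarrow>
     (\<exists>F X. filtration M F \<and> free_additive_BM \<tau> F X \<and>
        (\<forall>t\<ge>0. Y t \<in> F t \<and> adj (Y t) * Y t = 1 \<and> Y t * adj (Y t) = 1) \<and>
        Y 0 = 1 \<and>
        (\<forall>t\<ge>0. \<exists>I J. has_free_stochastic_integral M \<tau> F X Y t I \<and> (Y has_integral J) {0..t} \<and>
           Y t = 1 + \<i> *\<^sub>C I - (1/2) *\<^sub>R J))"


section \<open>The generating series\<close>

definition R_coeff ::
    "('h::chilbert_space bop \<Rightarrow> complex) \<Rightarrow> real \<Rightarrow> 'h bop \<Rightarrow> (real \<Rightarrow> 'h bop) \<Rightarrow> real \<Rightarrow> nat \<Rightarrow> nat \<Rightarrow> complex" where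
  "R_coeff \<tau> \<alpha> P Y t m n =
     (if m = 0 \<and> n = 0 then complex_of_real \<alpha>
      else complex_of_real (exp (t * real (m + n) / 2)) * \<tau> ((P * Y t) ^ m * (P * adj (Y t)) ^ n))"

definition phi ::
    "('h::chilbert_space bop \<Rightarrow> complex) \<Rightarrow> real \<Rightarrow> 'h bop \<Rightarrow> (real \<Rightarrow> 'h bop) \<Rightarrow> real \<Rightarrow> complex \<Rightarrow> complex \<Rightarrow> complex" where
  "phi \<tau> \<alpha> P Y t y z = (\<Sum>\<^sub>\<infinity>(m, n)\<in>UNIV. R_coeff \<tau> \<alpha> P Y t m n * y ^ m * z ^ n)"

definition f_fun ::
    "('h::chilbert_space bop \<Rightarrow> complex) \<Rightarrow> real \<Rightarrow> 'h bop \<Rightarrow> (real \<Rightarrow> 'h bop) \<Rightarrow> real \<Rightarrow> complex \<Rightarrow> complex \<Rightarrow> complex" where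
  "f_fun \<tau> \<alpha> P Y t y z = - 1 / phi \<tau> \<alpha> P Y t y z"

definition g_fun ::
    "('h::chilbert_space bop \<Rightarrow> complex) \<Rightarrow> real \<Rightarrow> 'h bop \<Rightarrow> (real \<Rightarrow> 'h bop) \<Rightarrow> real \<Rightarrow> complex \<Rightarrow> complex \<Rightarrow> complex" where
  "g_fun \<tau> \<alpha> P Y t y z = f_fun \<tau> \<alpha> P Y t
     (y * exp (of_real (\<alpha> * t) * y) / (1 + y)) (z * exp (of_real (\<alpha> * t) * z) / (1 + z))"

end

(* By freeness, the generating function only depends on alpha and on the moments of Y_t. The
   integral of Y dX over [s, t] is orthogonal to F_s and L2-close to Y_s (X_t - X_s), so expanding
   Y_t^n around Y_s to third order gives tau(Y_t^n) - tau(Y_s^n) up to O((t - s)^(3/2)). With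
   r_n = e^(nt/2) tau(Y_t^n) this is the system r_n' = - sum_d d r_d r_(n-d), i.e.
   eta_t = - y eta eta_y for eta = sum_n r_n y^n. Following the characteristics,
   y -> y e^(ty) / (1 + y) inverts eta.

   At a fixed time, for the unitary u = Y_t, which is free from P, Haagerup's factorisation turns
   the Neumann series of y P u into an alternating product of centred elements of the algebras of
   P and of u. In the product with the corresponding series for u*, only the middle junction can
   produce a non-centred element, so the trace of the product satisfies a 2 x 2 linear system. *)

theory Submission
  imports Defs "HOL-Complex_Analysis.Laurent_Convergence"
begin

section \<open>Bounded operators and traces\<close>

text \<open>Three obstacles shape the proof. \<open>has_free_stochastic_integral\<close> treats each
  end time separately, so the integral over [s, t] is a difference of limits of two unrelated
  families of simple processes, which have to be compared on [0, s] through the isometry. In the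
  expansion of moments, Cauchy-Schwarz handles two L2 factors, but the remainder contains three
  increments: one is absorbed by the operator bound 2 for a difference of unitaries, and the term in
  which two Brownian increments meet needs the fourth moment of the semicircle law. Finally,
  freeness concerns generated star-algebras while the factorisation uses resolvents, which are norm
  limits; so the trace must be shown norm continuous, from positivity, before alternating words can
  be replaced by their limits. The parameter c of the factorisation is chosen such that the
  resolvent of c u has trace 1 + \<alpha> y, that is, as the inverse moment series of u at \<alpha>
  y. Multiplied by the other scalars of the factorisation it becomes e^(t/2) y e^(\<alpha> t y) / (1
  + y), which explains the substitution defining \<open>g_fun\<close>.\<close>

instance chilbert_space \<subseteq> banach ..

lemma norm_bop_apply: "norm (bop_apply T x) \<le> norm T * norm x"
  by transfer (rule norm_blinfun)

lemma norm_bop_le: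
  assumes "0 \<le> b" and "\<And>x. norm (bop_apply T x) \<le> b * norm x"
  shows "norm T \<le> b"
  using assms by transfer (rule norm_blinfun_bound)

text \<open>Complex linearity survives pointwise limits, so these operators are a closed subspace of
  the bounded real-linear maps. Completeness is what makes Neumann series and the fixed point in
  \<open>tau_selfadjoint_le\<close> available.\<close>

instance bop :: (chilbert_space) banach
proof
  fix X :: "nat \<Rightarrow> 'a bop"
  assume "Cauchy X"
  then have "Cauchy (\<lambda>n. Rep_bop (X n))"
    by (simp add: Cauchy_def dist_norm norm_bop.rep_eq minus_bop.rep_eq)
  then obtain L where L: "(\<lambda>n. Rep_bop (X n)) \<longlonglongrightarrow> L"
    using Cauchy_convergent_iff convergent_def by blast
  have "blinfun_apply L (c *\<^sub>C x) = c *\<^sub>C blinfun_apply L x" for c x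
  proof (rule LIMSEQ_unique)
    show "(\<lambda>n. blinfun_apply (Rep_bop (X n)) (c *\<^sub>C x)) \<longlonglongrightarrow> blinfun_apply L (c *\<^sub>C x)"
      by (intro blinfun.tendsto L tendsto_const)
    have "(\<lambda>n. c *\<^sub>C blinfun_apply (Rep_bop (X n)) x) \<longlonglongrightarrow> c *\<^sub>C blinfun_apply L x"
      by (intro bounded_linear.tendsto[OF bounded_linear_scaleC] blinfun.tendsto L tendsto_const)
    moreover have "blinfun_apply (Rep_bop T) (c *\<^sub>C x) = c *\<^sub>C blinfun_apply (Rep_bop T) x" for T :: "'a bop"
      using Rep_bop[of T] by simp
    ultimately show "(\<lambda>n. blinfun_apply (Rep_bop (X n)) (c *\<^sub>C x)) \<longlonglongrightarrow> c *\<^sub>C blinfun_apply L x"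
      by simp
  qed
  then have R: "Rep_bop (Abs_bop L) = L" by (simp add: Abs_bop_inverse)
  have "X \<longlonglongrightarrow> Abs_bop L"
    using L unfolding LIMSEQ_def dist_norm norm_bop.rep_eq minus_bop.rep_eq R .
  then show "convergent X" by (auto simp: convergent_def)
qed

lemma scaleC_mult_left [simp]: "(c *\<^sub>C S) * T = c *\<^sub>C (S * (T :: 'h::complex_inner bop))"
  by (rule bop_eqI) simp

lemma scaleC_mult_right [simp]: "S * (c *\<^sub>C T) = c *\<^sub>C (S * (T :: 'h::complex_inner bop))"
  by (rule bop_eqI) (simp add: bop_apply_scaleC)

lemma scaleC_one [simp]: "1 *\<^sub>C (x :: 'a::complex_vector) = x"
  using scaleC_of_real[of 1 x] by simp

lemma scaleC_zero_left [simp]: "0 *\<^sub>C (x :: 'a::complex_vector) = 0"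
  using scaleC_of_real[of 0 x] by simp

lemma scaleC_minus_left: "(- c) *\<^sub>C (x :: 'a::complex_vector) = - (c *\<^sub>C x)"
  using scaleC_add_left[of c "- c" x] by (simp add: eq_neg_iff_add_eq_0 add.commute)

lemma scaleC_diff_left: "(c - d) *\<^sub>C (x :: 'a::complex_vector) = c *\<^sub>C x - d *\<^sub>C x"
  using scaleC_add_left[of c "- d" x] by (simp add: scaleC_minus_left)

lemma norm_scaleC_bop: "norm (c *\<^sub>C (T :: 'h::complex_inner bop)) \<le> cmod c * norm T"
proof (rule norm_bop_le)
  show "norm (bop_apply (c *\<^sub>C T) x) \<le> cmod c * norm T * norm x" for x
    using mult_left_mono[OF norm_bop_apply[of T x], of "cmod c"] by (simp add: norm_scaleC mult.assoc)
qed simp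

text \<open>An inequality only: on the zero space the identity has norm 0.\<close>

lemma norm_bop_one: "norm (1 :: 'h::complex_inner bop) \<le> 1"
  by (rule norm_bop_le) simp_all

lemma norm_bop_power: "norm (T ^ n) \<le> norm (T :: 'h::complex_inner bop) ^ n"
proof (induction n)
  case (Suc n)
  have "norm (T ^ Suc n) \<le> norm T * norm (T ^ n)" by (simp add: norm_mult_ineq)
  also have "\<dots> \<le> norm T * norm T ^ n" by (intro mult_left_mono Suc) simp
  finally show ?case by simp
qed (simp add: norm_bop_one)

section \<open>Adjoints, unitaries and projections\<close>

lemma adj_unique:
  assumes "\<And>x y. cinner (bop_apply T x) y = cinner x (bop_apply S y)"
  shows "adj T = S"
  by (rule bop_eqI, rule cinner_eqI) (simp add: cinner_adj[symmetric] assms)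

lemma cinner_adj': "cinner (bop_apply (adj T) x) y = cinner x (bop_apply T y)"
  by (metis cinner_adj cinner_commute)

lemma adj_adj [simp]: "adj (adj T) = T"
  by (rule adj_unique) (rule cinner_adj')

lemma adj_one [simp]: "adj 1 = 1"
  by (rule adj_unique) simp

lemma adj_add [simp]: "adj (S + T) = adj S + adj T"
  by (rule adj_unique) (simp add: cinner_add_left cinner_add_right cinner_adj)

lemma adj_mult [simp]: "adj (S * T) = adj T * adj S"
  by (rule adj_unique) (simp add: cinner_adj)

lemma adj_scaleC [simp]: "adj (c *\<^sub>C T) = cnj c *\<^sub>C adj T"
  by (rule adj_unique) (simp add: cinner_scaleC_left cinner_scaleC_right cinner_adj)

lemma adj_scaleR [simp]: "adj (r *\<^sub>R T) = r *\<^sub>R adj T"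
  using adj_scaleC[of "of_real r" T] by (simp add: scaleC_of_real)

lemma adj_minus [simp]: "adj (- T) = - adj T"
  using adj_scaleR[of "-1" T] by simp

lemma adj_zero [simp]: "adj 0 = 0"
  using adj_scaleR[of 0 0] by simp

lemma adj_diff [simp]: "adj (S - T) = adj S - adj T"
  using adj_add[of S "- T"] by simp

lemma adj_sum [simp]: "adj (sum f A) = (\<Sum>i\<in>A. adj (f i))"
  by (induction A rule: infinite_finite_induct) simp_all

lemma adj_power [simp]: "adj (T ^ n) = adj T ^ n"
  by (induction n) (simp_all add: power_commutes)

lemma norm_adj_le: "norm (adj T) \<le> norm T"
proof (rule norm_bop_le)
  fix y
  have "(norm (bop_apply (adj T) y))\<^sup>2 = Re (cinner (bop_apply T (bop_apply (adj T) y)) y)"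
    by (simp add: norm_sq_cinner cinner_adj)
  also have "\<dots> \<le> norm (bop_apply T (bop_apply (adj T) y)) * norm y" by (rule Re_cinner_le)
  also have "\<dots> \<le> (norm T * norm (bop_apply (adj T) y)) * norm y"
    by (intro mult_right_mono norm_bop_apply) simp
  finally show "norm (bop_apply (adj T) y) \<le> norm T * norm y"
    by (cases "bop_apply (adj T) y = 0") (simp_all add: power2_eq_square mult_ac)
qed simp

lemma norm_adj [simp]: "norm (adj T) = norm T"
  using norm_adj_le[of T] norm_adj_le[of "adj T"] by simp

definition unitary :: "'h::chilbert_space bop \<Rightarrow> bool" where
  "unitary u \<longleftrightarrow> adj u * u = 1 \<and> u * adj u = 1"

lemma unitary_one [simp]: "unitary 1"
  by (simp add: unitary_def)

lemma unitary_mult [simp]: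
  assumes "unitary u" "unitary v"
  shows "unitary (u * v)"
proof -
  have "adj v * adj u * (u * v) = adj v * (adj u * u) * v" by (simp only: mult.assoc)
  moreover have "u * v * (adj v * adj u) = u * (v * adj v) * adj u" by (simp only: mult.assoc)
  ultimately show ?thesis using assms by (simp add: unitary_def)
qed

lemma unitary_adj [simp]: "unitary (adj u) = unitary u"
  by (auto simp: unitary_def)

lemma unitary_power [simp]: "unitary u \<Longrightarrow> unitary (u ^ n)"
  by (induction n) simp_all

lemma unitary_cancel:
  assumes "unitary u"
  shows "adj u * (u * x) = x" "u * (adj u * x) = x"
  using assms by (simp_all add: unitary_def flip: mult.assoc)

lemma norm_unitary_le:
  assumes "unitary u"
  shows "norm u \<le> 1"
proof (rule norm_bop_le)
  fix x
  have "bop_apply (adj u * u) x = x" using assms by (simp add: unitary_def)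
  then have "(norm (bop_apply u x))\<^sup>2 = (norm x)\<^sup>2" by (simp add: norm_sq_cinner cinner_adj)
  then show "norm (bop_apply u x) \<le> 1 * norm x" by simp
qed simp

lemma norm_projection_le:
  assumes "adj P = P" "P * P = P"
  shows "norm P \<le> 1"
proof (rule norm_bop_le)
  fix x
  have "bop_apply P (bop_apply P x) = bop_apply P x" using assms(2) by (metis bop_apply_simps(2))
  then have "cinner (bop_apply P x) (bop_apply P x) = cinner (bop_apply P x) x"
    using cinner_adj[of P "bop_apply P x" x] assms(1) by simp
  then have "(norm (bop_apply P x))\<^sup>2 = Re (cinner (bop_apply P x) x)" by (simp add: norm_sq_cinner)
  also have "\<dots> \<le> norm (bop_apply P x) * norm x" by (rule Re_cinner_le)
  finally show "norm (bop_apply P x) \<le> 1 * norm x"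
    by (cases "bop_apply P x = 0") (simp_all add: power2_eq_square)
qed simp

section \<open>Commutants, norm closure and star-subalgebras\<close>

lemma commutant_closed:
  assumes "\<And>n::nat. X n \<in> commutant S" "X \<longlonglongrightarrow> L"
  shows "L \<in> commutant S"
  unfolding commutant_def
proof safe
  fix A assume A: "A \<in> S"
  have "(\<lambda>n. A * X n) \<longlonglongrightarrow> A * L" "(\<lambda>n. X n * A) \<longlonglongrightarrow> L * A"
    by (intro tendsto_intros assms)+
  moreover have "A * X n = X n * A" for n using assms(1) A by (auto simp: commutant_def)
  ultimately show "A * L = L * A" using LIMSEQ_unique by simp
qed

lemma commutant_subalgebra:
  "1 \<in> commutant S"
  "a \<in> commutant S \<Longrightarrow> b \<in> commutant S \<Longrightarrow> a + b \<in> commutant S"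
  "a \<in> commutant S \<Longrightarrow> b \<in> commutant S \<Longrightarrow> a * b \<in> commutant S"
  "a \<in> commutant S \<Longrightarrow> c *\<^sub>C a \<in> commutant S"
proof -
  show "a * b \<in> commutant S" if a: "a \<in> commutant S" and b: "b \<in> commutant S"
    unfolding commutant_def
  proof safe
    fix A assume A: "A \<in> S"
    have "A * (a * b) = a * A * b" using A a by (simp add: commutant_def flip: mult.assoc)
    also have "\<dots> = a * b * A" using A b by (simp add: commutant_def mult.assoc)
    finally show "A * (a * b) = a * b * A" .
  qed
qed (auto simp: commutant_def algebra_simps)

lemma von_neumann_subalgebra:
  assumes "von_neumann_algebra M"
  shows "unital_star_subalgebra M"
proof -
  have M: "commutant (commutant M) = M" "\<forall>T\<in>M. adj T \<in> M"
    using assms by (auto simp: von_neumann_algebra_def)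
  show ?thesis unfolding unital_star_subalgebra_def
    using commutant_subalgebra[where S = "commutant M"] M by auto
qed

text \<open>\<open>M\<close> equals its double commutant, hence is itself a commutant, and
  commutants are norm closed because multiplication is continuous. Sums of Neumann series thereby
  stay in \<open>M\<close>.\<close>

lemma von_neumann_closed:
  assumes "von_neumann_algebra M" "\<And>n::nat. X n \<in> M" "X \<longlonglongrightarrow> L"
  shows "L \<in> M"
proof -
  have M: "commutant (commutant M) = M" using assms(1) by (simp add: von_neumann_algebra_def)
  show ?thesis using commutant_closed[of X "commutant M" L] assms(2,3) unfolding M by blast
qed

named_theorems star_closed

locale star_subalgebra =
  fixes B :: "'h::chilbert_space bop set"
  assumes B: "unital_star_subalgebra B"
begin

lemma closed_one [star_closed]: "1 \<in> B"
  and closed_add [star_closed]: "a \<in> B \<Longrightarrow> b \<in> B \<Longrightarrow> a + b \<in> B"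
  and closed_mult [star_closed]: "a \<in> B \<Longrightarrow> b \<in> B \<Longrightarrow> a * b \<in> B"
  and closed_adj [star_closed]: "a \<in> B \<Longrightarrow> adj a \<in> B"
  and closed_scaleC [star_closed]: "a \<in> B \<Longrightarrow> c *\<^sub>C a \<in> B"
  using B by (auto simp: unital_star_subalgebra_def)

lemma closed_scaleR [star_closed]: "a \<in> B \<Longrightarrow> r *\<^sub>R a \<in> B"
  using closed_scaleC[of a "of_real r"] by (simp add: scaleC_of_real)

lemma closed_minus [star_closed]: "a \<in> B \<Longrightarrow> - a \<in> B"
  using closed_scaleR[of a "-1"] by simp

lemma closed_zero [star_closed]: "0 \<in> B"
  using closed_scaleR[OF closed_one, of 0] by simp

lemma closed_diff [star_closed]: "a \<in> B \<Longrightarrow> b \<in> B \<Longrightarrow> a - b \<in> B"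
  using closed_add[of a "- b"] by (simp add: closed_minus)

lemma closed_sum [star_closed]: "(\<And>i. i \<in> A \<Longrightarrow> f i \<in> B) \<Longrightarrow> sum f A \<in> B"
  by (induction A rule: infinite_finite_induct) (simp_all add: closed_zero closed_add)

lemma closed_power [star_closed]: "a \<in> B \<Longrightarrow> a ^ n \<in> B"
  by (induction n) (simp_all add: closed_one closed_mult)

end

section \<open>The trace and its L2 norm\<close>

locale tracial_vna =
  fixes M :: "'h::chilbert_space bop set" and \<tau> :: "'h bop \<Rightarrow> complex"
  assumes vna: "von_neumann_algebra M" and trace: "faithful_tracial_state M \<tau>"
begin

sublocale star_subalgebra M
  by unfold_locales (rule von_neumann_subalgebra[OF vna])

lemma tau_add: "a \<in> M \<Longrightarrow> b \<in> M \<Longrightarrow> \<tau> (a + b) = \<tau> a + \<tau> b"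
  and tau_scaleC: "a \<in> M \<Longrightarrow> \<tau> (c *\<^sub>C a) = c * \<tau> a"
  and tau_one: "\<tau> 1 = 1"
  and tau_nonneg: "a \<in> M \<Longrightarrow> \<tau> (adj a * a) \<in> \<real>\<^sub>\<ge>\<^sub>0"
  and tau_commute: "a \<in> M \<Longrightarrow> b \<in> M \<Longrightarrow> \<tau> (a * b) = \<tau> (b * a)"
  and tau_faithful: "a \<in> M \<Longrightarrow> \<tau> (adj a * a) = 0 \<Longrightarrow> a = 0"
  using trace by (auto simp: faithful_tracial_state_def)

lemma tau_scaleR: "a \<in> M \<Longrightarrow> \<tau> (r *\<^sub>R a) = of_real r * \<tau> a"
  using tau_scaleC[of a "of_real r"] by (simp add: scaleC_of_real)

lemma tau_minus: "a \<in> M \<Longrightarrow> \<tau> (- a) = - \<tau> a"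
  using tau_scaleR[of a "-1"] by simp

lemma tau_zero: "\<tau> 0 = 0"
  using tau_scaleR[OF closed_one, of 0] by simp

lemma tau_diff: "a \<in> M \<Longrightarrow> b \<in> M \<Longrightarrow> \<tau> (a - b) = \<tau> a - \<tau> b"
  using tau_add[of a "- b"] by (simp add: tau_minus star_closed)

lemma tau_sum: "(\<And>i. i \<in> A \<Longrightarrow> f i \<in> M) \<Longrightarrow> \<tau> (sum f A) = (\<Sum>i\<in>A. \<tau> (f i))"
  by (induction A rule: infinite_finite_induct) (simp_all add: tau_zero tau_add star_closed)

lemmas tau_linear = tau_add tau_diff tau_minus tau_scaleC tau_scaleR tau_one tau_zero

text \<open>Positivity makes \<tau> real on \<open>adj x * x\<close>. For x = a + c 1 this shows
  that c \<tau>(adj a) + cnj c \<tau>(a) is real; c = 1 and c = i then give the imaginary and the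
  real part.\<close>

lemma tau_adj:
  assumes a: "a \<in> M"
  shows "\<tau> (adj a) = cnj (\<tau> a)"
proof -
  have *: "Im (\<tau> (adj x * x)) = 0" if "x \<in> M" for x
    using tau_nonneg[OF that] complex_is_Real_iff nonneg_Reals_subset_Reals by blast
  have "Im (c * \<tau> (adj a) + cnj c * \<tau> a) = 0" for c
  proof -
    have "adj (a + c *\<^sub>C 1) * (a + c *\<^sub>C 1)
        = adj a * a + c *\<^sub>C adj a + cnj c *\<^sub>C a + (cnj c * c) *\<^sub>C 1"
      by (simp add: algebra_simps scaleC_scaleC scaleC_add_right)
    then show ?thesis
      using *[of "a + c *\<^sub>C 1"] *[OF a] a by (simp add: tau_linear star_closed)
  qed
  from this[of 1] this[of \<i>] show ?thesis by (simp add: complex_eq_iff)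
qed

abbreviation N where "N \<equiv> L2_norm \<tau>"

lemma tau_adj_mult_self: "a \<in> M \<Longrightarrow> \<tau> (adj a * a) = complex_of_real ((N a)\<^sup>2)"
  using tau_nonneg[of a] by (simp add: L2_norm_def complex_nonneg_Reals_iff complex_eq_iff)

lemma N_nonneg [simp]: "0 \<le> N a" if "a \<in> M"
  using tau_nonneg[OF that] by (simp add: L2_norm_def complex_nonneg_Reals_iff)

lemma N_zero [simp]: "N 0 = 0"
  by (simp add: L2_norm_def tau_zero)

lemma N_adj: "a \<in> M \<Longrightarrow> N (adj a) = N a"
  by (simp add: L2_norm_def tau_commute star_closed)

lemma N_scaleC:
  assumes a: "a \<in> M"
  shows "N (c *\<^sub>C a) = cmod c * N a"
proof -
  have "complex_of_real ((N (c *\<^sub>C a))\<^sup>2) = (cnj c * c) * complex_of_real ((N a)\<^sup>2)"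
    unfolding tau_adj_mult_self[OF a, symmetric] tau_adj_mult_self[OF closed_scaleC[OF a], symmetric]
    using a by (simp add: scaleC_scaleC tau_linear star_closed)
  also have "cnj c * c = complex_of_real ((cmod c)\<^sup>2)"
    using complex_norm_square[of c] by (simp add: mult.commute)
  finally have "(N (c *\<^sub>C a))\<^sup>2 = (cmod c * N a)\<^sup>2"
    unfolding of_real_mult[symmetric] of_real_eq_iff power_mult_distrib .
  then show ?thesis using a by (simp add: star_closed)
qed

lemma N_scaleR: "a \<in> M \<Longrightarrow> N (r *\<^sub>R a) = \<bar>r\<bar> * N a"
  using N_scaleC[of a "of_real r"] by (simp add: scaleC_of_real)

lemma N_minus: "a \<in> M \<Longrightarrow> N (- a) = N a"
  using N_scaleR[of a "-1"] by simp

lemma tau_Cauchy_Schwarz: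
  assumes a: "a \<in> M" and b: "b \<in> M"
  shows "cmod (\<tau> (adj a * b)) \<le> N a * N b"
proof (cases "N a = 0")
  case True
  then have "a = 0" using tau_adj_mult_self[OF a] tau_faithful[OF a] by simp
  then show ?thesis by (simp add: tau_zero)
next
  case False
  define z where "z = \<tau> (adj a * b)"
  \<comment> \<open>The coefficient of the orthogonal projection of \<open>b\<close> onto
    \<open>a\<close>; positivity of the squared norm of b - k a is the inequality.\<close>
  define k where "k = z / of_real ((N a)\<^sup>2)"
  have ba: "\<tau> (adj b * a) = cnj z"
    using tau_adj[of "adj a * b"] a b by (simp add: z_def star_closed)
  have "\<tau> (adj (b - k *\<^sub>C a) * (b - k *\<^sub>C a))
      = of_real ((N b)\<^sup>2) - cnj k * z - k * cnj z + cnj k * k * of_real ((N a)\<^sup>2)"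
    using a b by (simp add: algebra_simps scaleC_scaleC tau_linear star_closed ba scaleC_diff_right
        tau_adj_mult_self flip: z_def)
  also have "\<dots> = of_real ((N b)\<^sup>2 - (cmod z)\<^sup>2 / (N a)\<^sup>2)"
    using False by (simp add: k_def complex_norm_square field_simps del: of_real_power)
  finally have "0 \<le> (N b)\<^sup>2 - (cmod z)\<^sup>2 / (N a)\<^sup>2"
    using tau_nonneg[of "b - k *\<^sub>C a"] a b by (simp add: star_closed complex_nonneg_Reals_iff del: of_real_diff of_real_divide)
  then have "(cmod z)\<^sup>2 \<le> (N a * N b)\<^sup>2"
    using False by (simp add: field_simps power_mult_distrib)
  then show ?thesis using a b by (simp add: z_def power2_le_iff_abs_le)
qed

lemma tau_mult_le: "a \<in> M \<Longrightarrow> b \<in> M \<Longrightarrow> cmod (\<tau> (a * b)) \<le> N a * N b"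
  using tau_Cauchy_Schwarz[of "adj a" b] by (simp add: star_closed N_adj)

lemma tau_le_N: "a \<in> M \<Longrightarrow> cmod (\<tau> a) \<le> N a"
  using tau_mult_le[OF closed_one] by (simp add: L2_norm_def tau_one)

lemma N_add_sq:
  assumes "a \<in> M" "b \<in> M"
  shows "(N (a + b))\<^sup>2 = (N a)\<^sup>2 + (N b)\<^sup>2 + 2 * Re (\<tau> (adj a * b))"
proof -
  have ba: "\<tau> (adj b * a) = cnj (\<tau> (adj a * b))"
    using tau_adj[of "adj a * b"] assms by (simp add: star_closed)
  have "\<tau> (adj (a + b) * (a + b)) = of_real ((N a)\<^sup>2) + of_real ((N b)\<^sup>2) + (\<tau> (adj a * b) + cnj (\<tau> (adj a * b)))"
    using assms by (simp add: algebra_simps tau_linear star_closed ba tau_adj_mult_self)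
  then have "of_real ((N (a + b))\<^sup>2) = complex_of_real ((N a)\<^sup>2 + (N b)\<^sup>2 + 2 * Re (\<tau> (adj a * b)))"
    using assms tau_adj_mult_self[of "a + b"] by (simp add: star_closed complex_add_cnj)
  then show ?thesis using of_real_eq_iff by blast
qed

lemma N_triangle:
  assumes "a \<in> M" "b \<in> M"
  shows "N (a + b) \<le> N a + N b"
proof -
  have "Re (\<tau> (adj a * b)) \<le> N a * N b"
    using tau_Cauchy_Schwarz[OF assms] complex_Re_le_cmod order_trans by blast
  then have "(N (a + b))\<^sup>2 \<le> (N a + N b)\<^sup>2"
    using N_add_sq[OF assms] by (simp add: power2_sum)
  then show ?thesis using assms by (simp add: power2_le_iff_abs_le star_closed)
qed

lemma N_triangle_diff: "a \<in> M \<Longrightarrow> b \<in> M \<Longrightarrow> N (a - b) \<le> N a + N b"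
  using N_triangle[of a "- b"] by (simp add: star_closed N_minus)

lemma N_sum: "(\<And>i. i \<in> A \<Longrightarrow> f i \<in> M) \<Longrightarrow> N (sum f A) \<le> (\<Sum>i\<in>A. N (f i))"
proof (induction A rule: infinite_finite_induct)
  case (insert x F)
  have "N (f x + sum f F) \<le> N (f x) + N (sum f F)"
    by (rule N_triangle) (simp_all add: insert star_closed)
  then show ?case using insert by fastforce
qed simp_all

lemma N_diff_sq_le:
  assumes "a \<in> M" "b \<in> M"
  shows "(N (a - b))\<^sup>2 \<le> 2 * (N a)\<^sup>2 + 2 * (N b)\<^sup>2"
proof -
  have "(N (a - b))\<^sup>2 \<le> (N a + N b)\<^sup>2"
    using assms by (intro power_mono N_triangle_diff) (simp_all add: star_closed)
  also have "\<dots> \<le> 2 * (N a)\<^sup>2 + 2 * (N b)\<^sup>2"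
    using zero_le_power2[of "N a - N b"] by (simp add: power2_sum power2_diff)
  finally show ?thesis .
qed

lemma N_unitary_left:
  assumes "u \<in> M" "unitary u" "a \<in> M"
  shows "N (u * a) = N a"
  using assms by (simp add: L2_norm_def mult.assoc unitary_cancel)

lemma N_unitary_right:
  assumes "u \<in> M" "unitary u" "a \<in> M"
  shows "N (a * u) = N a"
  using N_unitary_left[of "adj u" "adj a"] N_adj[of "a * u"] N_adj[of a] assms
  by (simp add: star_closed)

lemma N_unitary: "unitary u \<Longrightarrow> N u = 1"
  by (simp add: L2_norm_def unitary_def tau_one)

text \<open>The fixed point \<open>w\<close> of \<open>w \<mapsto> (h + w\<^sup>2) / 2\<close> satisfies \<open>(1 - w)\<^sup>2 = 1 - h\<close>.\<close>

lemma tau_selfadjoint_le: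
  assumes h: "h \<in> M" "adj h = h" "norm h \<le> 3 / 4"
  shows "Re (\<tau> h) \<le> 1"
proof -
  define W where "W = {w \<in> M. adj w = w \<and> norm w \<le> 1 / 2}"
  define f where "f = (\<lambda>w. (1 / 2) *\<^sub>R (h + w * w))"
  have "\<exists>!w. w \<in> W \<and> f w = w"
  proof (rule Banach_fix)
    show "complete W" unfolding complete_def
    proof safe
      fix X assume X: "\<forall>n. X n \<in> W" and "Cauchy X"
      then obtain L where L: "X \<longlonglongrightarrow> L" using Cauchy_convergent_iff convergent_def by blast
      have "L \<in> M" using X by (intro von_neumann_closed[OF vna _ L]) (auto simp: W_def)
      moreover have "norm L \<le> 1 / 2"
      proof (rule LIMSEQ_le_const2[OF tendsto_norm[OF L]])
        show "\<exists>N. \<forall>n\<ge>N. norm (X n) \<le> 1 / 2" using X unfolding W_def by blast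
      qed
      moreover have "adj L = L"
      proof -
        have "(\<lambda>n. norm (X n - L)) \<longlonglongrightarrow> 0" by (intro tendsto_norm_zero LIM_zero L)
        moreover have "norm (X n - adj L) = norm (X n - L)" for n
          using X norm_adj[of "X n - L"] by (simp add: W_def)
        ultimately have "(\<lambda>n. norm (X n - adj L)) \<longlonglongrightarrow> 0" by simp
        then have "X \<longlonglongrightarrow> adj L" by (rule LIM_zero_cancel[OF tendsto_norm_zero_cancel])
        then show ?thesis using L LIMSEQ_unique by blast
      qed
      ultimately show "\<exists>l\<in>W. X \<longlonglongrightarrow> l" using L by (auto simp: W_def)
    qed
    have "0 \<in> W" using closed_zero by (simp add: W_def)
    then show "W \<noteq> {}" by blast
    show "0 \<le> (1 / 2 :: real)" "1 / 2 < (1 :: real)" by simp_all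
    show "f ` W \<subseteq> W"
    proof safe
      fix w assume w: "w \<in> W"
      have "norm (h + w * w) \<le> norm h + norm w * norm w"
        using norm_triangle_ineq[of h "w * w"] norm_mult_ineq[of w w] by linarith
      \<comment> \<open>3/4 + 1/4 = 1: this is why \<open>norm h \<le> 3 / 4\<close> goes with the
        ball of radius 1/2, on which \<open>f\<close> contracts by 1/2.\<close>
      also have "\<dots> \<le> 3 / 4 + 1 / 2 * (1 / 2)"
        using w h by (intro add_mono mult_mono) (auto simp: W_def)
      finally have "norm (f w) \<le> 1 / 2" by (simp add: f_def)
      then show "f w \<in> W" using w h by (simp add: W_def f_def star_closed)
    qed
    show "dist (f x) (f y) \<le> 1 / 2 * dist x y" if xy: "x \<in> W" "y \<in> W" for x y
    proof -
      have "f x - f y = (1 / 2) *\<^sub>R (x * (x - y) + (x - y) * y)"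
        by (simp add: f_def algebra_simps)
      moreover have "norm (x * (x - y) + (x - y) * y) \<le> norm x * norm (x - y) + norm (x - y) * norm y"
        by (rule order_trans[OF norm_triangle_ineq]) (intro add_mono norm_mult_ineq)
      moreover have "\<dots> \<le> 1 / 2 * norm (x - y) + norm (x - y) * (1 / 2)"
        using xy by (intro add_mono mult_mono) (auto simp: W_def)
      ultimately show "dist (f x) (f y) \<le> 1 / 2 * dist x y" by (simp add: dist_norm)
    qed
  qed
  then obtain w where w: "w \<in> M" "adj w = w" "f w = w" by (auto simp: W_def)
  have "2 *\<^sub>R f w = h + w * w" by (simp add: f_def)
  then have "2 *\<^sub>R w = h + w * w" using w by simp
  moreover have "adj (1 - w) * (1 - w) = 1 - 2 *\<^sub>R w + w * w"
    unfolding adj_diff adj_one w(2) by (simp add: algebra_simps scaleR_2)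
  ultimately have "adj (1 - w) * (1 - w) = 1 - h" by simp
  then show ?thesis
    using tau_nonneg[of "1 - w"] w h by (simp add: star_closed tau_linear complex_nonneg_Reals_iff)
qed

text \<open>Scaling a self-adjoint \<open>h\<close> to norm 3/4 in \<open>tau_selfadjoint_le\<close>
  gives Re \<tau>(h) \<le> 4/3 norm h. Taking h = \<open>adj a * a\<close> bounds the L2 norm by
  sqrt (4/3) norm a, rounded up to 2. Passing to norm limits under \<tau> rests on this.\<close>

lemma tau_bounded:
  assumes a: "a \<in> M"
  shows "N a \<le> 2 * norm a" "cmod (\<tau> a) \<le> 2 * norm a"
proof -
  have "Re (\<tau> h) \<le> 4 / 3 * norm h" if h: "h \<in> M" "adj h = h" for h
  proof (cases "h = 0")
    case False
    have "Re (\<tau> ((3 / 4 / norm h) *\<^sub>R h)) \<le> 1"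
      using h False by (intro tau_selfadjoint_le) (simp_all add: star_closed)
    then show ?thesis using False h by (simp add: tau_linear field_simps)
  qed (simp add: tau_zero)
  from this[of "adj a * a"] have "(N a)\<^sup>2 \<le> 4 / 3 * norm (adj a * a)"
    using a tau_adj_mult_self[OF a] by (simp add: star_closed)
  also have "\<dots> \<le> 4 / 3 * (norm a * norm a)"
    using norm_mult_ineq[of "adj a" a] by simp
  also have "\<dots> \<le> (2 * norm a)\<^sup>2" by (simp add: power2_eq_square)
  finally show *: "N a \<le> 2 * norm a"
    by (rule power2_le_imp_le) simp
  show "cmod (\<tau> a) \<le> 2 * norm a" using tau_le_N[OF a] * by simp
qed

lemma tau_tendsto:
  assumes "\<And>n::nat. X n \<in> M" "X \<longlonglongrightarrow> L"
  shows "(\<lambda>n. \<tau> (X n)) \<longlonglongrightarrow> \<tau> L"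
proof (rule LIM_zero_cancel, rule Lim_null_comparison)
  have L: "L \<in> M" using von_neumann_closed[OF vna assms] .
  show "\<forall>\<^sub>F n in sequentially. norm (\<tau> (X n) - \<tau> L) \<le> 2 * norm (X n - L)"
    using tau_bounded(2)[of "X n - L" for n] assms(1) L by (simp add: tau_diff star_closed)
  show "(\<lambda>n. 2 * norm (X n - L)) \<longlonglongrightarrow> 0"
    using tendsto_mult_right_zero[OF tendsto_norm_zero[OF LIM_zero[OF assms(2)]]] .
qed

lemma sums_in_M:
  assumes "\<And>n. X n \<in> M" "X sums L"
  shows "L \<in> M" "(\<lambda>n. \<tau> (X n)) sums \<tau> L"
proof -
  have S: "(\<Sum>k<n. X k) \<in> M" for n using assms(1) by (simp add: star_closed)
  show "L \<in> M" using von_neumann_closed[OF vna S] assms(2) by (simp add: sums_def)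
  show "(\<lambda>n. \<tau> (X n)) sums \<tau> L"
    using tau_tendsto[OF S] assms by (simp add: sums_def tau_sum)
qed

end

section \<open>Freeness and semicircular elements\<close>

lemma hull_subalgebra: "unital_star_subalgebra (unital_star_subalgebra hull S)"
  by (rule hull_in) (auto simp: unital_star_subalgebra_def)

locale free_pair = tracial_vna M \<tau> + A: star_subalgebra A + B: star_subalgebra B
  for M :: "'h::chilbert_space bop set" and \<tau> A B +
  assumes A_M: "A \<subseteq> M" and B_M: "B \<subseteq> M"
    and free: "free_family \<tau> UNIV (\<lambda>i. if i then A else B)"
begin

lemma free_word:
  assumes "w \<noteq> []" "\<forall>(i, a)\<in>set w. a \<in> (if i then A else B) \<and> \<tau> a = 0"
    "successively (\<lambda>(i, a) (j, b). i \<noteq> j) w"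
  shows "\<tau> (prod_list (map snd w)) = 0"
  using free assms unfolding free_family_def by auto

lemma tau_mult:
  assumes a: "a \<in> A" and b: "b \<in> B"
  shows "\<tau> (a * b) = \<tau> a * \<tau> b"
proof -
  define a' b' where "a' = a - \<tau> a *\<^sub>C 1" and "b' = b - \<tau> b *\<^sub>C 1"
  have M: "a \<in> M" "b \<in> M" using a b A_M B_M by auto
  have "\<tau> (prod_list (map snd [(True, a'), (False, b')])) = 0"
    by (rule free_word)
      (use a b M in \<open>auto simp: a'_def b'_def tau_linear star_closed A.closed_diff A.closed_scaleC
        A.closed_one B.closed_diff B.closed_scaleC B.closed_one\<close>)
  moreover have "a' * b' = a * b - \<tau> b *\<^sub>C a - \<tau> a *\<^sub>C b + (\<tau> a * \<tau> b) *\<^sub>C 1"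
    by (simp add: a'_def b'_def algebra_simps scaleC_scaleC scaleC_diff_right)
  ultimately show ?thesis using M by (simp add: tau_linear star_closed)
qed

text \<open>Centre \<open>a\<close> and \<open>b\<close> and expand: every word that keeps a centred
  part of \<open>a\<close> or \<open>b\<close> has trace 0 by freeness. With \<open>q\<close> and
  \<open>r\<close> built from a Brownian increment this is the source of the Ito correction.\<close>

lemma tau_mult_four:
  assumes a: "a \<in> A" and b: "b \<in> A" and q: "q \<in> B" "\<tau> q = 0" and r: "r \<in> B" "\<tau> r = 0"
  shows "\<tau> (a * q * b * r) = \<tau> a * \<tau> b * \<tau> (q * r)"
proof -
  define a' b' where "a' = a - \<tau> a *\<^sub>C 1" and "b' = b - \<tau> b *\<^sub>C 1"
  have M: "a \<in> M" "b \<in> M" "q \<in> M" "r \<in> M" using assms A_M B_M by auto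
  have a': "a' \<in> A" "\<tau> a' = 0" "a' \<in> M" and b': "b' \<in> A" "\<tau> b' = 0" "b' \<in> M"
    using a b M by (simp_all add: a'_def b'_def tau_linear star_closed A.closed_diff A.closed_scaleC A.closed_one)
  have 1: "\<tau> (prod_list (map snd [(True, a'), (False, q), (True, b'), (False, r)])) = 0"
    by (rule free_word) (use a' b' q r in auto)
  have 2: "\<tau> (prod_list (map snd [(False, q), (True, b'), (False, r)])) = 0"
    by (rule free_word) (use b' q r in auto)
  have 3: "\<tau> (a' * (q * r)) = 0"
    using tau_mult[OF a'(1) B.closed_mult[OF q(1) r(1)]] a' by simp
  have "a * q * b * r = (a' + \<tau> a *\<^sub>C 1) * q * (b' + \<tau> b *\<^sub>C 1) * r"
    by (simp add: a'_def b'_def)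
  also have "\<dots> = a' * (q * (b' * r)) + \<tau> a *\<^sub>C (q * (b' * r)) + \<tau> b *\<^sub>C (a' * (q * r))
      + (\<tau> a * \<tau> b) *\<^sub>C (q * r)"
    by (simp add: algebra_simps scaleC_scaleC scaleC_add_right)
  finally show ?thesis using 1 2 3 M a' b' by (simp add: tau_linear star_closed mult.assoc)
qed

end

lemma (in tracial_vna) star_free_pair:
  assumes "S \<subseteq> M" "T \<subseteq> M" "star_free \<tau> S T"
  shows "free_pair M \<tau> (unital_star_subalgebra hull S) (unital_star_subalgebra hull T)"
proof unfold_locales
  show "unital_star_subalgebra hull S \<subseteq> M" "unital_star_subalgebra hull T \<subseteq> M"
    using assms B by (simp_all add: hull_minimal)
  show "free_family \<tau> UNIV
      (\<lambda>i. if i then unital_star_subalgebra hull S else unital_star_subalgebra hull T)"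
    using assms(3) unfolding star_free_def by (simp add: if_distrib[of "\<lambda>x. unital_star_subalgebra hull x"])
qed (rule hull_subalgebra)+

section \<open>Moments of the semicircle law\<close>

lemma semicircle_moment_recursion:
  fixes v :: real and k :: nat
  assumes "0 < v"
  shows "((\<lambda>x. (4 * v * k * x ^ (k - 1) - (k + 3) * x ^ Suc k) * sqrt (4 * v - x\<^sup>2)) has_integral 0)
    {- 2 * sqrt v .. 2 * sqrt v}"
proof -
  \<comment> \<open>This is x^k (4v - x^2)^(3/2): it vanishes at both ends of the support, and its
    derivative is sqrt (4v - x^2) times a polynomial linking the moments of order k - 1 and k +
    1.\<close>
  let ?F = "\<lambda>x. x ^ k * ((4 * v - x\<^sup>2) * sqrt (4 * v - x\<^sup>2))"
  have "((\<lambda>x. (4 * v * k * x ^ (k - 1) - (k + 3) * x ^ Suc k) * sqrt (4 * v - x\<^sup>2)) has_integral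
      (?F (2 * sqrt v) - ?F (- 2 * sqrt v))) {- 2 * sqrt v .. 2 * sqrt v}"
  proof (rule fundamental_theorem_of_calculus_interior)
    show "continuous_on {- 2 * sqrt v..2 * sqrt v} ?F" by (intro continuous_intros)
    fix x assume x: "x \<in> {- 2 * sqrt v<..<2 * sqrt v}"
    then have "\<bar>x\<bar> < 2 * sqrt v" by auto
    then have "\<bar>x\<bar>\<^sup>2 < (2 * sqrt v)\<^sup>2" by (intro power_strict_mono) auto
    then have pos: "4 * v - x\<^sup>2 > 0" using assms by (simp add: power_mult_distrib)
    define s where "s = sqrt (4 * v - x\<^sup>2)"
    have s: "s > 0" "4 * v - x\<^sup>2 = s * s" using pos by (simp_all add: s_def)
    have "(?F has_real_derivative (k * x ^ (k - 1)) * ((4 * v - x\<^sup>2) * s)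
        + x ^ k * ((- 2 * x) * s + (4 * v - x\<^sup>2) * (- 2 * x / (2 * s)))) (at x)"
      unfolding s_def using pos by (auto intro!: derivative_eq_intros simp: field_simps)
    also have "(k * x ^ (k - 1)) * ((4 * v - x\<^sup>2) * s)
        + x ^ k * ((- 2 * x) * s + (4 * v - x\<^sup>2) * (- 2 * x / (2 * s)))
      = (4 * v * k * x ^ (k - 1) - (k + 3) * x ^ Suc k) * s"
    proof -
      define p q where "p = x ^ k" and "q = k * x ^ (k - 1)"
      have 1: "(4 * v - x\<^sup>2) * (- 2 * x / (2 * s)) = - x * s" using s by simp
      have 2: "q * x\<^sup>2 = k * (x * p)" unfolding p_def q_def by (cases k) (simp_all add: power2_eq_square)
      have "q * ((4 * v - x\<^sup>2) * s) + p * ((- 2 * x) * s + (4 * v - x\<^sup>2) * (- 2 * x / (2 * s)))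
          = (4 * v * q - q * x\<^sup>2 - 3 * (x * p)) * s"
        unfolding 1 by (simp add: algebra_simps)
      also have "\<dots> = (4 * v * q - (k + 3) * (x * p)) * s"
        unfolding 2 by (simp add: algebra_simps)
      finally show ?thesis by (simp add: p_def q_def mult.assoc)
    qed
    finally show "(?F has_vector_derivative (4 * v * k * x ^ (k - 1) - (k + 3) * x ^ Suc k) * sqrt (4 * v - x\<^sup>2)) (at x)"
      by (simp add: has_real_derivative_iff_has_vector_derivative s_def)
  qed (use assms in simp)
  moreover have "(2 * sqrt v)\<^sup>2 = 4 * v" "(- 2 * sqrt v)\<^sup>2 = 4 * v" using assms by (simp_all add: power_mult_distrib)
  ultimately show ?thesis by simp
qed

lemma (in tracial_vna) semicircular_moments:
  assumes a: "semicircular \<tau> v a" and v: "0 < v"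
  shows "\<tau> a = 0" "\<tau> (a * a) = of_real v" "\<tau> (a * a * (a * a)) = of_real (2 * v\<^sup>2)"
proof -
  define D where "D = {- 2 * sqrt v .. 2 * sqrt v}"
  define J where "J k = integral D (\<lambda>x. x ^ k * sqrt (4 * v - x\<^sup>2))" for k :: nat
  have J: "((\<lambda>x. x ^ k * sqrt (4 * v - x\<^sup>2)) has_integral J k) D" for k
    unfolding J_def D_def by (intro integrable_integral integrable_continuous_real continuous_intros)
  have m: "\<tau> (a ^ k) = of_real (J k / (2 * pi * v))" for k
    using a v by (simp add: semicircular_def J_def D_def)
  have rec: "4 * v * k * J (k - 1) = (k + 3) * J (Suc k)" for k
  proof -
    have 1: "((\<lambda>x. 4 * v * k * (x ^ (k - 1) * sqrt (4 * v - x\<^sup>2)) - (k + 3) * (x ^ Suc k * sqrt (4 * v - x\<^sup>2)))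
        has_integral (4 * v * k * J (k - 1) - (k + 3) * J (Suc k))) D"
      by (intro has_integral_diff has_integral_mult_right J)
    have 2: "((\<lambda>x. 4 * v * k * (x ^ (k - 1) * sqrt (4 * v - x\<^sup>2)) - (k + 3) * (x ^ Suc k * sqrt (4 * v - x\<^sup>2)))
        has_integral 0) D"
      using semicircle_moment_recursion[OF v, of k] by (simp add: D_def algebra_simps)
    show ?thesis using has_integral_unique[OF 1 2] by simp
  qed
  \<comment> \<open>The area under the semicircle is read off from \<tau>(1) = 1, the moment of
    order 0, instead of being computed.\<close>
  have "complex_of_real (J 0 / (2 * pi * v)) = of_real 1" using m[of 0] by (simp add: tau_one)
  then have "J 0 / (2 * pi * v) = 1" by (simp only: of_real_eq_iff)
  then have J0: "J 0 = 2 * pi * v" using v by (simp add: field_simps)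
  have "J 1 = 0" using rec[of 0] by simp
  then show "\<tau> a = 0" using m[of 1] by simp
  have J2: "J 2 = v * J 0" using rec[of 1] by (simp add: numeral_2_eq_2)
  then show "\<tau> (a * a) = of_real v" using m[of 2] v by (simp add: J0 power2_eq_square)
  have J4: "J 4 = 2 * v * J 2" using rec[of 3] by (simp add: eval_nat_numeral)
  have a4: "a ^ 4 = a * a * (a * a)" by (simp add: eval_nat_numeral mult.assoc)
  show "\<tau> (a * a * (a * a)) = of_real (2 * v\<^sup>2)"
    using m[of 4] v unfolding a4 by (simp add: J4 J2 J0 power2_eq_square)
qed

section \<open>The free stochastic integral\<close>

lemma has_integral_indicator_Ico:
  fixes c d p q :: real
  assumes "c \<le> p" "q \<le> d"
  shows "(indicat_real {p..<q} has_integral max 0 (q - p)) {c..d}"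
proof (cases "p < q")
  case True
  have "((\<lambda>_. 1) has_integral (q - p)) {p..q}"
    using has_integral_const_real[of "1::real" p q] True by simp
  then have "((\<lambda>x. if x \<in> {p..q} then 1 else 0) has_integral (q - p)) {c..d}"
    using assms by (subst has_integral_restrict) auto
  then have "(indicat_real {p..<q} has_integral (q - p)) {c..d}"
    by (rule has_integral_spike_finite[of "{q}", rotated 2]) (auto simp: indicator_def)
  then show ?thesis using True by simp
next
  case False
  then have "indicat_real {p..<q} = (\<lambda>_. 0)" by auto
  then show ?thesis using False by simp
qed

lemma indicator_Ico_times_Ico:
  fixes s :: real
  shows "indicat_real {l..<r} s * indicat_real {l'..<r'} s = indicat_real {max l l'..<min r r'} s"
  by (auto simp: indicator_def max_def min_def)

lemma simple_adapted_bounds: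
  assumes "simple_adapted F t K p A" "j \<le> K"
  shows "0 \<le> p j" "p j \<le> t"
proof -
  have mono: "p i \<le> p k" if "i \<le> k" "k \<le> K" for i k
    using that
  proof (induction k)
    case (Suc k)
    show ?case
    proof (cases "i = Suc k")
      case False
      then have "p i \<le> p k" using Suc by simp
      moreover have "p k < p (Suc k)" using assms(1) Suc.prems by (simp add: simple_adapted_def)
      ultimately show ?thesis by simp
    qed simp
  qed simp
  show "0 \<le> p j" "p j \<le> t"
    using mono[of 0 j] mono[of j K] assms by (auto simp: simple_adapted_def)
qed

text \<open>The integral exists in operator norm but \<open>K\<close> bounds L2 norms, so the bound
  is applied to the Riemann sum of a fine division; its operator-norm distance to \<open>J\<close>
  controls the L2 distance by \<open>tau_bounded\<close>.\<close>

lemma (in tracial_vna) N_has_integral_le: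
  fixes f :: "real \<Rightarrow> 'h bop"
  assumes f: "\<And>q. q \<in> {s..t} \<Longrightarrow> f q \<in> M" "\<And>q. q \<in> {s..t} \<Longrightarrow> N (f q) \<le> K"
    and J: "(f has_integral J) {s..t}" "J \<in> M" and st: "s \<le> t"
  shows "N J \<le> K * (t - s)"
proof (rule field_le_epsilon)
  fix e :: real assume e: "0 < e"
  \<comment> \<open>Half of \<open>e\<close>, because the L2 norm is at most twice the operator
    norm.\<close>
  then obtain g where g: "gauge g"
    "\<And>D. D tagged_division_of {s..t} \<Longrightarrow> g fine D \<Longrightarrow>
      norm ((\<Sum>(x, k)\<in>D. measure lborel k *\<^sub>R f x) - J) < e / 2"
    using J(1) unfolding has_integral_real by (meson half_gt_zero)
  obtain D where D: "D tagged_division_of {s..t}" "g fine D"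
    using fine_division_exists_real[OF g(1)] by blast
  have mem: "x \<in> {s..t}" if "(x, k) \<in> D" for x k
    using tagged_division_ofD(2,3)[OF D(1) that] by auto
  define R where "R = (\<Sum>(x, k)\<in>D. measure lborel k *\<^sub>R f x)"
  have R_M: "R \<in> M" unfolding R_def using f mem by (auto intro!: closed_sum closed_scaleR)
  have "N R \<le> (\<Sum>(x, k)\<in>D. N (measure lborel k *\<^sub>R f x))"
    unfolding R_def by (rule order_trans[OF N_sum]) (use f mem in \<open>auto intro!: closed_scaleR sum_mono\<close>)
  also have "\<dots> \<le> (\<Sum>(x, k)\<in>D. measure lborel k * K)"
  proof (intro sum_mono, safe)
    fix x k assume "(x, k) \<in> D"
    then show "N (measure lborel k *\<^sub>R f x) \<le> measure lborel k * K"
      using f mem by (simp add: N_scaleR mult_left_mono)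
  qed
  also have "\<dots> = K * (\<Sum>(x, k)\<in>D. measure lborel k)"
    by (simp add: sum_distrib_left case_prod_unfold mult.commute)
  also have "(\<Sum>(x, k)\<in>D. measure lborel k) = t - s"
    using additive_content_tagged_division[of D s t] D(1) st by (simp add: case_prod_unfold)
  finally have "N R \<le> K * (t - s)" .
  moreover have "N (R - J) \<le> e"
    using tau_bounded(1)[of "R - J"] g(2)[OF D] R_M J(2) unfolding R_def[symmetric] by (simp add: star_closed)
  moreover have "N J \<le> N R + N (R - J)"
    using N_triangle_diff[of R "R - J"] R_M J(2) by (simp add: star_closed)
  ultimately show "N J \<le> K * (t - s) + e" by linarith
qed

section \<open>Increments of the free Brownian motion\<close>

locale free_BM = tracial_vna M \<tau> for M :: "'h::chilbert_space bop set" and \<tau> +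
  fixes F :: "real \<Rightarrow> 'h bop set" and X :: "real \<Rightarrow> 'h bop"
  assumes filt: "filtration M F" and bm: "free_additive_BM \<tau> F X"
begin

lemma F_M: "0 \<le> s \<Longrightarrow> a \<in> F s \<Longrightarrow> a \<in> M"
  using filt by (auto simp: filtration_def)

lemma F_mono: "0 \<le> s \<Longrightarrow> s \<le> t \<Longrightarrow> a \<in> F s \<Longrightarrow> a \<in> F t"
  using filt unfolding filtration_def by (meson order_trans subsetD)

lemma F_star_subalgebra: "0 \<le> s \<Longrightarrow> star_subalgebra (F s)"
  using filt by (auto simp: filtration_def star_subalgebra_def intro: von_neumann_subalgebra)

lemmas F_closed =
  star_subalgebra.closed_one[OF F_star_subalgebra] star_subalgebra.closed_add[OF F_star_subalgebra]
  star_subalgebra.closed_diff[OF F_star_subalgebra] star_subalgebra.closed_mult[OF F_star_subalgebra]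
  star_subalgebra.closed_adj[OF F_star_subalgebra] star_subalgebra.closed_scaleC[OF F_star_subalgebra]
  star_subalgebra.closed_minus[OF F_star_subalgebra] star_subalgebra.closed_power[OF F_star_subalgebra]

lemma X_F: "0 \<le> t \<Longrightarrow> X t \<in> F t"
  and X_adj: "0 \<le> t \<Longrightarrow> adj (X t) = X t"
  using bm by (auto simp: free_additive_BM_def)

lemma dX_F: "0 \<le> s \<Longrightarrow> s \<le> t \<Longrightarrow> X t - X s \<in> F t"
  by (rule F_closed(3)) (simp_all add: X_F F_mono[OF _ _ X_F])

lemma dX_M: "0 \<le> s \<Longrightarrow> s \<le> t \<Longrightarrow> X t - X s \<in> M"
  using F_M[OF _ dX_F] by simp

lemma dX_free:
  assumes "0 \<le> s" "s < t"
  shows "free_pair M \<tau> (unital_star_subalgebra hull F s) (unital_star_subalgebra hull {X t - X s})"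
  using assms bm by (intro star_free_pair) (auto simp: free_additive_BM_def intro: F_M dX_M)

lemma dX_moments:
  assumes "0 \<le> s" "s < t"
  shows "\<tau> (X t - X s) = 0" "\<tau> ((X t - X s) * (X t - X s)) = of_real (t - s)"
    "\<tau> ((X t - X s) * (X t - X s) * ((X t - X s) * (X t - X s))) = of_real (2 * (t - s)\<^sup>2)"
  using semicircular_moments[of "t - s" "X t - X s"] assms bm by (simp_all add: free_additive_BM_def)

lemma
  assumes s: "0 \<le> s" "s \<le> t" and a: "a \<in> F s"
  shows tau_dX: "\<tau> (a * (X t - X s)) = 0"
    and tau_dX_dX: "\<tau> (a * ((X t - X s) * (X t - X s))) = \<tau> a * of_real (t - s)"
    and tau_dX_mult_dX: "b \<in> F s \<Longrightarrow> \<tau> (a * (X t - X s) * b * (X t - X s)) = \<tau> a * \<tau> b * of_real (t - s)"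
proof -
  have "\<tau> (a * (X t - X s)) = 0 \<and> \<tau> (a * ((X t - X s) * (X t - X s))) = \<tau> a * of_real (t - s) \<and>
    (b \<in> F s \<longrightarrow> \<tau> (a * (X t - X s) * b * (X t - X s)) = \<tau> a * \<tau> b * of_real (t - s))" for b
  proof (cases "s = t")
    case False
    then have st: "s < t" using s by simp
    interpret P: free_pair M \<tau> "unital_star_subalgebra hull F s" "unital_star_subalgebra hull {X t - X s}"
      using dX_free[OF s(1) st] .
    have H: "c \<in> F s \<Longrightarrow> c \<in> unital_star_subalgebra hull F s" for c by (rule hull_inc)
    have S: "X t - X s \<in> unital_star_subalgebra hull {X t - X s}" by (rule hull_inc) simp
    show ?thesis
      using P.tau_mult[OF H[OF a] S] P.tau_mult[OF H[OF a] P.B.closed_mult[OF S S]]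
        P.tau_mult_four[OF H[OF a] H S _ S] dX_moments[OF s(1) st] by simp
  qed (simp add: tau_zero)
  then show "\<tau> (a * (X t - X s)) = 0" "\<tau> (a * ((X t - X s) * (X t - X s))) = \<tau> a * of_real (t - s)"
    "b \<in> F s \<Longrightarrow> \<tau> (a * (X t - X s) * b * (X t - X s)) = \<tau> a * \<tau> b * of_real (t - s)"
    by blast+
qed

lemma N_dX:
  assumes "0 \<le> s" "s \<le> t"
  shows "N (X t - X s) = sqrt (t - s)"
  using tau_dX_dX[OF assms F_closed(1)] assms by (simp add: L2_norm_def X_adj tau_one)

text \<open>By traciality the square of this L2 norm is \<tau>(b S^2 adj b S^2). Writing S^2 = Q + h
  with Q centred, freeness gives |\<tau>(b)|^2 h^2 + h^2; the first term uses \<tau>(Q^2) = 2 h^2 -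
  h^2, which is where the fourth moment enters. This estimate serves for two increments meeting
  inside a third-order remainder.\<close>

lemma N_dX_unitary_dX:
  assumes s: "0 \<le> s" "s < t" and b: "b \<in> F s" "unitary b"
  shows "N ((X t - X s) * b * (X t - X s)) \<le> sqrt 2 * (t - s)"
proof -
  interpret P: free_pair M \<tau> "unital_star_subalgebra hull F s" "unital_star_subalgebra hull {X t - X s}"
    using dX_free[OF s] .
  define S where "S = X t - X s"
  define h where "h = t - s"
  define Q where "Q = S * S - of_real h *\<^sub>C 1"
  have M: "S \<in> M" "b \<in> M" "Q \<in> M" using s b F_M dX_M by (auto simp: S_def Q_def star_closed)
  have b': "b \<in> unital_star_subalgebra hull F s" using b by (intro hull_inc)
  have "S \<in> unital_star_subalgebra hull {X t - X s}" unfolding S_def by (rule hull_inc) simp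
  then have Q: "Q \<in> unital_star_subalgebra hull {X t - X s}"
    unfolding Q_def by (intro P.B.closed_diff P.B.closed_mult P.B.closed_scaleC P.B.closed_one)
  have Q0: "\<tau> Q = 0" using M dX_moments(2)[OF s] by (simp add: Q_def tau_linear star_closed flip: S_def h_def)
  have "Q * Q = S * S * (S * S) - of_real h *\<^sub>C (S * S) - of_real h *\<^sub>C (S * S) + (of_real h)\<^sup>2 *\<^sub>C 1"
    by (simp add: Q_def algebra_simps scaleC_scaleC scaleC_diff_right power2_eq_square)
  then have QQ: "\<tau> (Q * Q) = of_real (h\<^sup>2)"
    using M dX_moments(2,3)[OF s] unfolding S_def[symmetric] h_def[symmetric]
    by (simp add: tau_linear star_closed power2_eq_square)
  have "\<tau> (b * Q * adj b * Q) = of_real ((cmod (\<tau> b))\<^sup>2 * h\<^sup>2)"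
    using P.tau_mult_four[OF b' P.A.closed_adj[OF b'] Q Q0 Q Q0] M complex_norm_square[of "\<tau> b"]
    by (simp add: QQ tau_adj)
  moreover have "\<tau> (b * Q * adj b) = 0"
    using tau_commute[of "b * Q" "adj b"] M b(2) by (simp add: star_closed unitary_cancel Q0)
  moreover have "b * (S * S) * adj b * (S * S) = b * Q * adj b * Q
      + of_real h *\<^sub>C (b * Q * adj b) + of_real h *\<^sub>C Q + (of_real h)\<^sup>2 *\<^sub>C 1"
  proof -
    have SS: "S * S = Q + of_real h *\<^sub>C 1" by (simp add: Q_def)
    show ?thesis unfolding SS using b(2)
      by (simp add: algebra_simps scaleC_scaleC scaleC_add_right power2_eq_square unitary_cancel)
        (simp add: unitary_def)
  qed
  ultimately have "\<tau> (b * (S * S) * adj b * (S * S)) = of_real ((cmod (\<tau> b))\<^sup>2 * h\<^sup>2 + h\<^sup>2)"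
    using M by (simp add: tau_linear star_closed Q0)
  moreover have "\<tau> (adj (S * b * S) * (S * b * S)) = \<tau> (b * (S * S) * adj b * (S * S))"
  proof -
    have adjS: "adj S = S" using s by (simp add: S_def X_adj)
    have "\<tau> (adj (S * b * S) * (S * b * S)) = \<tau> ((S * adj b * S * S) * (b * S))"
      using adjS by (simp add: mult.assoc)
    also have "\<dots> = \<tau> ((b * S) * (S * adj b * S * S))" using M by (intro tau_commute) (simp_all add: star_closed)
    finally show ?thesis by (simp add: mult.assoc)
  qed
  ultimately have "(N (S * b * S))\<^sup>2 = (cmod (\<tau> b))\<^sup>2 * h\<^sup>2 + h\<^sup>2"
    using M tau_adj_mult_self[of "S * b * S"] of_real_eq_iff by (metis closed_mult)
  moreover have "cmod (\<tau> b) \<le> 1" using tau_le_N[OF M(2)] b(2) by (simp add: N_unitary)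
  ultimately have "(N (S * b * S))\<^sup>2 \<le> 1 * h\<^sup>2 + h\<^sup>2"
    by (simp add: mult_left_le_one_le power_le_one)
  then have "(N (S * b * S))\<^sup>2 \<le> (sqrt 2 * h)\<^sup>2" by (simp add: power_mult_distrib)
  then show ?thesis unfolding S_def[symmetric] h_def[symmetric]
    by (rule power2_le_imp_le) (use s in \<open>simp add: h_def\<close>)
qed

lemma tau_adj_flip:
  assumes "x \<in> M" "y \<in> M"
  shows "\<tau> (adj x * y) = cnj (\<tau> (adj y * x))"
  using tau_adj[of "adj y * x"] assms by (simp add: star_closed)

lemma covariance_disjoint:
  assumes "0 \<le> a" "a \<le> b" "b \<le> c" "c \<le> d" "V \<in> F a" "W \<in> F c"
  shows "\<tau> (adj (V * (X b - X a)) * (W * (X d - X c))) = 0"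
proof -
  have "X b - X a \<in> F c" using assms by (intro F_mono[OF _ _ dX_F]) auto
  moreover have "V \<in> F c" using assms by (intro F_mono[of a c]) auto
  ultimately have "adj (V * (X b - X a)) * W \<in> F c"
    using assms by (intro F_closed(4,5)) auto
  from tau_dX[OF _ assms(4) this] show ?thesis using assms by (simp add: mult.assoc del: adj_mult adj_diff)
qed

lemma covariance_same_start:
  assumes "0 \<le> a" "a \<le> b" "b \<le> d" "V \<in> F a" "W \<in> F a"
  shows "\<tau> (adj (V * (X b - X a)) * (W * (X d - X a))) = of_real (b - a) * \<tau> (adj V * W)"
proof -
  define S where "S = X b - X a"
  have M: "S \<in> M" "V \<in> M" "W \<in> M" "X d - X b \<in> M" using assms F_M dX_M by (auto simp: S_def)
  have "\<tau> (adj (V * S) * (W * (X d - X b))) = 0"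
    unfolding S_def using assms F_mono[of a b W] by (intro covariance_disjoint) auto
  moreover have "\<tau> (adj (V * S) * (W * S)) = of_real (b - a) * \<tau> (adj V * W)"
  proof -
    have "adj S = S" using assms by (simp add: S_def X_adj)
    then have "\<tau> (adj (V * S) * (W * S)) = \<tau> ((adj V * W * S) * S)"
      using M tau_commute[of S "adj V * W * S"] by (simp add: star_closed mult.assoc)
    also have "\<dots> = of_real (b - a) * \<tau> (adj V * W)"
      using tau_dX_dX[of a b "adj V * W"] assms F_closed by (simp add: S_def mult.assoc)
    finally show ?thesis .
  qed
  moreover have "adj (V * S) * (W * (X d - X a)) = adj (V * S) * (W * S) + adj (V * S) * (W * (X d - X b))"
    by (simp add: S_def algebra_simps)
  ultimately show ?thesis unfolding S_def[symmetric] using M by (simp only:) (simp add: tau_linear star_closed)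
qed

text \<open>Cut the interval of \<open>V\<close> at \<open>c\<close>: the increment before
  \<open>c\<close> belongs to \<open>F c\<close> and is orthogonal to the later one, and the two
  remaining intervals have a common start. If the interval of \<open>W\<close> is the shorter one,
  the common-start case is applied to the adjoint product.\<close>

lemma covariance_ordered:
  assumes "0 \<le> a" "a \<le> c" "a \<le> b" "c \<le> d" "V \<in> F a" "W \<in> F c"
  shows "\<tau> (adj (V * (X b - X a)) * (W * (X d - X c))) = of_real (max 0 (min b d - c)) * \<tau> (adj V * W)"
proof (cases "b \<le> c")
  case True
  then show ?thesis using covariance_disjoint[of a b c d V W] assms by simp
next
  case False
  have c: "0 \<le> c" using assms by simp
  have V: "V \<in> F c" using assms by (intro F_mono[of a c]) auto
  have M: "V \<in> M" "W \<in> M" "X c - X a \<in> M" "X b - X c \<in> M" "X d - X c \<in> M"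
    using F_M[OF assms(1) assms(5)] F_M[OF c assms(6)] dX_M[of a c] dX_M[of c b] dX_M[of c d] assms c False
    by auto
  have 1: "\<tau> (adj (V * (X c - X a)) * (W * (X d - X c))) = 0"
    using assms by (intro covariance_disjoint) auto
  have 2: "\<tau> (adj (V * (X b - X c)) * (W * (X d - X c))) = of_real (min b d - c) * \<tau> (adj V * W)"
  proof (cases "b \<le> d")
    case True
    then show ?thesis using covariance_same_start[of c b d V W] V assms False by simp
  next
    case bd: False
    have "\<tau> (adj (W * (X d - X c)) * (V * (X b - X c))) = of_real (d - c) * \<tau> (adj W * V)"
      using covariance_same_start[of c d b W V] V assms bd by simp
    then show ?thesis
      using tau_adj_flip[of "V * (X b - X c)" "W * (X d - X c)"] tau_adj_flip[of V W] M bd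
      by (simp add: star_closed)
  qed
  have "adj (V * (X b - X a)) * (W * (X d - X c)) = adj (V * (X c - X a)) * (W * (X d - X c))
      + adj (V * (X b - X c)) * (W * (X d - X c))"
    by (simp add: algebra_simps)
  then have "\<tau> (adj (V * (X b - X a)) * (W * (X d - X c))) = \<tau> (adj (V * (X c - X a)) * (W * (X d - X c)))
      + \<tau> (adj (V * (X b - X c)) * (W * (X d - X c)))"
    using M by (simp only:) (simp add: tau_add closed_mult closed_adj del: adj_mult adj_diff)
  then show ?thesis using 1 2 False assms by simp
qed

lemma covariance:
  assumes "0 \<le> a" "a \<le> b" "0 \<le> c" "c \<le> d" "V \<in> F a" "W \<in> F c"
  shows "\<tau> (adj (V * (X b - X a)) * (W * (X d - X c)))
    = of_real (max 0 (min b d - max a c)) * \<tau> (adj V * W)"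
proof (cases "a \<le> c")
  case True
  then show ?thesis using covariance_ordered[of a c b d V W] assms by (simp add: max_absorb2)
next
  case False
  have M: "V \<in> M" "W \<in> M" "X b - X a \<in> M" "X d - X c \<in> M" using assms F_M dX_M by auto
  show ?thesis
    using covariance_ordered[of c a d b W V] assms False M
      tau_adj_flip[of "V * (X b - X a)" "W * (X d - X c)"] tau_adj_flip[of V W]
    by (simp add: star_closed min.commute max_absorb1)
qed

end

section \<open>Step processes and the Ito isometry\<close>

definition step_process ::
    "'i set \<Rightarrow> ('i \<Rightarrow> real) \<Rightarrow> ('i \<Rightarrow> real) \<Rightarrow> ('i \<Rightarrow> 'h::chilbert_space bop) \<Rightarrow> real \<Rightarrow> 'h bop" where
  "step_process I l r Z q = (\<Sum>i\<in>I. indicat_real {l i..<r i} q *\<^sub>R Z i)"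

context free_BM
begin

definition step_integral where
  "step_integral I l r Z = (\<Sum>i\<in>I. Z i * (X (r i) - X (l i)))"

text \<open>The intervals may overlap, so that families can be concatenated without passing to a
  common refinement of the subdivisions.\<close>

definition adapted where
  "adapted c d I l r Z \<longleftrightarrow> finite I \<and> 0 \<le> c \<and>
    (\<forall>i\<in>I. c \<le> l i \<and> l i \<le> r i \<and> r i \<le> d \<and> Z i \<in> M \<and> (l i < r i \<longrightarrow> Z i \<in> F (l i)))"

lemma adaptedI:
  assumes "finite I" "0 \<le> c" "\<And>i. i \<in> I \<Longrightarrow> c \<le> l i \<and> l i \<le> r i \<and> r i \<le> d \<and> Z i \<in> M"
    "\<And>i. i \<in> I \<Longrightarrow> l i < r i \<Longrightarrow> Z i \<in> F (l i)"
  shows "adapted c d I l r Z"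
  using assms by (simp add: adapted_def)

lemma adaptedD:
  assumes "adapted c d I l r Z" "i \<in> I"
  shows "0 \<le> c" "c \<le> l i" "0 \<le> l i" "l i \<le> r i" "r i \<le> d" "Z i \<in> M" "l i < r i \<Longrightarrow> Z i \<in> F (l i)"
    "X (r i) - X (l i) \<in> M"
  using assms dX_M[of "l i" "r i"] unfolding adapted_def by fastforce+

lemma step_process_M: "adapted c d I l r Z \<Longrightarrow> step_process I l r Z q \<in> M"
  unfolding step_process_def using adaptedD(6) by (fast intro: closed_sum closed_scaleR)

lemma step_integral_M: "adapted c d I l r Z \<Longrightarrow> step_integral I l r Z \<in> M"
  unfolding step_integral_def using adaptedD(6,8) by (fast intro: closed_sum closed_mult)

text \<open>Both squared norms expand into double sums over pairs of intervals with the same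
  coefficients Re \<tau>(\<open>adj (Z i) * Z j\<close>): for the process the weight is the
  indicator of the overlap of two intervals, for the integral, by \<open>covariance\<close>, the
  length of that overlap.\<close>

lemma isometry:
  assumes ad: "adapted c d I l r Z"
  shows "((\<lambda>q. (N (step_process I l r Z q))\<^sup>2) has_integral (N (step_integral I l r Z))\<^sup>2) {c..d}"
proof -
  have N_sq: "(N (\<Sum>i\<in>I. f i))\<^sup>2 = (\<Sum>i\<in>I. \<Sum>j\<in>I. Re (\<tau> (adj (f i) * f j)))"
    if "\<And>i. i \<in> I \<Longrightarrow> f i \<in> M" for f
  proof -
    have "complex_of_real ((N (\<Sum>i\<in>I. f i))\<^sup>2) = (\<Sum>i\<in>I. \<Sum>j\<in>I. \<tau> (adj (f i) * f j))"
      using that tau_adj_mult_self[of "\<Sum>i\<in>I. f i"]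
      by (simp add: star_closed sum_product tau_sum)
    from arg_cong[OF this, of Re] show ?thesis by simp
  qed
  define e where "e i j = max 0 (min (r i) (r j) - max (l i) (l j))" for i j
  have 1: "(N (step_process I l r Z q))\<^sup>2
      = (\<Sum>i\<in>I. \<Sum>j\<in>I. indicat_real {max (l i) (l j)..<min (r i) (r j)} q * Re (\<tau> (adj (Z i) * Z j)))" for q
  proof -
    have "Re (\<tau> (adj (indicat_real {l i..<r i} q *\<^sub>R Z i) * indicat_real {l j..<r j} q *\<^sub>R Z j))
      = indicat_real {max (l i) (l j)..<min (r i) (r j)} q * Re (\<tau> (adj (Z i) * Z j))"
      if "i \<in> I" "j \<in> I" for i j
      using that adaptedD(6)[OF ad]
      by (simp add: tau_scaleR star_closed flip: indicator_Ico_times_Ico)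
    then show ?thesis unfolding step_process_def
      using adaptedD(6)[OF ad] by (subst N_sq) (simp_all add: star_closed)
  qed
  have 2: "(N (step_integral I l r Z))\<^sup>2 = (\<Sum>i\<in>I. \<Sum>j\<in>I. e i j * Re (\<tau> (adj (Z i) * Z j)))"
  proof -
    have "Re (\<tau> (adj (Z i * (X (r i) - X (l i))) * (Z j * (X (r j) - X (l j))))) = e i j * Re (\<tau> (adj (Z i) * Z j))"
      if i: "i \<in> I" and j: "j \<in> I" for i j
    proof (cases "l i < r i \<and> l j < r j")
      case True
      then show ?thesis
        using covariance[of "l i" "r i" "l j" "r j" "Z i" "Z j"] adaptedD[OF ad i] adaptedD[OF ad j]
        by (simp add: e_def)
    next
      case False
      then have "e i j = 0" "l i = r i \<or> l j = r j"
        using adaptedD(4)[OF ad i] adaptedD(4)[OF ad j] by (auto simp: e_def)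
      then show ?thesis by (auto simp: tau_zero)
    qed
    then show ?thesis unfolding step_integral_def
      using adaptedD(6,8)[OF ad] by (subst N_sq) (simp_all add: star_closed)
  qed
  have "finite I" using ad by (simp add: adapted_def)
  then show ?thesis unfolding 1 2 e_def
    using adaptedD[OF ad]
    by (intro has_integral_sum has_integral_mult_left has_integral_indicator_Ico)
      (auto simp: le_max_iff_disj min_le_iff_disj)
qed

text \<open>The intervals are half-open, so a step process vanishes at \<open>d\<close> whatever it
  approximates; the comparison is therefore required on [c, d) only, with \<open>0 \<le> g d\<close>
  at the end point.\<close>

lemma isometry_le:
  assumes ad: "adapted c d I l r Z"
    and g: "(g has_integral e) {c..d}"
    and le: "\<And>q. q \<in> {c..<d} \<Longrightarrow> (N (step_process I l r Z q))\<^sup>2 \<le> g q" and d: "0 \<le> g d"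
  shows "(N (step_integral I l r Z))\<^sup>2 \<le> e"
proof (rule has_integral_le[OF isometry[OF ad] g])
  fix q assume q: "q \<in> {c..d}"
  show "(N (step_process I l r Z q))\<^sup>2 \<le> g q"
  proof (cases "q = d")
    case True
    have "step_process I l r Z d = 0" unfolding step_process_def
      using adaptedD(5)[OF ad] by (intro sum.neutral) (fastforce simp: indicator_def)
    then show ?thesis using d True by simp
  qed (use q le in simp)
qed

lemma tau_step_integral:
  assumes ad: "adapted c d I l r Z" and b: "b \<in> F c"
  shows "\<tau> (b * step_integral I l r Z) = 0"
proof -
  have c: "i \<in> I \<Longrightarrow> 0 \<le> c" for i using ad by (simp add: adapted_def)
  have "\<tau> (b * (Z i * (X (r i) - X (l i)))) = 0" if i: "i \<in> I" for i
  proof (cases "l i < r i")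
    case True
    have "b \<in> F (l i)" using F_mono[OF _ adaptedD(2)[OF ad i] b] adaptedD(1)[OF ad i] by simp
    then have "b * Z i \<in> F (l i)" using adaptedD[OF ad i] True by (intro F_closed(4)) auto
    then show ?thesis using tau_dX[of "l i" "r i" "b * Z i"] adaptedD[OF ad i] by (simp add: mult.assoc)
  next
    case False
    then show ?thesis using adaptedD(4)[OF ad i] by (simp add: tau_zero)
  qed
  moreover have "b * (Z i * (X (r i) - X (l i))) \<in> M" if "i \<in> I" for i
    using F_M[OF c b] adaptedD(6,8)[OF ad] that by (simp add: star_closed)
  ultimately show ?thesis by (simp add: step_integral_def sum_distrib_left tau_sum)
qed

end

lemma has_integral_nonneg_subinterval:
  fixes f :: "real \<Rightarrow> real"
  assumes "(f has_integral d) {a..b}" "\<And>x. 0 \<le> f x" "{c..e} \<subseteq> {a..b}"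
  obtains d' where "(f has_integral d') {c..e}" "d' \<le> d"
proof -
  have i: "f integrable_on {a..b}" using assms(1) by (rule has_integral_integrable)
  then have "f integrable_on {c..e}" using assms(3) by (rule integrable_on_subinterval)
  moreover from this have "integral {c..e} f \<le> d"
    using integral_subset_le[OF assms(3) _ i] assms(1,2) by (simp add: integral_unique)
  ultimately show ?thesis using that by (blast intro: integrable_integral)
qed

section \<open>Increments of the stochastic integral of Y\<close>

locale unitary_BM = free_BM M \<tau> F X for M :: "'h::chilbert_space bop set" and \<tau> F X +
  fixes Y :: "real \<Rightarrow> 'h bop"
  assumes Y_F: "0 \<le> t \<Longrightarrow> Y t \<in> F t" and Y_unitary: "0 \<le> t \<Longrightarrow> unitary (Y t)" and Y_0: "Y 0 = 1"
    and sde: "0 \<le> t \<Longrightarrow> \<exists>I J. has_free_stochastic_integral M \<tau> F X Y t I \<and>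
      (Y has_integral J) {0..t} \<and> Y t = 1 + \<i> *\<^sub>C I - (1/2) *\<^sub>R J"
begin

lemma Y_M: "0 \<le> t \<Longrightarrow> Y t \<in> M"
  using F_M Y_F by blast

lemma stochastic_integral_approx:
  assumes "has_free_stochastic_integral M \<tau> F X Y t I" "0 < \<delta>"
  obtains K p A d where "simple_adapted F t K p A"
    "((\<lambda>s. (N (Y s - simple_process K p A s))\<^sup>2) has_integral d) {0..t}" "d < \<delta>"
    "N (simple_integral K p A X - I) < \<delta>"
proof -
  obtain K p A e where *: "\<And>n. simple_adapted F t (K n) (p n) (A n)"
    "\<And>n. ((\<lambda>s. (N (Y s - simple_process (K n) (p n) (A n) s))\<^sup>2) has_integral e n) {0..t}"
    "e \<longlonglongrightarrow> 0" "(\<lambda>n. N (simple_integral (K n) (p n) (A n) X - I)) \<longlonglongrightarrow> 0"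
    using assms(1) unfolding has_free_stochastic_integral_def by blast
  have "\<forall>\<^sub>F n in sequentially. e n < \<delta> \<and> N (simple_integral (K n) (p n) (A n) X - I) < \<delta>"
    using order_tendstoD(2)[OF *(3) assms(2)] order_tendstoD(2)[OF *(4) assms(2)] by (rule eventually_conj)
  then have "\<exists>n. e n < \<delta> \<and> N (simple_integral (K n) (p n) (A n) X - I) < \<delta>"
    by (rule eventually_happens'[OF sequentially_bot])
  then obtain n where "e n < \<delta>" "N (simple_integral (K n) (p n) (A n) X - I) < \<delta>"
    by blast
  then show ?thesis using that *(1,2) by blast
qed

text \<open>The simple processes approximating \<open>It\<close> and \<open>Is\<close> are
  unrelated. Cutting the former at \<open>s\<close> leaves a step process on [s, t] and one on
  [0, s]; the latter minus the process for \<open>Is\<close> is small in L2 because both are close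
  to \<open>Y\<close> there, so by \<open>isometry_le\<close> its integral is small too.\<close>

lemma increment_approx:
  assumes s: "0 \<le> s" "s < t"
    and Is: "has_free_stochastic_integral M \<tau> F X Y s Is"
    and It: "has_free_stochastic_integral M \<tau> F X Y t It" and e: "0 < e"
  obtains K :: nat and l r Z d where "adapted s t {..<K} l r Z"
    "((\<lambda>q. (N (Y q - step_process {..<K} l r Z q))\<^sup>2) has_integral d) {s..t}" "d < e"
    "N (step_integral {..<K} l r Z - (It - Is)) < e"
proof -
  \<comment> \<open>4 \<delta> \<le> (e/2)^2 bounds the isometry term on [0, s] by e/2; the two
    approximation errors take e/4 each.\<close>
  define \<delta> where "\<delta> = min (e / 4) (e\<^sup>2 / 32)"
  have \<delta>: "0 < \<delta>" using e by (simp add: \<delta>_def)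
  obtain K p A d1 where 1: "simple_adapted F t K p A"
    "((\<lambda>q. (N (Y q - simple_process K p A q))\<^sup>2) has_integral d1) {0..t}" "d1 < \<delta>"
    "N (simple_integral K p A X - It) < \<delta>"
    using stochastic_integral_approx[OF It \<delta>] .
  obtain K' p' A' d2 where 2: "simple_adapted F s K' p' A'"
    "((\<lambda>q. (N (Y q - simple_process K' p' A' q))\<^sup>2) has_integral d2) {0..s}" "d2 < \<delta>"
    "N (simple_integral K' p' A' X - Is) < \<delta>"
    using stochastic_integral_approx[OF Is \<delta>] .
  have IM: "Is \<in> M" "It \<in> M" using Is It by (simp_all add: has_free_stochastic_integral_def)
  have p: "0 \<le> p i" "p i \<le> p (Suc i)" "p (Suc i) \<le> t" "A i \<in> F (p i)" "A i \<in> M" if "i < K" for i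
    using simple_adapted_bounds[OF 1(1), of i] simple_adapted_bounds[OF 1(1), of "Suc i"] 1(1) that
    by (auto simp: simple_adapted_def less_imp_le intro: F_M)
  have p': "0 \<le> p' i" "p' i \<le> p' (Suc i)" "p' (Suc i) \<le> s" "A' i \<in> F (p' i)" "A' i \<in> M" if "i < K'" for i
    using simple_adapted_bounds[OF 2(1), of i] simple_adapted_bounds[OF 2(1), of "Suc i"] 2(1) that
    by (auto simp: simple_adapted_def less_imp_le intro: F_M)
  define l r where "l = (\<lambda>i. max s (p i))" and "r = (\<lambda>i. max s (p (Suc i)))"
  have ad: "adapted s t {..<K} l r A"
  proof (rule adaptedI)
    fix i assume "i \<in> {..<K}"
    then have i: "i < K" by simp
    show "s \<le> l i \<and> l i \<le> r i \<and> r i \<le> t \<and> A i \<in> M" using p[OF i] s by (auto simp: l_def r_def)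
    show "A i \<in> F (l i)" by (rule F_mono[OF p(1)[OF i] _ p(4)[OF i]]) (simp add: l_def)
  qed (use s in auto)
  have proc: "simple_process K p A q = step_process {..<K} l r A q" if "q \<in> {s..t}" for q
    unfolding simple_process_def step_process_def using that
    by (intro sum.cong) (auto simp: l_def r_def indicator_def)
  define I where "I = {..<K} <+> {..<K'}"
  define lm where "lm = case_sum (\<lambda>i. min s (p i)) p'"
  define rm where "rm = case_sum (\<lambda>i. min s (p (Suc i))) (\<lambda>i. p' (Suc i))"
  define Zm where "Zm = case_sum A (\<lambda>i. - A' i)"
  have adm: "adapted 0 s I lm rm Zm"
  proof (rule adaptedI)
    fix i assume i: "i \<in> I"
    show "0 \<le> lm i \<and> lm i \<le> rm i \<and> rm i \<le> s \<and> Zm i \<in> M"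
      using i p p' s by (auto simp: I_def lm_def rm_def Zm_def star_closed min_le_iff_disj split: sum.split)
    \<comment> \<open>An interval lying after \<open>s\<close> has collapsed to the point
      \<open>s\<close>, and its coefficient need not be in \<open>F s\<close>. Strictness excludes
      this case, so the left end is still the original \<open>p j\<close>.\<close>
    assume lr: "lm i < rm i"
    show "Zm i \<in> F (lm i)"
    proof (cases i)
      case (Inl j)
      then have "j < K" using i by (auto simp: I_def)
      moreover from this have "lm i = p j" using lr Inl by (auto simp: lm_def rm_def min_def split: if_splits)
      ultimately show ?thesis using p(4) Inl by (simp add: Zm_def)
    next
      case (Inr j)
      then have "j < K'" using i by (auto simp: I_def)
      then show ?thesis using p'(1,4)[of j] Inr by (simp add: Zm_def lm_def F_closed)
    qed
  qed (simp_all add: I_def)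
  have SPM: "simple_process K p A q \<in> M" "simple_process K' p' A' q \<in> M" for q
    using p(5) p'(5) by (auto simp: simple_process_def intro!: closed_sum)
  have SIM: "simple_integral K p A X \<in> M" "simple_integral K' p' A' X \<in> M"
    using p p' dX_M by (auto simp: simple_integral_def intro!: closed_sum closed_mult)
  have procm: "step_process I lm rm Zm q = (Y q - simple_process K' p' A' q) - (Y q - simple_process K p A q)"
    if "q \<in> {0..<s}" for q
  proof -
    have "step_process I lm rm Zm q
        = (\<Sum>i<K. indicat_real {min s (p i)..<min s (p (Suc i))} q *\<^sub>R A i)
          + (\<Sum>i<K'. indicat_real {p' i..<p' (Suc i)} q *\<^sub>R (- A' i))"
      unfolding step_process_def I_def lm_def rm_def Zm_def
        sum.Plus[OF finite_lessThan finite_lessThan] comp_def sum.case ..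
    also have "(\<Sum>i<K. indicat_real {min s (p i)..<min s (p (Suc i))} q *\<^sub>R A i) = simple_process K p A q"
      unfolding simple_process_def using that by (intro sum.cong) (auto simp: indicator_def)
    also have "(\<Sum>i<K'. indicat_real {p' i..<p' (Suc i)} q *\<^sub>R (- A' i)) = - simple_process K' p' A' q"
      by (simp add: simple_process_def sum_negf)
    finally show ?thesis by simp
  qed
  obtain d1' where d1': "((\<lambda>q. (N (Y q - simple_process K p A q))\<^sup>2) has_integral d1') {0..s}" "d1' \<le> d1"
    using has_integral_nonneg_subinterval[OF 1(2), of 0 s] s by auto
  have "(N (step_integral I lm rm Zm))\<^sup>2 \<le> 2 * d2 + 2 * d1'"
  proof (rule isometry_le[OF adm])
    show "((\<lambda>q. 2 * (N (Y q - simple_process K' p' A' q))\<^sup>2 + 2 * (N (Y q - simple_process K p A q))\<^sup>2)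
        has_integral 2 * d2 + 2 * d1') {0..s}"
      by (intro has_integral_add has_integral_mult_right 2(2) d1'(1))
    show "(N (step_process I lm rm Zm q))\<^sup>2
        \<le> 2 * (N (Y q - simple_process K' p' A' q))\<^sup>2 + 2 * (N (Y q - simple_process K p A q))\<^sup>2"
      if "q \<in> {0..<s}" for q
      unfolding procm[OF that] using that by (intro N_diff_sq_le closed_diff Y_M SPM) simp_all
  qed simp
  also have "\<dots> \<le> 4 * \<delta>" using 1(3) 2(3) d1'(2) by linarith
  also have "\<dots> \<le> (e / 2)\<^sup>2"
  proof -
    have "\<delta> \<le> e\<^sup>2 / 32" "(e / 2)\<^sup>2 = e\<^sup>2 / 4" by (simp_all add: \<delta>_def power_divide)
    then show ?thesis using \<delta> by linarith
  qed
  finally have mid: "N (step_integral I lm rm Zm) \<le> e / 2"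
    by (rule power2_le_imp_le) (use e in simp)
  have "simple_integral K p A X = step_integral {..<K} l r A
      + (\<Sum>i<K. A i * (X (min s (p (Suc i))) - X (min s (p i))))"
    unfolding simple_integral_def step_integral_def sum.distrib[symmetric] distrib_left[symmetric]
  proof (intro sum.cong refl)
    fix i
    have "X (p j) = X (max s (p j)) + X (min s (p j)) - X s" for j by (simp add: max_def min_def)
    then show "A i * (X (p (Suc i)) - X (p i)) = A i * (X (r i) - X (l i) + (X (min s (p (Suc i))) - X (min s (p i))))"
      by (metis (no_types, lifting) add_diff_add diff_diff_eq2 diff_add_cancel l_def r_def)
  qed
  moreover have "step_integral I lm rm Zm
      = (\<Sum>i<K. A i * (X (min s (p (Suc i))) - X (min s (p i)))) - simple_integral K' p' A' X"
    by (simp add: step_integral_def simple_integral_def I_def sum.Plus lm_def rm_def Zm_def sum_negf)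
  ultimately have eq: "step_integral {..<K} l r A - (It - Is)
      = (simple_integral K p A X - It) - step_integral I lm rm Zm - (simple_integral K' p' A' X - Is)"
    by simp
  have "N (step_integral {..<K} l r A - (It - Is))
      \<le> N ((simple_integral K p A X - It) - step_integral I lm rm Zm) + N (simple_integral K' p' A' X - Is)"
    unfolding eq using SIM IM step_integral_M[OF adm] by (intro N_triangle_diff closed_diff)
  also have "\<dots> \<le> (N (simple_integral K p A X - It) + N (step_integral I lm rm Zm)) + N (simple_integral K' p' A' X - Is)"
    using SIM IM step_integral_M[OF adm] by (intro add_right_mono N_triangle_diff closed_diff)
  also have "\<dots> < e" using 1(4) 2(4) mid by (simp add: \<delta>_def)
  finally have small: "N (step_integral {..<K} l r A - (It - Is)) < e" .
  obtain d where d: "((\<lambda>q. (N (Y q - simple_process K p A q))\<^sup>2) has_integral d) {s..t}" "d \<le> d1"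
    using has_integral_nonneg_subinterval[OF 1(2), of s t] s by auto
  have "((\<lambda>q. (N (Y q - step_process {..<K} l r A q))\<^sup>2) has_integral d) {s..t}"
    using has_integral_cong[of "{s..t}" "\<lambda>q. (N (Y q - simple_process K p A q))\<^sup>2"
        "\<lambda>q. (N (Y q - step_process {..<K} l r A q))\<^sup>2" d] d(1) proc by simp
  moreover have "d < e" using d(2) 1(3) e by (simp add: \<delta>_def)
  ultimately show ?thesis using that[OF ad _ _ small] by blast
qed

lemma increment_martingale:
  assumes s: "0 \<le> s" "s < t"
    and Is: "has_free_stochastic_integral M \<tau> F X Y s Is"
    and It: "has_free_stochastic_integral M \<tau> F X Y t It" and b: "b \<in> F s"
  shows "\<tau> (b * (It - Is)) = 0"
proof -
  have M: "Is \<in> M" "It \<in> M" "b \<in> M"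
    using Is It F_M[OF s(1) b] by (simp_all add: has_free_stochastic_integral_def)
  have "cmod (\<tau> (b * (It - Is))) \<le> 0 + e" if e: "0 < e" for e
  proof -
    define e' where "e' = e / (N b + 1)"
    have b0: "0 \<le> N b" using M by simp
    then have e': "0 < e'" using e by (simp add: e'_def)
    obtain K :: nat and l r Z d where ad: "adapted s t {..<K} l r Z"
      and small: "N (step_integral {..<K} l r Z - (It - Is)) < e'"
      by (rule increment_approx[OF s Is It e'])
    let ?S = "step_integral {..<K} l r Z"
    have "b * (It - Is) = b * ?S - b * (?S - (It - Is))" by (simp add: algebra_simps)
    then have "cmod (\<tau> (b * (It - Is))) = cmod (\<tau> (b * (?S - (It - Is))))"
      using M step_integral_M[OF ad] tau_step_integral[OF ad b] by (simp only:) (simp add: tau_diff closed_mult closed_diff)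
    also have "\<dots> \<le> N b * N (?S - (It - Is))"
      using M step_integral_M[OF ad] by (intro tau_mult_le) (simp_all add: star_closed)
    also have "\<dots> \<le> N b * e'" using small b0 by (intro mult_left_mono) simp_all
    also have "\<dots> \<le> e" using e b0 by (simp add: e'_def field_simps)
    finally show ?thesis by simp
  qed
  then have "cmod (\<tau> (b * (It - Is))) \<le> 0" by (rule field_le_epsilon)
  then show ?thesis by simp
qed

text \<open>This is the isometry for \<open>Y - V\<close>, obtained by adding to the approximating
  step process one more interval [s, t) with value \<open>- V\<close>. The factor sqrt 2 is the
  price of (x + y)^2 \<le> 2 x^2 + 2 y^2.\<close>

lemma increment_L2:
  assumes s: "0 \<le> s" "s < t"
    and Is: "has_free_stochastic_integral M \<tau> F X Y s Is"
    and It: "has_free_stochastic_integral M \<tau> F X Y t It"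
    and V: "V \<in> F s" "\<And>q. q \<in> {s..t} \<Longrightarrow> N (Y q - V) \<le> C" "0 \<le> C"
  shows "N (It - Is - V * (X t - X s)) \<le> sqrt 2 * C * sqrt (t - s)"
proof (rule field_le_epsilon)
  fix e :: real assume e: "0 < e"
  \<comment> \<open>sqrt (2 e') \<le> e/2 covers the error of the process, e' \<le> e/2 that of the
    integral.\<close>
  define e' where "e' = min (e / 2) (e\<^sup>2 / 8)"
  have e': "0 < e'" using e by (simp add: e'_def)
  have M: "Is \<in> M" "It \<in> M" "V \<in> M" "X t - X s \<in> M"
    using Is It F_M[OF s(1) V(1)] dX_M s by (simp_all add: has_free_stochastic_integral_def)
  obtain K :: nat and l r Z d where ad: "adapted s t {..<K} l r Z"
    and d: "((\<lambda>q. (N (Y q - step_process {..<K} l r Z q))\<^sup>2) has_integral d) {s..t}" "d < e'"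
    and small: "N (step_integral {..<K} l r Z - (It - Is)) < e'"
    by (rule increment_approx[OF s Is It e'])
  define I where "I = {..<K} <+> {()}"
  define lm where "lm = case_sum l (\<lambda>_ :: unit. s)"
  define rm where "rm = case_sum r (\<lambda>_ :: unit. t)"
  define Zm where "Zm = case_sum Z (\<lambda>_ :: unit. - V)"
  have adm: "adapted s t I lm rm Zm"
    using ad M(3) s V(1) unfolding adapted_def
    by (auto simp: I_def lm_def rm_def Zm_def star_closed F_closed)
  have procm: "step_process I lm rm Zm q = (Y q - V) - (Y q - step_process {..<K} l r Z q)"
    if "q \<in> {s..<t}" for q
  proof -
    have "step_process I lm rm Zm q = step_process {..<K} l r Z q + (\<Sum>i\<in>{()}. indicat_real {s..<t} q *\<^sub>R (- V))"
      unfolding step_process_def I_def lm_def rm_def Zm_def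
        sum.Plus[OF finite_lessThan finite.insertI[OF finite.emptyI]] comp_def sum.case ..
    then show ?thesis using that by simp
  qed
  have "(N (step_integral I lm rm Zm))\<^sup>2 \<le> 2 * C\<^sup>2 * (t - s) + 2 * d"
  proof (rule isometry_le[OF adm])
    have "((\<lambda>q. 2 * C\<^sup>2) has_integral 2 * C\<^sup>2 * (t - s)) {s..t}"
      using has_integral_const_real[of "2 * C\<^sup>2" s t] s by (simp add: mult.commute)
    then show "((\<lambda>q. 2 * C\<^sup>2 + 2 * (N (Y q - step_process {..<K} l r Z q))\<^sup>2)
        has_integral 2 * C\<^sup>2 * (t - s) + 2 * d) {s..t}"
      by (intro has_integral_add has_integral_mult_right d(1))
    fix q assume q: "q \<in> {s..<t}"
    have "(N (step_process I lm rm Zm q))\<^sup>2 \<le> 2 * (N (Y q - V))\<^sup>2 + 2 * (N (Y q - step_process {..<K} l r Z q))\<^sup>2"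
      unfolding procm[OF q] using q s by (intro N_diff_sq_le closed_diff Y_M step_process_M[OF ad] M(3)) simp_all
    also have "(N (Y q - V))\<^sup>2 \<le> C\<^sup>2"
      using V(2)[of q] q s M(3) by (intro power_mono N_nonneg closed_diff Y_M) simp_all
    finally show "(N (step_process I lm rm Zm q))\<^sup>2 \<le> 2 * C\<^sup>2 + 2 * (N (Y q - step_process {..<K} l r Z q))\<^sup>2"
      by simp
  qed simp
  also have "\<dots> \<le> 2 * C\<^sup>2 * (t - s) + 2 * e'" using d(2) by simp
  finally have "N (step_integral I lm rm Zm) \<le> sqrt (2 * C\<^sup>2 * (t - s) + 2 * e')" by (rule real_le_rsqrt)
  also have "\<dots> \<le> sqrt (2 * C\<^sup>2 * (t - s)) + sqrt (2 * e')"
    using s e' by (intro sqrt_add_le_add_sqrt) simp_all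
  also have "sqrt (2 * e') \<le> e / 2"
    using e min.cobounded2[of "e / 2" "e\<^sup>2 / 8"]
    by (intro real_le_lsqrt) (simp_all add: e'_def power_divide)
  also have "sqrt (2 * C\<^sup>2 * (t - s)) = sqrt 2 * C * sqrt (t - s)" using V(3) by (simp add: real_sqrt_mult)
  finally have "N (step_integral I lm rm Zm) \<le> sqrt 2 * C * sqrt (t - s) + e / 2" by simp
  moreover have "step_integral I lm rm Zm = step_integral {..<K} l r Z - V * (X t - X s)"
    by (simp add: step_integral_def I_def sum.Plus lm_def rm_def Zm_def)
  then have eq: "It - Is - V * (X t - X s) = step_integral I lm rm Zm - (step_integral {..<K} l r Z - (It - Is))"
    by simp
  have "N (It - Is - V * (X t - X s)) \<le> N (step_integral I lm rm Zm) + N (step_integral {..<K} l r Z - (It - Is))"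
    unfolding eq using step_integral_M[OF ad] step_integral_M[OF adm] M
    by (intro N_triangle_diff) (simp_all add: closed_diff)
  moreover have "e' \<le> e / 2" by (simp add: e'_def)
  ultimately show "N (It - Is - V * (X t - X s)) \<le> sqrt 2 * C * sqrt (t - s) + e"
    using small by linarith
qed

end

section \<open>The moments of the free unitary Brownian motion\<close>

text \<open>All new factors stand left of the difference and all old ones right of it. Expanding
  \<open>x ^ j\<close> again therefore yields the next order, with powers of \<open>y\<close> alone
  between consecutive differences; in the application these belong to the earlier algebra of the
  filtration.\<close>

lemma power_diff_telescope:
  fixes x y :: "'h::complex_inner bop"
  shows "x ^ n = y ^ n + (\<Sum>j<n. x ^ j * (x - y) * y ^ (n - 1 - j))"
proof (induction n)
  case (Suc n)
  have "(\<Sum>j<n. x ^ j * (x - y) * y ^ (n - j)) = (\<Sum>j<n. x ^ j * (x - y) * y ^ (n - 1 - j)) * y"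
    unfolding sum_distrib_right
  proof (intro sum.cong refl)
    fix j assume "j \<in> {..<n}"
    then have "n - j = Suc (n - 1 - j)" by auto
    then show "x ^ j * (x - y) * y ^ (n - j) = x ^ j * (x - y) * y ^ (n - 1 - j) * y"
      by (simp only: power_Suc2 mult.assoc)
  qed
  moreover have "x ^ Suc n = x ^ n * y + x ^ n * (x - y)"
    by (simp add: power_Suc2 algebra_simps del: power_Suc)
  moreover have "x ^ n * y = y ^ Suc n + (\<Sum>j<n. x ^ j * (x - y) * y ^ (n - 1 - j)) * y"
    using arg_cong[OF Suc.IH, of "\<lambda>z. z * y"] by (simp only: distrib_right power_Suc2)
  ultimately show ?case by (simp del: power_Suc)
qed simp

context unitary_BM
begin

lemma increment_decomposition:
  assumes s: "0 \<le> s" "s < t"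
  obtains I J where "I \<in> M" "J \<in> M" "Y t - Y s = \<i> *\<^sub>C I - (1/2) *\<^sub>R J"
    "(Y has_integral J) {s..t}" "\<forall>b\<in>F s. \<tau> (b * I) = 0"
    "\<forall>V\<in>F s. \<forall>C\<ge>0. (\<forall>q\<in>{s..t}. N (Y q - V) \<le> C) \<longrightarrow>
      N (I - V * (X t - X s)) \<le> sqrt 2 * C * sqrt (t - s)"
proof -
  have t: "0 \<le> t" using s by simp
  obtain Is Js where 1: "has_free_stochastic_integral M \<tau> F X Y s Is" "(Y has_integral Js) {0..s}"
    "Y s = 1 + \<i> *\<^sub>C Is - (1/2) *\<^sub>R Js" using sde[OF s(1)] by blast
  obtain It Jt where 2: "has_free_stochastic_integral M \<tau> F X Y t It" "(Y has_integral Jt) {0..t}"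
    "Y t = 1 + \<i> *\<^sub>C It - (1/2) *\<^sub>R Jt" using sde[OF t] by blast
  have M: "Is \<in> M" "It \<in> M" using 1 2 by (simp_all add: has_free_stochastic_integral_def)
  have "Y integrable_on {s..t}"
    by (rule integrable_on_subinterval[OF has_integral_integrable[OF 2(2)]]) (use s in auto)
  then obtain J where J: "(Y has_integral J) {s..t}" by blast
  have "(Y has_integral (Js + J)) {0..t}"
    using has_integral_combine[OF _ _ 1(2) J] s by simp
  then have "J = Jt - Js" using has_integral_unique[OF 2(2)] by simp
  then have D: "Y t - Y s = \<i> *\<^sub>C (It - Is) - (1/2) *\<^sub>R J"
    unfolding 1(3) 2(3) by (simp add: scaleC_diff_right scaleR_diff_right)
  then have "J = 2 *\<^sub>R (\<i> *\<^sub>C (It - Is) - (Y t - Y s))" by (simp add: scaleR_diff_right)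
  then have "J \<in> M" using M Y_M s t by (simp add: star_closed)
  with M J D show ?thesis
    by (intro that[of "It - Is" J] ballI allI impI increment_martingale[OF s 1(1) 2(1)]
        increment_L2[OF s 1(1) 2(1)] closed_diff) auto
qed

lemma N_Y_increment:
  assumes s: "0 \<le> s" "s \<le> t" "t - s \<le> 1"
  shows "N (Y t - Y s) \<le> 2 * sqrt (t - s)"
proof (cases "s = t")
  case False
  then have st: "s < t" using s by simp
  obtain I J where IJ: "I \<in> M" "J \<in> M" "Y t - Y s = \<i> *\<^sub>C I - (1/2) *\<^sub>R J"
    "(Y has_integral J) {s..t}" "\<forall>b\<in>F s. \<tau> (b * I) = 0"
    "\<forall>V\<in>F s. \<forall>C\<ge>0. (\<forall>q\<in>{s..t}. N (Y q - V) \<le> C) \<longrightarrow>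
      N (I - V * (X t - X s)) \<le> sqrt 2 * C * sqrt (t - s)"
    by (rule increment_decomposition[OF s(1) st])
  have "0 \<in> F s" using star_subalgebra.closed_zero[OF F_star_subalgebra[OF s(1)]] .
  \<comment> \<open>The plain isometry: V = 0, and each \<open>Y q\<close> has L2 norm 1.\<close>
  have 1: "N I \<le> sqrt 2 * sqrt (t - s)"
    using IJ(6)[rule_format, OF \<open>0 \<in> F s\<close>, of 1] s by (simp add: N_unitary Y_unitary)
  have "N J \<le> 1 * (t - s)"
    using s by (intro N_has_integral_le[OF _ _ IJ(4,2)]) (simp_all add: Y_M N_unitary Y_unitary)
  moreover have "t - s \<le> sqrt (t - s)"
    using s by (intro real_le_rsqrt) (simp add: power2_eq_square mult_left_le_one_le)
  ultimately have 2: "N J \<le> sqrt (t - s)" by simp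
  have "N (Y t - Y s) \<le> N (\<i> *\<^sub>C I) + N ((1/2) *\<^sub>R J)"
    unfolding IJ(3) using IJ(1,2) by (intro N_triangle_diff) (simp_all add: star_closed)
  also have "\<dots> = N I + 1/2 * N J" using IJ(1,2) by (simp add: N_scaleC N_scaleR)
  also have "\<dots> \<le> (sqrt 2 + 1/2) * sqrt (t - s)" using 1 2 by (simp add: algebra_simps)
  also have "\<dots> \<le> 2 * sqrt (t - s)"
  proof (intro mult_right_mono)
    have "sqrt 2 \<le> 3 / 2" by (rule real_le_lsqrt) (simp_all add: power2_eq_square)
    then show "sqrt 2 + 1/2 \<le> (2::real)" by simp
  qed (use s in simp)
  finally show ?thesis .
qed simp

text \<open>A bootstrap: the bound 2w on Y_q - Y_s is put back into the L2 estimate with V = Y_s,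
  which gives an error of order w^2. Traces against \<open>F s\<close> are one order better, since
  the martingale part drops out there and only half of J - w^2 Y_s remains, where J is the drift
  integral.\<close>

lemma increment_expansion:
  assumes s: "0 \<le> s" "s < t" "t - s \<le> 1"
  defines "w \<equiv> sqrt (t - s)"
  obtains E where "E \<in> M" "Y t - Y s = \<i> *\<^sub>C (Y s * (X t - X s)) + E" "N E \<le> 4 * w\<^sup>2"
    "\<forall>b\<in>F s. unitary b \<longrightarrow>
      cmod (\<tau> (b * (Y t - Y s)) + of_real (w\<^sup>2 / 2) * \<tau> (b * Y s)) \<le> w ^ 3"
proof -
  obtain I J where IJ: "I \<in> M" "J \<in> M" "Y t - Y s = \<i> *\<^sub>C I - (1/2) *\<^sub>R J"
    "(Y has_integral J) {s..t}" "\<forall>b\<in>F s. \<tau> (b * I) = 0"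
    "\<forall>V\<in>F s. \<forall>C\<ge>0. (\<forall>q\<in>{s..t}. N (Y q - V) \<le> C) \<longrightarrow>
      N (I - V * (X t - X s)) \<le> sqrt 2 * C * sqrt (t - s)"
    by (rule increment_decomposition[OF s(1,2)])
  have t: "0 \<le> t" using s by simp
  have w: "0 < w" "w \<le> 1" "w\<^sup>2 = t - s" using s by (simp_all add: w_def)
  have M: "Y s \<in> M" "Y t \<in> M" "X t - X s \<in> M" using s t by (auto intro: Y_M dX_M)
  have Yq: "N (Y q - Y s) \<le> 2 * w" if "q \<in> {s..t}" for q
    using N_Y_increment[of s q] that s unfolding w_def
    by (smt (verit) atLeastAtMost_iff real_sqrt_le_mono)
  define E where "E = Y t - Y s - \<i> *\<^sub>C (Y s * (X t - X s))"
  have I: "N (I - Y s * (X t - X s)) \<le> 3 * w\<^sup>2"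
  proof -
    have "N (I - Y s * (X t - X s)) \<le> sqrt 2 * (2 * w) * sqrt (t - s)"
      using IJ(6)[rule_format, OF Y_F[OF s(1)], of "2 * w"] Yq w by simp
    also have "\<dots> = 2 * sqrt 2 * w\<^sup>2" by (simp add: power2_eq_square flip: w_def)
    also have "\<dots> \<le> 3 * w\<^sup>2"
    proof (intro mult_right_mono)
      have "sqrt 2 \<le> 3 / 2" by (rule real_le_lsqrt) (simp_all add: power2_eq_square)
      then show "2 * sqrt 2 \<le> (3::real)" by simp
    qed simp
    finally show ?thesis .
  qed
  have JY: "N (J - (w\<^sup>2) *\<^sub>R Y s) \<le> 2 * w * w\<^sup>2"
    unfolding w(3)
  proof (rule N_has_integral_le[where f = "\<lambda>q. Y q - Y s"])
    have "((\<lambda>q. Y s) has_integral (t - s) *\<^sub>R Y s) {s..t}"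
      using has_integral_const_real[of "Y s" s t] s by simp
    then show "((\<lambda>q. Y q - Y s) has_integral J - (t - s) *\<^sub>R Y s) {s..t}"
      by (intro has_integral_diff IJ(4))
    show "N (Y q - Y s) \<le> 2 * w" if "q \<in> {s..t}" for q using Yq[OF that] .
  qed (use s IJ M in \<open>auto simp: star_closed Y_M\<close>)
  have "N J \<le> 1 * (t - s)"
    using s by (intro N_has_integral_le[OF _ _ IJ(4,2)]) (simp_all add: Y_M N_unitary Y_unitary)
  then have J: "N J \<le> w\<^sup>2" using w by simp
  show ?thesis
  proof
    show "E \<in> M" using M by (simp add: E_def star_closed)
    show "Y t - Y s = \<i> *\<^sub>C (Y s * (X t - X s)) + E" by (simp add: E_def)
    have "E = \<i> *\<^sub>C (I - Y s * (X t - X s)) - (1/2) *\<^sub>R J"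
      unfolding E_def IJ(3) by (simp add: scaleC_diff_right)
    then have "N E \<le> N (\<i> *\<^sub>C (I - Y s * (X t - X s))) + N ((1/2) *\<^sub>R J)"
      using N_triangle_diff IJ(1,2) M by (simp add: closed_diff closed_mult closed_scaleC closed_scaleR)
    also have "\<dots> = N (I - Y s * (X t - X s)) + 1/2 * N J"
      using IJ(1,2) M by (simp add: N_scaleC N_scaleR closed_diff closed_mult)
    finally show "N E \<le> 4 * w\<^sup>2" using I J zero_le_power2[of w] by linarith
    show "\<forall>b\<in>F s. unitary b \<longrightarrow>
      cmod (\<tau> (b * (Y t - Y s)) + of_real (w\<^sup>2 / 2) * \<tau> (b * Y s)) \<le> w ^ 3"
    proof (intro ballI impI)
      fix b assume b: "b \<in> F s" "unitary b"
      have bM: "b \<in> M" using F_M[OF s(1) b(1)] .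
      have "b * (Y t - Y s) = \<i> *\<^sub>C (b * I) - (1/2) *\<^sub>R (b * J)"
        unfolding IJ(3) by (simp add: algebra_simps)
      then have "\<tau> (b * (Y t - Y s)) = - (1/2) * \<tau> (b * J)"
        using IJ(5)[rule_format, OF b(1)] bM IJ(1,2) by (simp only:) (simp add: tau_linear star_closed)
      moreover have "b * (J - w\<^sup>2 *\<^sub>R Y s) = b * J - w\<^sup>2 *\<^sub>R (b * Y s)" by (simp add: algebra_simps)
      then have "\<tau> (b * (J - w\<^sup>2 *\<^sub>R Y s)) = \<tau> (b * J) - of_real (w\<^sup>2) * \<tau> (b * Y s)"
        using bM IJ(2) M by (simp only:) (simp add: tau_linear star_closed)
      ultimately have "\<tau> (b * (Y t - Y s)) + of_real (w\<^sup>2 / 2) * \<tau> (b * Y s)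
          = - (1/2) * \<tau> (b * (J - w\<^sup>2 *\<^sub>R Y s))" by (simp add: algebra_simps)
      also have "cmod \<dots> = 1/2 * cmod (\<tau> (b * (J - w\<^sup>2 *\<^sub>R Y s)))" by (simp add: norm_mult)
      also have "\<dots> \<le> 1/2 * (N b * N (J - w\<^sup>2 *\<^sub>R Y s))"
        using bM IJ(2) M by (intro mult_left_mono tau_mult_le) (simp_all add: star_closed)
      also have "\<dots> \<le> w ^ 3" using JY b(2) by (simp add: N_unitary power3_eq_cube power2_eq_square)
      finally show "cmod (\<tau> (b * (Y t - Y s)) + of_real (w\<^sup>2 / 2) * \<tau> (b * Y s)) \<le> w ^ 3" .
    qed
  qed
qed

end

section \<open>Second and third order estimates for one time step\<close>

locale unitary_BM_step = unitary_BM M \<tau> F X Y for M :: "'h::chilbert_space bop set" and \<tau> F X Y +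
  fixes s t w :: real and u S D E :: "'h bop"
  assumes s: "0 \<le> s" "s < t" and w: "0 < w" "t - s = w\<^sup>2"
    and u: "u = Y s" and S: "S = X t - X s" and D: "D = Y t - Y s"
    and E_M: "E \<in> M" and DE: "D = \<i> *\<^sub>C (u * S) + E" and N_E: "N E \<le> 4 * w\<^sup>2" and N_D: "N D \<le> 2 * w"
    and tau_b_D: "b \<in> F s \<Longrightarrow> unitary b \<Longrightarrow> cmod (\<tau> (b * D) + of_real (w\<^sup>2 / 2) * \<tau> (b * u)) \<le> w ^ 3"
begin

lemma u_M: "u \<in> M" and u_F: "u \<in> F s" and unitary_u: "unitary u" and D_M: "D \<in> M" and S_M: "S \<in> M"
  using s by (auto simp: u S D Y_M Y_F Y_unitary dX_M closed_diff)

lemmas step_M = u_M D_M S_M E_M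

lemma N_S: "N S = w"
  using N_dX[of s t] s w by (simp add: S)

text \<open>\<open>D\<close> is a difference of two unitaries, so multiplication by it costs at most
  a factor 2. Cauchy-Schwarz leaves room for two L2 factors; further increments are absorbed in this
  way.\<close>

lemma N_D_left: "x \<in> M \<Longrightarrow> N (D * x) \<le> 2 * N x"
proof -
  assume x: "x \<in> M"
  have "N (D * x) \<le> N (Y t * x) + N (Y s * x)"
    using N_triangle_diff[of "Y t * x" "Y s * x"] x s by (simp add: D left_diff_distrib closed_mult Y_M)
  then show ?thesis using x s by (simp add: N_unitary_left Y_M Y_unitary)
qed

lemmas N_unit = N_unitary_left N_unitary_right

text \<open>Replacing each D by i u S + E leaves the leading term - x u S b u S, whose trace is
  exactly minus the product by freeness. The errors contain E, of order w^2, and one more factor of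
  order w; the two bounds are 8 and 4.\<close>

lemma second_order:
  assumes x: "x \<in> F s" "unitary x" and b: "b \<in> F s" "unitary b"
  shows "cmod (\<tau> (x * D * b * D) + of_real (w\<^sup>2) * (\<tau> (x * u) * \<tau> (b * u))) \<le> 12 * w ^ 3"
proof -
  have M: "x \<in> M" "b \<in> M" using F_M[OF s(1)] x b by auto
  define T1 T2 where "T1 = \<tau> ((x * E) * (b * D))" and "T2 = \<tau> ((x * u * S * b) * E)"
  have "\<tau> ((x * u) * S * (b * u) * S) = \<tau> (x * u) * \<tau> (b * u) * of_real (w\<^sup>2)"
    using tau_dX_mult_dX[of s t "x * u" "b * u"] s x b u_F w by (simp add: S F_closed)
  moreover have "x * D * b * D = (x * E) * (b * D) + \<i> *\<^sub>C ((x * u * S * b) * E) - (x * u) * S * (b * u) * S"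
  proof -
    have "x * D * b * D = (x * E) * (b * D) + \<i> *\<^sub>C (x * u * S * b * D)"
      by (subst (1) DE) (simp add: algebra_simps)
    also have "x * u * S * b * D = (x * u * S * b) * E + \<i> *\<^sub>C ((x * u) * S * (b * u) * S)"
      by (subst DE) (simp add: algebra_simps)
    finally show ?thesis by (simp add: scaleC_add_right scaleC_scaleC scaleC_minus_left)
  qed
  ultimately have "\<tau> (x * D * b * D) + of_real (w\<^sup>2) * (\<tau> (x * u) * \<tau> (b * u)) = T1 + \<i> * T2"
    using M step_M by (simp only: T1_def T2_def) (simp add: tau_linear closed_mult closed_add closed_diff closed_scaleC)
  moreover have "cmod T1 \<le> N (x * E) * N (b * D)"
    unfolding T1_def using M step_M by (intro tau_mult_le closed_mult)
  moreover have "N (x * E) * N (b * D) \<le> (4 * w\<^sup>2) * (2 * w)"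
    using M step_M x b N_E N_D w by (intro mult_mono) (simp_all add: N_unit)
  moreover have "cmod T2 \<le> N (x * u * S * b) * N E"
    unfolding T2_def using M step_M by (intro tau_mult_le closed_mult)
  moreover have "N (x * u * S * b) * N E \<le> w * (4 * w\<^sup>2)"
    using M step_M x b N_E N_S w unitary_u by (intro mult_mono) (simp_all add: N_unit closed_mult mult.assoc)
  ultimately show ?thesis
    using norm_triangle_ineq[of T1 "\<i> * T2"] by (simp add: norm_mult power3_eq_cube power2_eq_square)
qed

text \<open>The outer factors are taken from \<open>M\<close>, since they will contain powers of
  \<open>Y t\<close>; the middle one comes from \<open>F s\<close>. Two increments are expanded:
  terms with E already have order w^2, and S (b u) S has order w^2 by
  \<open>N_dX_unitary_dX\<close>. One more factor D or S contributes the order w. The three bounds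
  are 16, 8 and 3.\<close>

lemma third_order:
  assumes x: "x \<in> M" "unitary x" and b: "b \<in> F s" "unitary b" and c: "c \<in> M" "unitary c"
  shows "cmod (\<tau> (x * D * b * D * c * D)) \<le> 27 * w ^ 3"
proof -
  have M: "x \<in> M" "b \<in> M" "c \<in> M" using F_M[OF s(1)] x b c by auto
  define T1 T2 T3 where "T1 = \<tau> ((x * E) * (b * (D * (c * D))))"
    and "T2 = \<tau> (E * (c * (D * (x * (u * (S * b))))))" and "T3 = \<tau> ((x * (u * (S * (b * u) * S)) * c) * D)"
  have "x * D * b * D * c * D = (x * E) * (b * (D * (c * D)))
      + \<i> *\<^sub>C ((x * u * S * b) * (E * c * D)) - (x * (u * (S * (b * u) * S)) * c) * D"
  proof -
    have "x * D * b * D * c * D = (x * E) * (b * (D * (c * D))) + \<i> *\<^sub>C (x * u * S * b * D * c * D)"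
      by (subst (1) DE) (simp add: algebra_simps)
    also have "x * u * S * b * D * c * D = (x * u * S * b) * (E * c * D) + \<i> *\<^sub>C ((x * (u * (S * (b * u) * S)) * c) * D)"
      by (subst (1) DE) (simp add: algebra_simps)
    finally show ?thesis by (simp add: scaleC_add_right scaleC_scaleC scaleC_minus_left)
  qed
  \<comment> \<open>Rotated so that D acts from the left, where it costs a factor 2, while S
    supplies the order w.\<close>
  moreover have "\<tau> ((x * u * S * b) * (E * c * D)) = T2"
    using tau_commute[of "x * u * S * b" "E * c * D"] M step_M by (simp add: T2_def closed_mult mult.assoc)
  ultimately have "\<tau> (x * D * b * D * c * D) = T1 + \<i> * T2 - T3"
    using M step_M by (simp only: T1_def T3_def) (simp add: tau_linear closed_mult closed_add closed_diff closed_scaleC)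
  then have "cmod (\<tau> (x * D * b * D * c * D)) \<le> cmod T1 + cmod T2 + cmod T3"
    using norm_triangle_ineq4[of "T1 + \<i> * T2" T3] norm_triangle_ineq[of T1 "\<i> * T2"] by (simp add: norm_mult)
  moreover have "cmod T1 \<le> N (x * E) * N (b * (D * (c * D)))"
    unfolding T1_def using M step_M by (intro tau_mult_le closed_mult)
  moreover have "N (x * E) * N (b * (D * (c * D))) \<le> (4 * w\<^sup>2) * (4 * w)"
    using M step_M x b c N_E N_D w N_D_left[of "c * D"] by (intro mult_mono) (simp_all add: N_unit closed_mult)
  moreover have "cmod T2 \<le> N E * N (c * (D * (x * (u * (S * b)))))"
    unfolding T2_def using M step_M by (intro tau_mult_le closed_mult)
  moreover have "N E * N (c * (D * (x * (u * (S * b))))) \<le> (4 * w\<^sup>2) * (2 * w)"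
    using M step_M x b c N_E N_S w unitary_u N_D_left[of "x * (u * (S * b))"]
    by (intro mult_mono) (simp_all add: N_unit closed_mult)
  moreover have "cmod T3 \<le> N (x * (u * (S * (b * u) * S)) * c) * N D"
    unfolding T3_def using M step_M by (intro tau_mult_le closed_mult)
  moreover have "N (x * (u * (S * (b * u) * S)) * c) * N D \<le> (3 / 2 * w\<^sup>2) * (2 * w)"
  proof (rule mult_mono)
    have "N (S * (b * u) * S) \<le> sqrt 2 * w\<^sup>2"
      using N_dX_unitary_dX[OF s, of "b * u"] b u_F unitary_u s w by (simp add: S F_closed)
    also have "\<dots> \<le> 3 / 2 * w\<^sup>2"
      by (intro mult_right_mono real_le_lsqrt) (simp_all add: power2_eq_square)
    finally show "N (x * (u * (S * (b * u) * S)) * c) \<le> 3 / 2 * w\<^sup>2"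
      using M step_M x c unitary_u by (simp add: N_unit closed_mult)
  qed (use N_D D_M in simp_all)
  ultimately show ?thesis by (simp add: power3_eq_cube power2_eq_square)
qed

end

section \<open>The transport equation for formal power series\<close>

definition moment_fps :: "(nat \<Rightarrow> real \<Rightarrow> complex) \<Rightarrow> real \<Rightarrow> complex fps" where
  "moment_fps r t = Abs_fps (\<lambda>n. r n t)"

text \<open>The position y e^(ty) / (1 + y) at time t of a characteristic; at t = 0 it is y / (1 +
  y), the compositional inverse of the moment series y / (1 - y) of \<open>Y 0 = 1\<close>.\<close>

definition flow_fps :: "real \<Rightarrow> complex fps" where
  "flow_fps t = fps_X * fps_exp (of_real t) * inverse (1 + fps_X)"

lemma flow_fps_0 [simp]: "fps_nth (flow_fps t) 0 = 0"
  by (simp add: flow_fps_def)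

text \<open>The flow psi solves d/dt psi = y psi, hence d/dt psi^i = i y psi^i. Each coefficient is
  a finite sum of coefficients of exponential series, so it can be differentiated term by
  term.\<close>

lemma flow_fps_power_deriv:
  "((\<lambda>t. fps_nth (flow_fps t ^ i) n) has_vector_derivative
     of_nat i * fps_nth (fps_X * flow_fps t ^ i) n) (at t within S)"
proof -
  define A :: "complex fps" where "A = (fps_X * inverse (1 + fps_X)) ^ i"
  have pow: "flow_fps t ^ i = A * fps_exp (of_nat i * of_real t)" for t
    by (simp add: flow_fps_def A_def power_mult_distrib fps_exp_power_mult mult_ac)
  have exp: "((\<lambda>t. fps_nth (fps_exp (of_nat i * of_real t)) m :: complex) has_vector_derivative
     of_nat i * fps_nth (fps_X * fps_exp (of_nat i * of_real t)) m) (at t within S)" for m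
  proof -
    have "((\<lambda>z. (of_nat i * z) ^ m / fact m :: complex) has_field_derivative
       of_nat i * fps_nth (fps_X * fps_exp (of_nat i * of_real t)) m) (at (of_real t))"
    proof (cases m)
      case (Suc k)
      have "of_nat (Suc k) * (of_nat i * (of_nat i * of_real t) ^ (Suc k - Suc 0)) / fact (Suc k)
          = of_nat i * ((of_nat i * complex_of_real t) ^ k / fact k)"
        by (simp only: fact_Suc diff_Suc_Suc diff_zero) (simp add: field_simps del: of_nat_Suc)
      then show ?thesis
        using DERIV_cdivide[OF DERIV_power[OF DERIV_cmult_Id[of "of_nat i :: complex" "of_real t" UNIV], of "Suc k"], of "fact (Suc k)"]
          Suc by (simp del: power_Suc fact_Suc of_nat_Suc)
    qed simp
    from has_vector_derivative_real_field[OF this] show ?thesis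
      by (simp add: has_vector_derivative_at_within)
  qed
  have "((\<lambda>t. \<Sum>k=0..n. fps_nth A k * fps_nth (fps_exp (of_nat i * of_real t)) (n - k)) has_vector_derivative
      (\<Sum>k=0..n. fps_nth A k * (of_nat i * fps_nth (fps_X * fps_exp (of_nat i * of_real t)) (n - k)))) (at t within S)"
    by (intro has_vector_derivative_sum has_vector_derivative_mult_right exp)
  also have "(\<Sum>k=0..n. fps_nth A k * (of_nat i * fps_nth (fps_X * fps_exp (of_nat i * of_real t)) (n - k)))
      = of_nat i * fps_nth (A * (fps_X * fps_exp (of_nat i * of_real t))) n"
    unfolding fps_mult_nth[of A] sum_distrib_left by (intro sum.cong refl) (simp only: mult_ac)
  also have "A * (fps_X * fps_exp (of_nat i * of_real t)) = fps_X * flow_fps t ^ i"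
    by (simp add: pow mult_ac)
  finally show ?thesis by (simp only: pow fps_mult_nth[of A])
qed

text \<open>Along the characteristics \<open>t \<mapsto> flow_fps t\<close> the equation \<open>\<partial>\<^sub>t \<eta> = - y \<eta> \<partial>\<^sub>y \<eta>\<close> makes
  \<open>\<eta> \<circ> flow_fps - y\<close> solve a homogeneous linear equation, triangular in the coefficients.\<close>

lemma moment_fps_compose_flow:
  assumes ode: "\<And>n t. 0 \<le> t \<Longrightarrow> (r n has_vector_derivative
      - fps_nth (moment_fps r t * (fps_X * fps_deriv (moment_fps r t))) n) (at t within {0..})"
    and r0: "\<And>t. r 0 t = 0" and init: "\<And>n. r (Suc n) 0 = 1" and t: "0 \<le> t"
  shows "fps_compose (moment_fps r t) (flow_fps t) = fps_X"
proof -
  define H where "H t = fps_compose (moment_fps r t) (flow_fps t)" for t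
  define G where "G t = fps_compose (fps_X * fps_deriv (moment_fps r t)) (flow_fps t)" for t
  have H0: "H 0 = fps_X"
  proof -
    \<comment> \<open>At time 0 all moments are 1, so the series is y / (1 - y); the multiplied-out
      form avoids a quotient under the composition.\<close>
    have "(1 - fps_X) * moment_fps r 0 = fps_X"
    proof (rule fps_ext)
      fix n
      show "fps_nth ((1 - fps_X) * moment_fps r 0) n = fps_nth fps_X n"
      proof (cases n)
        case (Suc m)
        then show ?thesis using r0 init
          by (cases m) (simp_all add: moment_fps_def left_diff_distrib)
      qed (simp add: moment_fps_def r0)
    qed
    from arg_cong[OF this, of "\<lambda>f. fps_compose f (flow_fps 0)"]
    have 1: "H 0 * (1 - flow_fps 0) = flow_fps 0"
      by (simp add: fps_compose_mult_distrib fps_compose_sub_distrib H_def mult.commute)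
    have 2: "flow_fps 0 * (1 + fps_X) = fps_X"
      by (simp add: flow_fps_def mult.assoc inverse_mult_eq_1)
    have "H 0 = H 0 * ((1 - flow_fps 0) * (1 + fps_X))" by (simp add: left_diff_distrib 2)
    also have "\<dots> = flow_fps 0 * (1 + fps_X)" using 1 by (simp add: mult.assoc[symmetric])
    finally show ?thesis using 2 by simp
  qed
  have deriv: "((\<lambda>s. fps_nth (H s - fps_X) n) has_vector_derivative - fps_nth ((H t - fps_X) * G t) n) (at t within {0..})"
    if t: "0 \<le> t" for t n
  proof -
    \<comment> \<open>Product rule for \<open>H\<close>: the motion of the flow gives y G, the
      equation for \<open>r\<close> gives - H G, together - (H - y) G.\<close>
    have "((\<lambda>s. \<Sum>i=0..n. r i s * fps_nth (flow_fps s ^ i) n) has_vector_derivative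
       (\<Sum>i=0..n. r i t * (of_nat i * fps_nth (fps_X * flow_fps t ^ i) n)
          + (- fps_nth (moment_fps r t * (fps_X * fps_deriv (moment_fps r t))) i) * fps_nth (flow_fps t ^ i) n)) (at t within {0..})"
      by (intro has_vector_derivative_sum has_vector_derivative_mult flow_fps_power_deriv ode t)
    also have "(\<Sum>i=0..n. r i t * (of_nat i * fps_nth (fps_X * flow_fps t ^ i) n)
          + (- fps_nth (moment_fps r t * (fps_X * fps_deriv (moment_fps r t))) i) * fps_nth (flow_fps t ^ i) n)
       = (\<Sum>i=0..n. r i t * (of_nat i * fps_nth (fps_X * flow_fps t ^ i) n))
        - fps_nth (fps_compose (moment_fps r t * (fps_X * fps_deriv (moment_fps r t))) (flow_fps t)) n"
      by (simp add: sum_subtractf fps_compose_nth)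
    also have "fps_compose (moment_fps r t * (fps_X * fps_deriv (moment_fps r t))) (flow_fps t) = H t * G t"
      by (simp add: H_def G_def fps_compose_mult_distrib)
    also have "(\<Sum>i=0..n. r i t * (of_nat i * fps_nth (fps_X * flow_fps t ^ i) n)) = fps_nth (fps_X * G t) n"
    proof (cases n)
      case (Suc m)
      have "(\<Sum>i=0..n. r i t * (of_nat i * fps_nth (fps_X * flow_fps t ^ i) n))
          = (\<Sum>i=0..Suc m. r i t * (of_nat i * fps_nth (flow_fps t ^ i) m))" using Suc by simp
      also have "\<dots> = (\<Sum>i=0..m. r i t * (of_nat i * fps_nth (flow_fps t ^ i) m))"
        using startsby_zero_power_prefix[OF flow_fps_0, of "Suc m" t] by simp
      also have "\<dots> = fps_nth (G t) m"
        unfolding G_def fps_compose_nth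
        by (intro sum.cong refl) (simp add: moment_fps_def r0)
      finally show ?thesis using Suc by simp
    qed simp
    also have "fps_nth (fps_X * G t) n - fps_nth (H t * G t) n = - fps_nth ((H t - fps_X) * G t) n"
      by (simp add: left_diff_distrib)
    finally have "((\<lambda>s. fps_nth (H s) n) has_vector_derivative - fps_nth ((H t - fps_X) * G t) n) (at t within {0..})"
      by (simp add: H_def fps_compose_nth moment_fps_def)
    from has_vector_derivative_diff[OF this has_vector_derivative_const[of "fps_nth fps_X n"]]
    show ?thesis by simp
  qed
  \<comment> \<open>Triangularity: \<open>G t\<close> has no constant term, so the derivative of
    coefficient n involves only lower coefficients of H - y, which vanish by induction. Coefficient
    n is thus constant, and it starts at 0.\<close>
  have "\<forall>t\<ge>0. fps_nth (H t - fps_X) n = 0" for n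
  proof (induction n rule: less_induct)
    case (less n)
    have "fps_nth ((H t - fps_X) * G t) n = 0" if "0 \<le> t" for t
      unfolding fps_mult_nth
    proof (intro sum.neutral ballI)
      fix i assume i: "i \<in> {0..n}"
      show "fps_nth (H t - fps_X) i * fps_nth (G t) (n - i) = 0"
      proof (cases "i = n")
        case True
        then show ?thesis by (simp add: G_def)
      qed (use i less that in auto)
    qed
    then have "((\<lambda>s. fps_nth (H s - fps_X) n) has_vector_derivative 0) (at t within {0..})" if "0 \<le> t" for t
      using deriv[OF that, of n] that by simp
    then obtain c where "\<And>t. t \<in> {0..} \<Longrightarrow> fps_nth (H t - fps_X) n = c"
      using has_vector_derivative_zero_constant[of "{0..}" "\<lambda>s. fps_nth (H s - fps_X) n"]
      by (auto simp: convex_real_interval)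
    from this[of 0] this show ?case by (simp add: H0)
  qed
  then have "H t - fps_X = 0" using t by (intro fps_ext) simp
  then show ?thesis by (simp add: H_def)
qed

text \<open>The geometric bound gives the series a positive radius of convergence, which turns the
  formal identity into one between analytic functions near 0.\<close>

lemma moment_series_inverse:
  assumes ode: "\<And>n t. 0 \<le> t \<Longrightarrow> (r n has_vector_derivative
      - fps_nth (moment_fps r t * (fps_X * fps_deriv (moment_fps r t))) n) (at t within {0..})"
    and r0: "\<And>t. r 0 t = 0" and init: "\<And>n. r (Suc n) 0 = 1" and t: "0 \<le> t"
    and bound: "\<And>n. cmod (r n t) \<le> K ^ n" and K: "0 < K"
  shows "\<forall>\<^sub>F a in nhds 0. (\<Sum>n. r n t * (a * exp (of_real t * a) / (1 + a)) ^ n) = a"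
proof -
  have "(\<lambda>z. z * exp (of_real t * z) * inverse (1 + z)) has_fps_expansion flow_fps t"
    unfolding flow_fps_def by (intro fps_expansion_intros) simp_all
  moreover have "fps_conv_radius (moment_fps r t) > 0"
  proof -
    have "ereal (1 / (2 * K)) \<le> fps_conv_radius (moment_fps r t)"
      unfolding fps_conv_radius_def
    proof (rule conv_radius_geI_ex')
      fix x :: real assume x: "0 < x" "ereal x < ereal (1 / (2 * K))"
      then have xK: "x * K < 1" using K by (simp add: field_simps)
      show "summable (\<lambda>n. fps_nth (moment_fps r t) n * of_real x ^ n)"
      proof (rule summable_comparison_test')
        show "summable (\<lambda>n. (K * x) ^ n)" using xK x K by (intro summable_geometric) (simp add: mult.commute)
        show "norm (fps_nth (moment_fps r t) n * of_real x ^ n) \<le> (K * x) ^ n" for n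
          using bound[of n] x by (simp add: moment_fps_def norm_mult norm_power power_mult_distrib mult_right_mono)
      qed
    qed
    moreover have "ereal (1 / (2 * K)) > 0" using K by simp
    ultimately show ?thesis by (rule less_le_trans[rotated])
  qed
  then have "eval_fps (moment_fps r t) has_fps_expansion moment_fps r t"
    by (simp add: has_fps_expansion_def)
  ultimately have "(eval_fps (moment_fps r t) \<circ> (\<lambda>z. z * exp (of_real t * z) * inverse (1 + z)))
      has_fps_expansion fps_compose (moment_fps r t) (flow_fps t)"
    by (intro has_fps_expansion_compose flow_fps_0)
  then have "(eval_fps (moment_fps r t) \<circ> (\<lambda>z. z * exp (of_real t * z) * inverse (1 + z))) has_fps_expansion fps_X"
    using moment_fps_compose_flow[OF ode r0 init t] by simp
  then have "\<forall>\<^sub>F a in nhds 0. a = eval_fps (moment_fps r t) (a * exp (of_real t * a) / (1 + a))"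
    by (simp add: has_fps_expansion_def divide_inverse)
  then show ?thesis
    unfolding eval_fps_def moment_fps_def by eventually_elim simp
qed

section \<open>Increments of the trace moments\<close>

context unitary_BM_step
begin

lemma u_power: "u ^ k \<in> F s" "u ^ k \<in> M" "unitary (u ^ k)"
  using s u_F u_M unitary_u by (simp_all add: F_closed closed_power)

lemma Y_power: "Y t ^ k \<in> M" "unitary (Y t ^ k)"
  using s by (simp_all add: closed_power Y_M Y_unitary)

lemma Y_power_telescope: "Y t ^ k = u ^ k + (\<Sum>j<k. Y t ^ j * D * u ^ (k - 1 - j))"
  using power_diff_telescope[of "Y t" k u] by (simp add: D u)

text \<open>Lowering \<open>Y t ^ i\<close> to \<open>u ^ i\<close> creates i words with three
  increments, each of trace at most 27 w^3; the word left over is cyclically rotated into the form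
  of \<open>second_order\<close>. \<open>tau_first_increment\<close> repeats this one order
  lower.\<close>

lemma tau_second_increment:
  "cmod (\<tau> (Y t ^ i * D * u ^ b * D * u ^ c) + of_real (w\<^sup>2) * (\<tau> (u ^ (i + c + 1)) * \<tau> (u ^ (b + 1))))
    \<le> (12 + 27 * i) * w ^ 3"
proof -
  let ?R = "\<lambda>k. Y t ^ k * D * u ^ (i - 1 - k) * D * u ^ b * D * u ^ c"
  have M: "u ^ i * D * u ^ b * D * u ^ c \<in> M" "?R k \<in> M" for k
    by (intro closed_mult u_power Y_power D_M)+
  have "Y t ^ i * D * u ^ b * D * u ^ c = u ^ i * D * u ^ b * D * u ^ c + (\<Sum>k<i. ?R k)"
    by (subst Y_power_telescope) (simp add: distrib_right sum_distrib_right)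
  then have "\<tau> (Y t ^ i * D * u ^ b * D * u ^ c)
      = \<tau> (u ^ i * D * u ^ b * D * u ^ c) + (\<Sum>k<i. \<tau> (?R k))"
    using M by (simp only: tau_add tau_sum closed_sum)
  also have "\<tau> (u ^ i * D * u ^ b * D * u ^ c) = \<tau> (u ^ (c + i) * D * u ^ b * D)"
    using tau_commute[of "u ^ i * D * u ^ b * D" "u ^ c"]
    by (simp add: closed_mult u_power D_M power_add mult.assoc)
  finally have "\<tau> (Y t ^ i * D * u ^ b * D * u ^ c) + of_real (w\<^sup>2) * (\<tau> (u ^ (i + c + 1)) * \<tau> (u ^ (b + 1)))
      = (\<tau> (u ^ (c + i) * D * u ^ b * D) + of_real (w\<^sup>2) * (\<tau> (u ^ (c + i) * u) * \<tau> (u ^ b * u)))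
        + (\<Sum>k<i. \<tau> (?R k))"
    by (simp add: power_Suc2[symmetric] add.commute[of c] del: power_Suc)
  also have "cmod \<dots> \<le> 12 * w ^ 3 + (\<Sum>k<i. 27 * w ^ 3)"
  proof (rule norm_triangle_le, rule add_mono[OF second_order], goal_cases)
    case 5
    show ?case
    proof (intro order_trans[OF norm_sum] sum_mono)
      fix k
      have "\<tau> (?R k) = \<tau> ((u ^ c * Y t ^ k) * D * u ^ (i - 1 - k) * D * u ^ b * D)"
        using tau_commute[of "Y t ^ k * D * u ^ (i - 1 - k) * D * u ^ b * D" "u ^ c"]
        by (simp add: closed_mult u_power Y_power D_M mult.assoc)
      then show "cmod (\<tau> (?R k)) \<le> 27 * w ^ 3"
        using third_order[of "u ^ c * Y t ^ k" "u ^ (i - 1 - k)" "u ^ b"]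
        by (simp add: closed_mult u_power Y_power)
    qed
  qed (rule u_power)+
  finally show ?thesis by (simp add: algebra_simps)
qed

lemma tau_first_increment:
  "cmod (\<tau> (Y t ^ j * D * u ^ c) + of_real (w\<^sup>2) * (\<tau> (u ^ (j + c + 1)) / 2
      + (\<Sum>i<j. \<tau> (u ^ (i + c + 1)) * \<tau> (u ^ (j - i))))) \<le> (1 + (\<Sum>i<j. 12 + 27 * real i)) * w ^ 3"
proof -
  let ?R = "\<lambda>i. Y t ^ i * D * u ^ (j - 1 - i) * D * u ^ c"
  have M: "u ^ j * D * u ^ c \<in> M" "?R k \<in> M" for k
    by (intro closed_mult u_power Y_power D_M)+
  have "Y t ^ j * D * u ^ c = u ^ j * D * u ^ c + (\<Sum>i<j. ?R i)"
    by (subst Y_power_telescope) (simp add: distrib_right sum_distrib_right)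
  then have "\<tau> (Y t ^ j * D * u ^ c) = \<tau> (u ^ j * D * u ^ c) + (\<Sum>i<j. \<tau> (?R i))"
    using M by (simp only: tau_add tau_sum closed_sum)
  also have "\<tau> (u ^ j * D * u ^ c) = \<tau> (u ^ (c + j) * D)"
    using tau_commute[of "u ^ j * D" "u ^ c"] by (simp add: closed_mult u_power D_M power_add mult.assoc)
  finally have e: "\<tau> (Y t ^ j * D * u ^ c) = \<tau> (u ^ (c + j) * D) + (\<Sum>i<j. \<tau> (?R i))" .
  have "\<tau> (Y t ^ j * D * u ^ c) + of_real (w\<^sup>2) * (\<tau> (u ^ (j + c + 1)) / 2
      + (\<Sum>i<j. \<tau> (u ^ (i + c + 1)) * \<tau> (u ^ (j - i))))
      = (\<tau> (u ^ (c + j) * D) + of_real (w\<^sup>2 / 2) * \<tau> (u ^ (c + j) * u))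
      + (\<Sum>i<j. \<tau> (?R i) + of_real (w\<^sup>2) * (\<tau> (u ^ (i + c + 1)) * \<tau> (u ^ (j - i))))"
  proof -
    have 1: "u ^ (c + j) * u = u ^ (j + c + 1)" by (simp only: Suc_eq_plus1[symmetric] power_Suc2 add.commute[of c])
    have 2: "a + b + x * (y / 2 + z) = a + of_real (w\<^sup>2 / 2) * y + (b + x * z)"
      if "x = of_real (w\<^sup>2)" for a b x y z :: complex
      unfolding that by (simp add: algebra_simps)
    show ?thesis
      unfolding e 1 by (simp only: 2 sum.distrib sum_distrib_left[symmetric])
  qed
  also have "cmod \<dots> \<le> w ^ 3 + (\<Sum>i<j. (12 + 27 * real i) * w ^ 3)"
  proof (rule norm_triangle_le, rule add_mono[OF tau_b_D], goal_cases)
    case 3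
    show ?case
    proof (intro order_trans[OF norm_sum] sum_mono)
      fix i assume "i \<in> {..<j}"
      then have "j - 1 - i + 1 = j - i" by auto
      then show "cmod (\<tau> (?R i) + of_real (w\<^sup>2) * (\<tau> (u ^ (i + c + 1)) * \<tau> (u ^ (j - i)))) \<le> (12 + 27 * real i) * w ^ 3"
        using tau_second_increment[of i "j - 1 - i" c] by simp
    qed
  qed (rule u_power)+
  finally show ?thesis by (simp only: distrib_right[of 1] mult_1 sum_distrib_right)
qed

text \<open>The linear term with total weight n/2 comes from the drift. The double sum is the Ito
  correction: two increments at positions i < j cut the cyclic word of length n into arcs of lengths
  j - i and n - j + i, whose traces factor by freeness.\<close>

lemma tau_power_increment:
  "cmod (\<tau> (Y t ^ n) - \<tau> (u ^ n) + of_real (w\<^sup>2) * (\<Sum>j<n. \<tau> (u ^ n) / 2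
      + (\<Sum>i<j. \<tau> (u ^ (n - j + i)) * \<tau> (u ^ (j - i))))) \<le> (\<Sum>j<n. 1 + (\<Sum>i<j. 12 + 27 * real i)) * w ^ 3"
proof -
  let ?R = "\<lambda>j. Y t ^ j * D * u ^ (n - 1 - j)"
  have "\<tau> (Y t ^ n) = \<tau> (u ^ n) + (\<Sum>j<n. \<tau> (?R j))"
    unfolding Y_power_telescope[of n]
    by (simp add: tau_add tau_sum closed_sum closed_mult u_power Y_power D_M)
  then have "\<tau> (Y t ^ n) - \<tau> (u ^ n) + of_real (w\<^sup>2) * (\<Sum>j<n. \<tau> (u ^ n) / 2
      + (\<Sum>i<j. \<tau> (u ^ (n - j + i)) * \<tau> (u ^ (j - i))))
    = (\<Sum>j<n. \<tau> (?R j) + of_real (w\<^sup>2) * (\<tau> (u ^ n) / 2 + (\<Sum>i<j. \<tau> (u ^ (n - j + i)) * \<tau> (u ^ (j - i)))))"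
    by (simp only: sum.distrib sum_distrib_left[symmetric] add_diff_cancel_left')
  also have "cmod \<dots> \<le> (\<Sum>j<n. (1 + (\<Sum>i<j. 12 + 27 * real i)) * w ^ 3)"
  proof (intro order_trans[OF norm_sum] sum_mono)
    fix j assume "j \<in> {..<n}"
    then have "j + (n - 1 - j) + 1 = n" "i + (n - 1 - j) + 1 = n - j + i" for i by auto
    then show "cmod (\<tau> (?R j) + of_real (w\<^sup>2) * (\<tau> (u ^ n) / 2 + (\<Sum>i<j. \<tau> (u ^ (n - j + i)) * \<tau> (u ^ (j - i)))))
        \<le> (1 + (\<Sum>i<j. 12 + 27 * real i)) * w ^ 3"
      using tau_first_increment[of j "n - 1 - j"] by (simp only:)
  qed
  finally show ?thesis by (simp add: sum_distrib_right)
qed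

end

text \<open>The order 3/2 exceeds 1, so the error disappears in the difference quotient. The
  increment estimate uses \<open>g\<close> at the left end of the step; from below it thus involves
  \<open>g y\<close>, which continuity of \<open>g\<close> exchanges for \<open>g t\<close>.\<close>

lemma has_vector_derivative_from_increments:
  fixes f g :: "real \<Rightarrow> complex"
  assumes inc: "\<And>s t. 0 \<le> s \<Longrightarrow> s < t \<Longrightarrow> t - s \<le> 1 \<Longrightarrow>
      cmod (f t - f s - of_real (t - s) * g s) \<le> C * sqrt (t - s) ^ 3"
    and g: "continuous_on {0..} g" and C: "0 \<le> C" and t: "0 \<le> t"
  shows "(f has_vector_derivative g t) (at t within {0..})"
  unfolding has_vector_derivative_def has_derivative_within_alt
proof (intro conjI allI impI)
  show "bounded_linear (\<lambda>x. x *\<^sub>R g t)" by (rule bounded_linear_scaleR_left)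
  fix e :: real assume e: "0 < e"
  obtain d1 where d1: "0 < d1" "\<And>y. y \<in> {0..} \<Longrightarrow> dist y t < d1 \<Longrightarrow> dist (g y) (g t) < e / 2"
    using g t e unfolding continuous_on_iff by (meson atLeast_iff half_gt_zero)
  \<comment> \<open>The square makes C sqrt h \<le> e/2 for h < d; \<open>C + 1\<close> keeps the
    denominator positive when C = 0.\<close>
  define d where "d = min (min 1 d1) ((e / (2 * (C + 1)))\<^sup>2)"
  have small: "C * sqrt h ^ 3 \<le> e / 2 * h" if h: "0 \<le> h" "h < d" for h
  proof -
    have "sqrt h \<le> e / (2 * (C + 1))"
      using h e C by (intro real_le_lsqrt) (auto simp: d_def)
    then have "C * sqrt h \<le> C * (e / (2 * (C + 1)))" using C by (rule mult_left_mono)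
    also have "\<dots> \<le> e / 2" using C e by (simp add: field_simps)
    finally have "C * sqrt h * h \<le> e / 2 * h" using h by (intro mult_right_mono) simp_all
    moreover have "sqrt h ^ 3 = sqrt h * h" using h by (simp add: power3_eq_cube)
    ultimately show ?thesis by (simp add: mult.assoc)
  qed
  have "norm (f y - f t - (y - t) *\<^sub>R g t) \<le> e * norm (y - t)" if y: "y \<in> {0..}" "norm (y - t) < d" for y
  proof (cases y t rule: linorder_cases)
    case equal
    then show ?thesis by simp
  next
    case greater
    have "cmod (f y - f t - of_real (y - t) * g t) \<le> C * sqrt (y - t) ^ 3"
      using y greater t by (intro inc) (auto simp: d_def)
    also have "\<dots> \<le> e / 2 * (y - t)" using y greater by (intro small) auto
    also have "\<dots> \<le> e * (y - t)" using e greater by simp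
    finally show ?thesis using greater by (simp add: scaleR_conv_of_real)
  next
    case less
    have "cmod (f t - f y - of_real (t - y) * g y) \<le> C * sqrt (t - y) ^ 3"
      using y less by (intro inc) (auto simp: d_def)
    also have "\<dots> \<le> e / 2 * (t - y)" using y less by (intro small) auto
    finally have 1: "cmod (f t - f y - of_real (t - y) * g y) \<le> e / 2 * (t - y)" .
    have "cmod (g y - g t) \<le> e / 2"
      using d1(2)[of y] y by (simp add: dist_norm d_def)
    then have 2: "cmod (of_real (t - y) * (g y - g t)) \<le> (t - y) * (e / 2)"
      using less by (simp only: norm_mult norm_of_real) (intro mult_mono, simp_all)
    have "f y - f t - (y - t) *\<^sub>R g t = - ((f t - f y - of_real (t - y) * g y) + of_real (t - y) * (g y - g t))"
      by (simp add: scaleR_conv_of_real algebra_simps)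
    then have "norm (f y - f t - (y - t) *\<^sub>R g t)
        \<le> cmod (f t - f y - of_real (t - y) * g y) + cmod (of_real (t - y) * (g y - g t))"
      by (simp only: norm_minus_cancel norm_triangle_ineq)
    also have "\<dots> \<le> e * (t - y)" using 1 2 by (simp add: algebra_simps)
    finally show ?thesis using less by simp
  qed
  moreover have "0 < d" using d1 e C by (simp add: d_def)
  ultimately show "\<exists>d>0. \<forall>y\<in>{0..}. norm (y - t) < d \<longrightarrow> norm (f y - f t - (y - t) *\<^sub>R g t) \<le> e * norm (y - t)"
    by blast
qed

section \<open>The differential equation of the moments\<close>

context unitary_BM
begin

definition moment_rate :: "nat \<Rightarrow> real \<Rightarrow> complex" where
  "moment_rate n s = - (\<Sum>j<n. \<tau> (Y s ^ n) / 2 + (\<Sum>i<j. \<tau> (Y s ^ (n - j + i)) * \<tau> (Y s ^ (j - i))))"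

lemma moment_increment:
  assumes s: "0 \<le> s" "s < t" "t - s \<le> 1"
  shows "cmod (\<tau> (Y t ^ n) - \<tau> (Y s ^ n) - of_real (t - s) * moment_rate n s)
      \<le> (\<Sum>j<n. 1 + (\<Sum>i<j. 12 + 27 * real i)) * sqrt (t - s) ^ 3"
proof -
  obtain E where E: "E \<in> M" "Y t - Y s = \<i> *\<^sub>C (Y s * (X t - X s)) + E" "N E \<le> 4 * (sqrt (t - s))\<^sup>2"
    "\<forall>b\<in>F s. unitary b \<longrightarrow>
      cmod (\<tau> (b * (Y t - Y s)) + of_real ((sqrt (t - s))\<^sup>2 / 2) * \<tau> (b * Y s)) \<le> sqrt (t - s) ^ 3"
    by (rule increment_expansion[OF s])
  interpret unitary_BM_step M \<tau> F X Y s t "sqrt (t - s)" "Y s" "X t - X s" "Y t - Y s" E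
    using E s N_Y_increment[of s t] by unfold_locales auto
  show ?thesis using tau_power_increment[of n] s by (simp add: moment_rate_def)
qed

lemma moment_continuous: "continuous_on {0..} (\<lambda>t. \<tau> (Y t ^ n))"
proof -
  have le: "cmod (\<tau> (Y t ^ n) - \<tau> (Y s ^ n)) \<le> real n * (2 * sqrt (t - s))"
    if s: "0 \<le> s" "s \<le> t" "t - s \<le> 1" for s t
  proof -
    have t: "0 \<le> t" using s by simp
    have "\<tau> (Y t ^ n) = \<tau> (Y s ^ n) + (\<Sum>j<n. \<tau> (Y t ^ j * (Y t - Y s) * Y s ^ (n - 1 - j)))"
      using s t unfolding power_diff_telescope[of "Y t" n "Y s"]
      by (simp add: tau_add tau_sum closed_sum closed_mult closed_power closed_diff Y_M)
    then have "cmod (\<tau> (Y t ^ n) - \<tau> (Y s ^ n)) \<le> (\<Sum>j<n. cmod (\<tau> (Y t ^ j * (Y t - Y s) * Y s ^ (n - 1 - j))))"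
      using norm_sum by simp
    also have "\<dots> \<le> (\<Sum>j<n. 2 * sqrt (t - s))"
    proof (intro sum_mono)
      fix j
      have "cmod (\<tau> (Y t ^ j * (Y t - Y s) * Y s ^ (n - 1 - j))) \<le> N (Y t ^ j * (Y t - Y s) * Y s ^ (n - 1 - j))"
        using s t by (intro tau_le_N closed_mult closed_power closed_diff Y_M)
      also have "\<dots> = N (Y t - Y s)"
        using s t by (simp add: N_unitary_left N_unitary_right Y_unitary closed_mult closed_power closed_diff Y_M)
      finally show "cmod (\<tau> (Y t ^ j * (Y t - Y s) * Y s ^ (n - 1 - j))) \<le> 2 * sqrt (t - s)"
        using N_Y_increment[OF s] by simp
    qed
    finally show ?thesis by simp
  qed
  show ?thesis unfolding continuous_on_iff
  proof (intro ballI allI impI)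
    fix t e :: real assume t: "t \<in> {0..}" and e: "0 < e"
    define d where "d = min 1 ((e / (2 * real n + 1))\<^sup>2)"
    have "dist (\<tau> (Y q ^ n)) (\<tau> (Y t ^ n)) < e" if q: "q \<in> {0..}" "dist q t < d" for q
    proof -
      have "dist (\<tau> (Y q ^ n)) (\<tau> (Y t ^ n)) \<le> real n * (2 * sqrt \<bar>q - t\<bar>)"
        using le[of t q] le[of q t] q t
        by (cases "q \<le> t") (auto simp: dist_norm norm_minus_commute d_def)
      also have "\<dots> \<le> real n * (2 * (e / (2 * real n + 1)))"
        using q e by (intro mult_left_mono real_le_lsqrt) (auto simp: d_def dist_norm)
      also have "\<dots> < e" using e by (simp add: field_simps)
      finally show ?thesis .
    qed
    moreover have "0 < d"
      unfolding d_def min_less_iff_conj using e by (intro conjI zero_less_power divide_pos_pos) auto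
    ultimately show "\<exists>d>0. \<forall>q\<in>{0..}. dist q t < d \<longrightarrow> dist (\<tau> (Y q ^ n)) (\<tau> (Y t ^ n)) < e" by blast
  qed
qed

lemma moment_derivative:
  assumes "0 \<le> t"
  shows "((\<lambda>t. \<tau> (Y t ^ n)) has_vector_derivative moment_rate n t) (at t within {0..})"
proof (rule has_vector_derivative_from_increments)
  show "cmod (\<tau> (Y t ^ n) - \<tau> (Y s ^ n) - of_real (t - s) * moment_rate n s)
      \<le> (\<Sum>j<n. 1 + (\<Sum>i<j. 12 + 27 * real i)) * sqrt (t - s) ^ 3"
    if "0 \<le> s" "s < t" "t - s \<le> 1" for s t using moment_increment[OF that] .
  show "continuous_on {0..} (moment_rate n)"
    unfolding moment_rate_def by (intro continuous_intros moment_continuous) simp_all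
qed (use assms in \<open>auto intro!: sum_nonneg add_nonneg_nonneg\<close>)

text \<open>The factor e^(nt/2) removes the linear term of \<open>moment_rate\<close>. Coefficient 0
  is set to 0 although \<tau>(1) = 1, so that the series can have an inverse under
  composition.\<close>

definition scaled_moment :: "nat \<Rightarrow> real \<Rightarrow> complex" where
  "scaled_moment n t = (if n = 0 then 0 else exp (of_real t * (of_nat n / 2)) * \<tau> (Y t ^ n))"

text \<open>Group the pairs i < j < n by d = j - i; there are n - d of them. This weight n - d later
  becomes the y-derivative of one factor of the convolution.\<close>

lemma triangle_sum_differences:
  fixes a :: "nat \<Rightarrow> complex"
  shows "(\<Sum>j<n. \<Sum>i<j. a (j - i)) = (\<Sum>d=1..<n. of_nat (n - d) * a d)"
proof (induction n)
  case (Suc n)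
  have "(\<Sum>i<n. a (n - i)) = (\<Sum>d=1..<Suc n. a d)"
    by (rule sum.reindex_bij_witness[of _ "\<lambda>d. n - d" "\<lambda>i. n - i"]) auto
  moreover have "(\<Sum>d=1..<Suc n. of_nat (Suc n - d) * a d) = (\<Sum>d=1..<Suc n. of_nat (n - d) * a d + a d)"
    by (intro sum.cong refl) (auto simp: Suc_diff_le algebra_simps)
  moreover have "(\<Sum>d=1..<Suc n. of_nat (n - d) * a d) = (\<Sum>d=1..<n. of_nat (n - d) * a d)"
    by (cases n) simp_all
  ultimately show ?case using Suc by (simp add: sum.distrib)
qed simp

lemma scaled_moment_ode:
  assumes t: "0 \<le> t"
  shows "(scaled_moment n has_vector_derivative
    - fps_nth (moment_fps scaled_moment t * (fps_X * fps_deriv (moment_fps scaled_moment t))) n) (at t within {0..})"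
proof (cases n)
  case 0
  then show ?thesis by (simp add: scaled_moment_def moment_fps_def[abs_def] scaled_moment_def[abs_def])
next
  case (Suc m)
  let ?e = "\<lambda>n. exp (of_real t * (of_nat n / 2)) :: complex"
  have "((\<lambda>t. exp (of_real t * (of_nat n / 2)) :: complex) has_vector_derivative ?e n * (of_nat n / 2)) (at t within {0..})"
  proof -
    have "((\<lambda>z. exp (z * (of_nat n / 2)) :: complex) has_field_derivative ?e n * (of_nat n / 2)) (at (of_real t))"
      by (auto intro!: derivative_eq_intros)
    from has_vector_derivative_real_field[OF this] show ?thesis
      by (simp add: has_vector_derivative_at_within)
  qed
  from has_vector_derivative_mult[OF this moment_derivative[OF t, of n]]
  have "(scaled_moment n has_vector_derivative
      ?e n * moment_rate n t + ?e n * (of_nat n / 2) * \<tau> (Y t ^ n)) (at t within {0..})"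
    using Suc by (simp add: scaled_moment_def[abs_def])
  also have "?e n * moment_rate n t + ?e n * (of_nat n / 2) * \<tau> (Y t ^ n)
      = - (\<Sum>j<n. \<Sum>i<j. ?e n * (\<tau> (Y t ^ (n - j + i)) * \<tau> (Y t ^ (j - i))))"
    by (simp add: moment_rate_def sum.distrib algebra_simps sum_distrib_left)
  also have "(\<Sum>j<n. \<Sum>i<j. ?e n * (\<tau> (Y t ^ (n - j + i)) * \<tau> (Y t ^ (j - i))))
      = (\<Sum>j<n. \<Sum>i<j. scaled_moment (n - (j - i)) t * scaled_moment (j - i) t)"
  proof (intro sum.cong refl)
    fix j i assume ji: "j \<in> {..<n}" "i \<in> {..<j}"
    then have "n - j + i = n - (j - i)" "n = (n - (j - i)) + (j - i)" by auto
    moreover have "?e ((n - (j - i)) + (j - i)) = ?e (n - (j - i)) * ?e (j - i)"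
      by (simp only: exp_add[symmetric] of_nat_add add_divide_distrib distrib_left)
    ultimately show "?e n * (\<tau> (Y t ^ (n - j + i)) * \<tau> (Y t ^ (j - i)))
        = scaled_moment (n - (j - i)) t * scaled_moment (j - i) t"
      using ji by (simp add: scaled_moment_def)
  qed
  also have "\<dots> = (\<Sum>d=1..<n. of_nat (n - d) * (scaled_moment (n - d) t * scaled_moment d t))"
    by (rule triangle_sum_differences)
  also have "\<dots> = (\<Sum>d=0..n. scaled_moment d t * (of_nat (n - d) * scaled_moment (n - d) t))"
    by (rule sum.mono_neutral_cong_left) (auto simp: scaled_moment_def)
  also have "\<dots> = fps_nth (moment_fps scaled_moment t * (fps_X * fps_deriv (moment_fps scaled_moment t))) n"
    unfolding fps_mult_nth[of "moment_fps scaled_moment t"] by (intro sum.cong refl) (auto simp: moment_fps_def scaled_moment_def Suc_diff_Suc simp del: power_Suc)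
  finally show ?thesis .
qed

text \<open>The factors e^(nt/2) of the scaled moments move into the argument. That the new argument
  has modulus below 1 near 0 supplies genuine convergence, which an equation between
  \<open>suminf\<close> values does not contain.\<close>

lemma moment_series:
  assumes t: "0 \<le> t"
  shows "\<forall>\<^sub>F a in nhds 0.
    (\<lambda>n. (a * exp (of_real t * a + of_real t / 2) / (1 + a)) ^ Suc n * \<tau> (Y t ^ Suc n)) sums a"
proof -
  have le1: "cmod (\<tau> (Y t ^ n)) \<le> 1" for n
    using tau_le_N[of "Y t ^ n"] t by (simp add: N_unitary Y_unitary closed_power Y_M)
  have "\<forall>\<^sub>F a in nhds 0. (\<Sum>n. scaled_moment n t * (a * exp (of_real t * a) / (1 + a)) ^ n) = a"
  proof (rule moment_series_inverse[OF scaled_moment_ode _ _ t])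
    show "cmod (scaled_moment n t) \<le> exp (t / 2) ^ n" for n
      using le1[of n] by (auto simp: scaled_moment_def norm_mult exp_of_nat_mult[symmetric] mult.commute)
  qed (simp_all add: scaled_moment_def Y_0 tau_one)
  moreover have "\<forall>\<^sub>F a in nhds 0. cmod (a * exp (of_real t * a + of_real t / 2) / (1 + a)) < 1"
  proof -
    define f where "f = (\<lambda>a :: complex. cmod (a * exp (of_real t * a + of_real t / 2) / (1 + a)))"
    have "isCont f 0" unfolding f_def by (intro continuous_intros) simp
    then have "(f \<longlongrightarrow> f 0) (nhds 0)" by (simp add: isCont_def tendsto_at_iff_tendsto_nhds)
    from order_tendstoD(2)[OF this, of 1] show ?thesis by (simp add: f_def)
  qed
  ultimately show ?thesis
  proof eventually_elim
    case (elim a)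
    define c where "c = a * exp (of_real t * a + of_real t / 2) / (1 + a)"
    have "scaled_moment n t * (a * exp (of_real t * a) / (1 + a)) ^ n = (if n = 0 then 0 else c ^ n * \<tau> (Y t ^ n))" for n
    proof -
      have "exp (of_real t * (of_nat n / 2)) = exp (of_real t / 2 :: complex) ^ n"
        by (simp add: exp_of_nat_mult[symmetric] mult.commute)
      then show ?thesis
        by (simp add: scaled_moment_def c_def exp_add power_mult_distrib power_divide mult_ac)
    qed
    then have s: "(\<Sum>n. if n = 0 then 0 else c ^ n * \<tau> (Y t ^ n)) = a" using elim(1) by simp
    have "summable (\<lambda>n. if n = 0 then 0 else c ^ n * \<tau> (Y t ^ n))"
    proof (rule summable_comparison_test')
      show "summable (\<lambda>n. cmod c ^ n)" using elim(2) by (simp add: c_def summable_geometric)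
      show "norm (if n = 0 then 0 else c ^ n * \<tau> (Y t ^ n)) \<le> cmod c ^ n" for n
        using mult_left_mono[OF le1[of n], of "cmod c ^ n"] by (simp add: norm_mult norm_power)
    qed
    then have "(\<lambda>n. if n = 0 then 0 else c ^ n * \<tau> (Y t ^ n)) sums a" using s summable_sums by metis
    then show ?case unfolding c_def[symmetric]
      using sums_Suc_iff[of "\<lambda>n. if n = 0 then 0 else c ^ n * \<tau> (Y t ^ n)" a] by simp
  qed
qed

end

section \<open>Compression by a free projection\<close>

lemma bop_geometric:
  fixes x :: "'h::chilbert_space bop"
  assumes "norm x < 1"
  obtains S where "(\<lambda>k. x ^ k) sums S" "(1 - x) * S = 1" "S * (1 - x) = 1"
proof -
  have "summable (\<lambda>k. norm x ^ k)" using assms by (simp add: summable_geometric)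
  then have "summable (\<lambda>k. x ^ k)" by (rule summable_comparison_test') (rule norm_bop_power)
  then obtain S where S: "(\<lambda>k. x ^ k) sums S" by blast
  have T: "(\<lambda>k. x ^ Suc k) sums (S - 1)" using sums_Suc_iff[of "\<lambda>k. x ^ k" "S - 1"] S by simp
  have "(\<lambda>k. x * x ^ k) sums (x * S)"
    by (rule bounded_linear.sums[OF bounded_linear_mult_right S])
  then have "x * S = S - 1" using T sums_unique2 by simp
  moreover have "(\<lambda>k. x ^ k * x) sums (S * x)"
    by (rule bounded_linear.sums[OF bounded_linear_mult_left S])
  then have "S * x = S - 1" using T sums_unique2 by (simp add: power_commutes)
  ultimately show ?thesis using that[OF S] by (simp add: algebra_simps)
qed

section \<open>Alternating words and their norm limits\<close>

context free_pair
begin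

definition letters :: "bool \<Rightarrow> 'h bop set" where
  "letters i = {a \<in> (if i then A else B). \<tau> a = 0}"

text \<open>Words that may be continued by a letter of type \<open>i\<close>; the empty word
  qualifies for both types. The index describes what may follow, not how the word ends.\<close>

definition alternating :: "bool \<Rightarrow> (bool \<times> 'h bop) list \<Rightarrow> bool" where
  "alternating i w \<longleftrightarrow> (\<forall>(k, a)\<in>set w. a \<in> letters k) \<and>
     successively (\<lambda>(i, a) (j, b). i \<noteq> j) w \<and> (w \<noteq> [] \<longrightarrow> fst (last w) \<noteq> i)"

text \<open>The elements that behave under \<open>\<tau>\<close> like alternating words with first letter of type \<open>i\<close>.\<close>

definition begins :: "bool \<Rightarrow> 'h bop set" where
  "begins i = {x \<in> M. \<forall>w. alternating i w \<longrightarrow> \<tau> (prod_list (map snd w) * x) = 0}"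

text \<open>Norm limits are included because freeness concerns the generated star-algebras, while
  the centred resolvents of \<open>u\<close> are limits of polynomials in \<open>u\<close>.\<close>

definition centred :: "bool \<Rightarrow> 'h bop set" where
  "centred i = {a. \<exists>f. (\<forall>n::nat. f n \<in> letters i) \<and> f \<longlonglongrightarrow> a}"

lemma letters_M: "a \<in> letters i \<Longrightarrow> a \<in> M"
  using A_M B_M by (auto simp: letters_def split: if_splits)

lemma alternating_word_M: "alternating i w \<Longrightarrow> prod_list (map snd w) \<in> M"
proof -
  have "\<forall>(k, a)\<in>set w. a \<in> letters k \<Longrightarrow> prod_list (map snd w) \<in> M"
    by (induction w) (auto simp: closed_one intro!: closed_mult intro: letters_M)
  then show "alternating i w \<Longrightarrow> prod_list (map snd w) \<in> M" by (simp add: alternating_def)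
qed

lemma alternating_append:
  assumes "alternating i w" "a \<in> letters i"
  shows "alternating (\<not> i) (w @ [(i, a)])"
  using assms by (auto simp: alternating_def successively_append_iff split: prod.splits)

lemma centred_M: "a \<in> centred i \<Longrightarrow> a \<in> M"
  unfolding centred_def using von_neumann_closed[OF vna] letters_M by blast

lemma begins_M: "x \<in> begins i \<Longrightarrow> x \<in> M"
  by (simp add: begins_def)

lemma begins_tau: "x \<in> begins i \<Longrightarrow> \<tau> x = 0"
proof -
  have "alternating i []" by (simp add: alternating_def)
  then show "x \<in> begins i \<Longrightarrow> \<tau> x = 0" unfolding begins_def by fastforce
qed

lemma begins_add: "x \<in> begins i \<Longrightarrow> y \<in> begins i \<Longrightarrow> x + y \<in> begins i"
  using alternating_word_M by (auto simp: begins_def closed_add closed_mult distrib_left tau_add)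

lemma begins_scaleC: "x \<in> begins i \<Longrightarrow> c *\<^sub>C x \<in> begins i"
  using alternating_word_M by (auto simp: begins_def closed_scaleC closed_mult tau_scaleC)

lemma begins_zero: "0 \<in> begins i"
  by (simp add: begins_def closed_zero tau_zero)

lemma begins_sum: "(\<And>k. k \<in> I \<Longrightarrow> f k \<in> begins i) \<Longrightarrow> sum f I \<in> begins i"
  by (induction I rule: infinite_finite_induct) (simp_all add: begins_zero begins_add)

lemma begins_limit:
  assumes "\<And>n::nat. f n \<in> begins i" "f \<longlonglongrightarrow> x"
  shows "x \<in> begins i"
  unfolding begins_def
proof safe
  show "x \<in> M" using von_neumann_closed[OF vna _ assms(2)] assms(1) begins_M by blast
  fix w assume w: "alternating i w"
  have "(\<lambda>n. \<tau> (prod_list (map snd w) * f n)) \<longlonglongrightarrow> \<tau> (prod_list (map snd w) * x)"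
    by (intro tau_tendsto tendsto_mult_left assms(2) closed_mult alternating_word_M[OF w] begins_M[OF assms(1)])
  moreover have "\<tau> (prod_list (map snd w) * f n) = 0" for n
    using assms(1) w by (auto simp: begins_def)
  ultimately show "\<tau> (prod_list (map snd w) * x) = 0" using LIMSEQ_unique[OF _ tendsto_const] by auto
qed

lemma begins_sums: "(\<And>n. f n \<in> begins i) \<Longrightarrow> f sums x \<Longrightarrow> x \<in> begins i"
  unfolding sums_def by (rule begins_limit[OF begins_sum])

lemma letters_begins:
  assumes a: "a \<in> letters i"
  shows "a \<in> begins i"
  unfolding begins_def
proof safe
  show "a \<in> M" using letters_M[OF a] .
  fix w assume "alternating i w"
  then have "alternating (\<not> i) (w @ [(i, a)])" using a by (rule alternating_append)
  then have "\<tau> (prod_list (map snd (w @ [(i, a)]))) = 0"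
    by (intro free_word) (auto simp: alternating_def letters_def split: prod.splits)
  then show "\<tau> (prod_list (map snd w) * a) = 0" by simp
qed

text \<open>The letter is absorbed into the test word. \<open>begins\<close> quantifies over all
  such words precisely so that products can be built up one letter at a time from the right.\<close>

lemma letters_mult_begins:
  assumes a: "a \<in> letters i" and x: "x \<in> begins (\<not> i)"
  shows "a * x \<in> begins i"
  unfolding begins_def
proof safe
  show "a * x \<in> M" using letters_M[OF a] begins_M[OF x] by (rule closed_mult)
  fix w assume "alternating i w"
  then have "alternating (\<not> i) (w @ [(i, a)])" using a by (rule alternating_append)
  then have "\<tau> (prod_list (map snd (w @ [(i, a)])) * x) = 0" using x by (simp only: begins_def mem_Collect_eq)
  then show "\<tau> (prod_list (map snd w) * (a * x)) = 0" by (simp add: mult.assoc)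
qed

lemma centred_begins: "a \<in> centred i \<Longrightarrow> a \<in> begins i"
  unfolding centred_def using begins_limit letters_begins by blast

lemma centred_mult_begins:
  assumes "a \<in> centred i" "x \<in> begins (\<not> i)"
  shows "a * x \<in> begins i"
proof -
  obtain f where f: "\<And>n::nat. f n \<in> letters i" "f \<longlonglongrightarrow> a" using assms(1) by (auto simp: centred_def)
  have "(\<lambda>n. f n * x) \<longlonglongrightarrow> a * x" by (intro tendsto_intros f)
  then show ?thesis by (rule begins_limit[rotated]) (intro letters_mult_begins f assms(2))
qed

text \<open>A power of p v put before an element that begins with type \<open>True\<close> again
  begins with \<open>p\<close>, and this persists in the series. The two expressions for S - 1 allow
  \<open>S\<close> to be unfolded at its right or its left end, wherever it meets another
  factor.\<close>

lemma geometric_begins: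
  assumes p: "p \<in> centred True" and v: "v \<in> centred False"
    and S: "(\<lambda>k. (c *\<^sub>C (p * v)) ^ k) sums S"
  shows "x \<in> begins True \<Longrightarrow> S * x \<in> begins True"
    and "S - 1 = c *\<^sub>C (S * (p * v))" and "S - 1 = c *\<^sub>C (p * (v * S))" and "S - 1 \<in> begins True" and "S \<in> M"
proof -
  let ?n = "c *\<^sub>C (p * v)"
  have *: "S * x \<in> begins True" if x: "x \<in> begins True" for x
  proof (rule begins_sums)
    show "(\<lambda>k. ?n ^ k * x) sums (S * x)" by (rule bounded_linear.sums[OF bounded_linear_mult_left S])
    show "?n ^ k * x \<in> begins True" for k
    proof (induction k)
      case (Suc k)
      have "?n ^ Suc k * x = c *\<^sub>C (p * (v * (?n ^ k * x)))" by (simp add: mult.assoc)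
      then show ?case using centred_mult_begins[OF p] centred_mult_begins[OF v] Suc
        by (simp add: begins_scaleC)
    qed (use x in simp)
  qed
  then show "x \<in> begins True \<Longrightarrow> S * x \<in> begins True" .
  have T: "(\<lambda>k. ?n ^ Suc k) sums (S - 1)" using sums_Suc_iff[of "\<lambda>k. ?n ^ k" "S - 1"] S by simp
  have "(\<lambda>k. ?n * ?n ^ k) sums (?n * S)"
    by (rule bounded_linear.sums[OF bounded_linear_mult_right S])
  then have "S - 1 = ?n * S" using sums_unique2[OF T] by simp
  then show "S - 1 = c *\<^sub>C (p * (v * S))" by (simp add: mult.assoc)
  have "(\<lambda>k. ?n ^ k * ?n) sums (S * ?n)"
    by (rule bounded_linear.sums[OF bounded_linear_mult_left S])
  then have "S - 1 = S * ?n" using sums_unique2[OF T] by (simp only: power_Suc2)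
  then show e: "S - 1 = c *\<^sub>C (S * (p * v))" by simp
  have "p * v \<in> begins True" using centred_mult_begins[OF p] centred_begins[OF v] by simp
  then show "S - 1 \<in> begins True" unfolding e by (intro begins_scaleC *)
  have "?n ^ k \<in> M" for k using centred_M p v by (simp add: star_closed)
  then show "S \<in> M" using sums_in_M(1) S by blast
qed

text \<open>The unknowns are \<tau>(l S p S' r) and \<tau>(l S v' S' r) with l in {1, v} and r in
  {1, p}. Unfolding S' in the first creates p p, whose scalar part \<sigma> leads to the second;
  unfolding S in the second creates v v', whose scalar part \<theta> leads back to the first. The
  other parts alternate and have trace 0, so both equations close, with determinant 1 - c c'
  \<sigma> \<theta>.\<close>

lemma trace_geometric_product:
  assumes p: "p \<in> centred True" and v: "v \<in> centred False" and v': "v' \<in> centred False"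
    and S: "(\<lambda>k. (c *\<^sub>C (p * v)) ^ k) sums S" and S': "(\<lambda>k. (c' *\<^sub>C (p * v')) ^ k) sums S'"
    and pp: "p * p = \<sigma> *\<^sub>C 1 + \<kappa> *\<^sub>C p"
    and vv: "v * v' = \<theta> *\<^sub>C 1 + c1 *\<^sub>C v + c2 *\<^sub>C v'"
  shows "c * c' * \<sigma> * \<theta> \<noteq> 1"
    and "\<tau> ((v + a *\<^sub>C 1) * S * (y *\<^sub>C p + a *\<^sub>C 1) * ((v' + b *\<^sub>C 1) * S' * (z *\<^sub>C p + b *\<^sub>C 1)))
    = a\<^sup>2 * b\<^sup>2 + (y * b * (a * z * \<sigma> + b * c' * \<sigma> * \<theta>) + a * (a * z * c * \<theta> * \<sigma> + b * \<theta>)) / (1 - c * c' * \<sigma> * \<theta>)"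
proof -
  note S_begins = geometric_begins(1)[OF p v S] and S'_begins = geometric_begins(1)[OF p v' S']
  note S1 = geometric_begins(4)[OF p v S] and S'1 = geometric_begins(4)[OF p v' S']
  note p_mult = centred_mult_begins[OF p, simplified]
  note v_mult = centred_mult_begins[OF v, simplified] and v'_mult = centred_mult_begins[OF v', simplified]
  note M = centred_M[OF p] centred_M[OF v] centred_M[OF v'] geometric_begins(5)[OF p v S] geometric_begins(5)[OF p v' S']
  have split: "x * T = x + x * (T - 1)" for x T :: "'h bop" by (simp add: algebra_simps)
  define R where "R = {1, p}"
  have RM: "r \<in> M" if "r \<in> R" for r using that M by (auto simp: R_def closed_one)
  have p_begins: "p \<in> begins True" using centred_begins[OF p] .
  have x_S'_r: "x * (S' * r) \<in> begins False" if x: "x \<in> centred False" and r: "r \<in> R" for x r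
  proof -
    have "x * (S' * 1) \<in> begins False"
      using begins_add[OF centred_begins[OF x] centred_mult_begins[OF x, simplified, OF S'1]]
      by (simp add: split[symmetric])
    moreover have "x * (S' * p) \<in> begins False"
      using centred_mult_begins[OF x, simplified] S'_begins p_begins by blast
    ultimately show ?thesis using r by (auto simp: R_def)
  qed
  have vS: "v * S \<in> begins False"
    using begins_add[OF centred_begins[OF v] v_mult[OF S1]] by (simp add: split[symmetric])
  have tau_S'_r: "\<tau> (S' * 1) = 1" "\<tau> (S' * p) = 0"
  proof -
    show "\<tau> (S' * p) = 0" by (rule begins_tau[where i = True]) (intro S'_begins p_begins)
    show "\<tau> (S' * 1) = 1" using begins_tau[OF S'1] M by (simp add: tau_diff closed_one tau_one)
  qed
  have tau_S: "\<tau> S = 1" using begins_tau[OF S1] M by (simp add: tau_diff closed_one tau_one)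
  have mid_pv: "\<tau> (S * (p * (v' * (S' * r)))) = 0" "\<tau> (v * (S * (p * (v' * (S' * r))))) = 0"
    "\<tau> (S * (p * (v * (S' * r)))) = 0" "\<tau> (v * (S * (p * (v * (S' * r))))) = 0" if r: "r \<in> R" for r
  proof -
    have 1: "S * (p * (v' * (S' * r))) \<in> begins True" and 2: "S * (p * (v * (S' * r))) \<in> begins True"
      by (intro S_begins p_mult x_S'_r v v' r)+
    show "\<tau> (S * (p * (v' * (S' * r)))) = 0" "\<tau> (v * (S * (p * (v' * (S' * r))))) = 0"
      "\<tau> (S * (p * (v * (S' * r)))) = 0" "\<tau> (v * (S * (p * (v * (S' * r))))) = 0"
      using begins_tau[OF 1] begins_tau[OF 2] begins_tau[OF v_mult[OF 1]] begins_tau[OF v_mult[OF 2]] by simp_all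
  qed
  have SS': "\<tau> (S * (S' * 1)) = 1" "\<tau> (S * (S' * p)) = 0" "\<tau> (v * (S * (S' * 1))) = 0" "\<tau> (v * (S * (S' * p))) = 0"
  proof -
    have 1: "S * (S' - 1) \<in> begins True" by (intro S_begins S'1)
    have "S * (S' * 1) = S + S * (S' - 1)" "v * (S * (S' * 1)) = v * S + v * (S * (S' - 1))"
      by (simp_all add: algebra_simps)
    then show "\<tau> (S * (S' * 1)) = 1" "\<tau> (v * (S * (S' * 1))) = 0"
      using tau_S begins_tau[OF 1] begins_tau[OF vS] begins_tau[OF v_mult[OF 1]] M
      by (simp_all only: tau_add closed_mult closed_diff closed_one) simp_all
    show "\<tau> (S * (S' * p)) = 0" by (intro begins_tau[where i = True] S_begins S'_begins p_begins)
    show "\<tau> (v * (S * (S' * p))) = 0" by (intro begins_tau[where i = False] v_mult S_begins S'_begins p_begins)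
  qed
  have S'_unfold: "S' = 1 + c' *\<^sub>C (p * (v' * S'))"
    using geometric_begins(3)[OF p v' S'] by (simp add: algebra_simps)
  have S_unfold: "S = 1 + c *\<^sub>C (S * (p * v))"
    using geometric_begins(2)[OF p v S] by (simp add: algebra_simps)
  have Spr: "\<tau> (S * (p * 1)) = 0" "\<tau> (S * (p * p)) = \<sigma>" "\<tau> (v * (S * (p * 1))) = 0" "\<tau> (v * (S * (p * p))) = 0"
  proof -
    have 1: "S * p \<in> begins True" by (intro S_begins p_begins)
    show "\<tau> (S * (p * 1)) = 0" "\<tau> (v * (S * (p * 1))) = 0"
      using begins_tau[OF 1] begins_tau[OF v_mult[OF 1]] by simp_all
    have "S * (p * p) = \<sigma> *\<^sub>C S + \<kappa> *\<^sub>C (S * p)" "v * (S * (p * p)) = \<sigma> *\<^sub>C (v * S) + \<kappa> *\<^sub>C (v * (S * p))"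
      unfolding pp by (simp_all add: algebra_simps)
    then show "\<tau> (S * (p * p)) = \<sigma>" "\<tau> (v * (S * (p * p))) = 0"
      using tau_S begins_tau[OF 1] begins_tau[OF vS] begins_tau[OF v_mult[OF 1]] M
      by (simp_all add: tau_add tau_scaleC closed_mult closed_scaleC)
  qed
  have v'S'r: "\<tau> (v' * (S' * r)) = 0" "\<tau> (v * (v' * (S' * r))) = \<theta> * \<tau> (S' * r)" if r: "r \<in> R" for r
  proof -
    show "\<tau> (v' * (S' * r)) = 0" using begins_tau[OF x_S'_r[OF v' r]] .
    have "v * (v' * (S' * r)) = \<theta> *\<^sub>C (S' * r) + c1 *\<^sub>C (v * (S' * r)) + c2 *\<^sub>C (v' * (S' * r))"
      unfolding mult.assoc[of v, symmetric] vv by (simp add: algebra_simps)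
    then show "\<tau> (v * (v' * (S' * r))) = \<theta> * \<tau> (S' * r)"
      using begins_tau[OF x_S'_r[OF v' r]] begins_tau[OF x_S'_r[OF v r]] M RM[OF r]
      by (simp add: tau_add tau_scaleC closed_mult closed_scaleC closed_add)
  qed
  have G: "\<tau> (l * (S * (p * (S' * r)))) = \<tau> (l * (S * (p * r))) + c' * \<sigma> * \<tau> (l * (S * (v' * (S' * r))))"
    if l: "l = 1 \<or> l = v" and r: "r \<in> R" for l r
  proof -
    have "p * (S' * r) = p * r + c' *\<^sub>C ((p * p) * (v' * (S' * r)))"
      by (subst S'_unfold) (simp add: algebra_simps)
    also have "\<dots> = p * r + (c' * \<sigma>) *\<^sub>C (v' * (S' * r)) + (c' * \<kappa>) *\<^sub>C (p * (v' * (S' * r)))"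
      unfolding pp by (simp add: algebra_simps scaleC_add_right scaleC_scaleC)
    finally have "l * (S * (p * (S' * r))) = l * (S * (p * r)) + (c' * \<sigma>) *\<^sub>C (l * (S * (v' * (S' * r))))
        + (c' * \<kappa>) *\<^sub>C (l * (S * (p * (v' * (S' * r)))))" by (simp add: distrib_left)
    moreover have "\<tau> (l * (S * (p * (v' * (S' * r))))) = 0" using mid_pv(1,2)[OF r] l by auto
    moreover have "l \<in> M" using l M closed_one by auto
    ultimately show ?thesis using M RM[OF r] by (simp add: tau_add tau_scaleC closed_mult closed_scaleC closed_add)
  qed
  have H: "\<tau> (l * (S * (v' * (S' * r)))) = \<tau> (l * (v' * (S' * r))) + c * \<theta> * \<tau> (l * (S * (p * (S' * r))))"
    if l: "l = 1 \<or> l = v" and r: "r \<in> R" for l r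
  proof -
    have "S * (v' * (S' * r)) = v' * (S' * r) + c *\<^sub>C (S * (p * ((v * v') * (S' * r))))"
      by (subst S_unfold) (simp add: algebra_simps)
    also have "\<dots> = v' * (S' * r) + (c * \<theta>) *\<^sub>C (S * (p * (S' * r))) + (c * c1) *\<^sub>C (S * (p * (v * (S' * r))))
        + (c * c2) *\<^sub>C (S * (p * (v' * (S' * r))))"
      unfolding vv by (simp add: algebra_simps scaleC_add_right scaleC_scaleC)
    finally have "l * (S * (v' * (S' * r))) = l * (v' * (S' * r)) + (c * \<theta>) *\<^sub>C (l * (S * (p * (S' * r))))
        + (c * c1) *\<^sub>C (l * (S * (p * (v * (S' * r))))) + (c * c2) *\<^sub>C (l * (S * (p * (v' * (S' * r)))))"
      by (simp add: distrib_left)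
    moreover have "\<tau> (l * (S * (p * (v' * (S' * r))))) = 0" "\<tau> (l * (S * (p * (v * (S' * r))))) = 0"
      using mid_pv[OF r] l by auto
    moreover have "l \<in> M" using l M closed_one by auto
    ultimately show ?thesis using M RM[OF r] by (simp add: tau_add tau_scaleC closed_mult closed_scaleC closed_add)
  qed
  define d where "d = 1 - c * c' * \<sigma> * \<theta>"
  have R1: "1 \<in> R" "p \<in> R" by (simp_all add: R_def)
  \<comment> \<open>For l = 1 and r = p a vanishing determinant would turn the system into x =
    \<sigma> + x, hence \<sigma> = 0, against c c' \<sigma> \<theta> = 1.\<close>
  have d: "d \<noteq> 0"
  proof
    assume "d = 0"
    then have "c * c' * \<sigma> * \<theta> = 1" by (simp add: d_def)
    moreover have "\<tau> (S * (p * (S' * p))) = \<sigma> + c' * \<sigma> * (c * \<theta> * \<tau> (S * (p * (S' * p))))"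
      using G[of 1 p] H[of 1 p] R1 Spr v'S'r[OF R1(2)] by simp
    ultimately have "\<sigma> = 0" by algebra
    then show False using \<open>c * c' * \<sigma> * \<theta> = 1\<close> by simp
  qed
  then show "c * c' * \<sigma> * \<theta> \<noteq> 1" by (simp add: d_def)
  have solve: "x = (e + c' * \<sigma> * f) / d" "w = (f + c * \<theta> * e) / d"
    if "x = e + c' * \<sigma> * w" "w = f + c * \<theta> * x" for x w e f
  proof -
    have "x * d = e + c' * \<sigma> * f" "w * d = f + c * \<theta> * e"
      unfolding d_def using that by algebra+
    then show "x = (e + c' * \<sigma> * f) / d" "w = (f + c * \<theta> * e) / d" using d by (simp_all add: field_simps)
  qed
  note s11 = solve[OF G[of 1 1] H[of 1 1]] and s1p = solve[OF G[of 1 p] H[of 1 p]]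
    and sv1 = solve[OF G[of v 1] H[of v 1]] and svp = solve[OF G[of v p] H[of v p]]
  have vals: "\<tau> (S * (p * S')) = 0" "\<tau> (S * (v' * S')) = 0"
    "\<tau> (S * (p * (S' * p))) = \<sigma> / d" "\<tau> (S * (v' * (S' * p))) = c * \<theta> * \<sigma> / d"
    "\<tau> (v * (S * (p * S'))) = c' * \<sigma> * \<theta> / d" "\<tau> (v * (S * (v' * S'))) = \<theta> / d"
    "\<tau> (v * (S * (p * (S' * p)))) = 0" "\<tau> (v * (S * (v' * (S' * p)))) = 0"
    using s11 s1p sv1 svp R1 Spr v'S'r[OF R1(1)] v'S'r[OF R1(2)] tau_S'_r by simp_all
  \<comment> \<open>Of the sixteen terms five have nonzero trace in general: four solutions of the
    linear system and the term S S'.\<close>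
  have "(v + a *\<^sub>C 1) * S * (y *\<^sub>C p + a *\<^sub>C 1) * ((v' + b *\<^sub>C 1) * S' * (z *\<^sub>C p + b *\<^sub>C 1))
    = (y * z) *\<^sub>C (v * (S * (p * (v' * (S' * p))))) + (y * b) *\<^sub>C (v * (S * (p * (v' * S'))))
    + (y * b * z) *\<^sub>C (v * (S * (p * (S' * p)))) + (y * b * b) *\<^sub>C (v * (S * (p * S')))
    + (a * z) *\<^sub>C (v * (S * (v' * (S' * p)))) + (a * b) *\<^sub>C (v * (S * (v' * S')))
    + (a * b * z) *\<^sub>C (v * (S * (S' * p))) + (a * b * b) *\<^sub>C (v * (S * S'))
    + (a * y * z) *\<^sub>C (S * (p * (v' * (S' * p)))) + (a * y * b) *\<^sub>C (S * (p * (v' * S')))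
    + (a * y * b * z) *\<^sub>C (S * (p * (S' * p))) + (a * y * b * b) *\<^sub>C (S * (p * S'))
    + (a * a * z) *\<^sub>C (S * (v' * (S' * p))) + (a * a * b) *\<^sub>C (S * (v' * S'))
    + (a * a * b * z) *\<^sub>C (S * (S' * p)) + (a * a * b * b) *\<^sub>C (S * S')"
    by (simp add: distrib_left distrib_right scaleC_add_right scaleC_scaleC mult.assoc) (simp add: mult_ac add_ac)
  then have "\<tau> ((v + a *\<^sub>C 1) * S * (y *\<^sub>C p + a *\<^sub>C 1) * ((v' + b *\<^sub>C 1) * S' * (z *\<^sub>C p + b *\<^sub>C 1)))
    = y * b * b * (c' * \<sigma> * \<theta> / d) + a * b * (\<theta> / d) + a * y * b * z * (\<sigma> / d) + a * a * z * (c * \<theta> * \<sigma> / d)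
      + a * a * b * b"
    using M mid_pv[OF R1(1)] mid_pv[OF R1(2)] SS' vals
    by (simp only: tau_add tau_scaleC closed_add closed_mult closed_scaleC) simp
  also have "\<dots> = a\<^sup>2 * b\<^sup>2 + (y * b * (a * z * \<sigma> + b * c' * \<sigma> * \<theta>) + a * (a * z * c * \<theta> * \<sigma> + b * \<theta>)) / d"
    using d by (simp add: field_simps power2_eq_square)
  finally show "\<tau> ((v + a *\<^sub>C 1) * S * (y *\<^sub>C p + a *\<^sub>C 1) * ((v' + b *\<^sub>C 1) * S' * (z *\<^sub>C p + b *\<^sub>C 1)))
    = a\<^sup>2 * b\<^sup>2 + (y * b * (a * z * \<sigma> + b * c' * \<sigma> * \<theta>) + a * (a * z * c * \<theta> * \<sigma> + b * \<theta>)) / (1 - c * c' * \<sigma> * \<theta>)"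
    unfolding d_def .
qed

end

section \<open>Resolvents of u and of its compression\<close>

lemma scaleC_power: "(c *\<^sub>C T) ^ n = c ^ n *\<^sub>C (T :: 'h::complex_inner bop) ^ n"
  by (induction n) (simp_all add: scaleC_scaleC mult.commute)

lemma tendsto_scaleC_left_bop:
  fixes f :: "nat \<Rightarrow> complex" and T :: "'h::complex_inner bop"
  assumes "f \<longlonglongrightarrow> c"
  shows "(\<lambda>n. f n *\<^sub>C T) \<longlonglongrightarrow> c *\<^sub>C T"
proof (rule LIM_zero_cancel, rule Lim_null_comparison)
  show "\<forall>\<^sub>F n in sequentially. norm (f n *\<^sub>C T - c *\<^sub>C T) \<le> cmod (f n - c) * norm T"
    using norm_scaleC_bop[of "f n - c" T for n] by (simp add: scaleC_diff_left)
  show "(\<lambda>n. cmod (f n - c) * norm T) \<longlonglongrightarrow> 0"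
    by (intro tendsto_mult_left_zero tendsto_norm_zero LIM_zero assms)
qed

text \<open>Unitarity turns (1 - c u)(1 - c' adj u) into a linear combination of the two factors and
  1; multiplying by the inverses does the same for K K'. This is why the product v v' of the centred
  resolvents has the form needed in \<open>trace_geometric_product\<close>.\<close>

lemma resolvent_product:
  fixes u :: "'h::chilbert_space bop"
  assumes u: "unitary u" and K: "K * (1 - c *\<^sub>C u) = 1" and K': "(1 - c' *\<^sub>C adj u) * K' = 1"
  shows "K + K' - 1 = (1 - c * c') *\<^sub>C (K * K')"
proof -
  have uu: "u * adj u = 1" using u by (simp add: unitary_def)
  have "(1 - c *\<^sub>C u) * (1 - c' *\<^sub>C adj u) = (1 - c *\<^sub>C u) + (1 - c' *\<^sub>C adj u) - (1 - c * c') *\<^sub>C 1"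
    by (simp add: algebra_simps scaleC_scaleC scaleC_diff_left scaleC_diff_right uu)
  then have "K * ((1 - c *\<^sub>C u) * (1 - c' *\<^sub>C adj u)) * K'
      = K * ((1 - c *\<^sub>C u) + (1 - c' *\<^sub>C adj u) - (1 - c * c') *\<^sub>C 1) * K'" by simp
  also have "\<dots> = (K * (1 - c *\<^sub>C u)) * K' + K * ((1 - c' *\<^sub>C adj u) * K') - (1 - c * c') *\<^sub>C (K * K')"
    by (simp only: distrib_left distrib_right right_diff_distrib left_diff_distrib mult.assoc scaleC_mult_left scaleC_mult_right mult_1_left)
  also have "\<dots> = K + K' - (1 - c * c') *\<^sub>C (K * K')" by (simp only: K K' mult_1_left mult_1_right add.commute)
  also have "K * ((1 - c *\<^sub>C u) * (1 - c' *\<^sub>C adj u)) * K' = (K * (1 - c *\<^sub>C u)) * ((1 - c' *\<^sub>C adj u) * K')"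
    by (simp only: mult.assoc)
  also have "\<dots> = 1" by (simp only: K K' mult_1_left)
  finally show ?thesis by (simp add: algebra_simps)
qed

text \<open>Haagerup's factorisation: \<open>(1 + yP) (1 - w P u) = (1 + a) (1 - N) (1 - c u)\<close>, where
  \<open>a = \<alpha> y\<close>, \<open>w = c (1 + a) / (\<alpha> (1 + y))\<close> and \<open>N\<close> is a multiple of the product of the centred
  elements \<open>P - \<alpha>\<close> and \<open>K - (1 + a)\<close>.\<close>

lemma compressed_resolvent:
  fixes P u :: "'h::chilbert_space bop" and \<alpha> y c :: complex
  defines "a \<equiv> \<alpha> * y"
  assumes P: "P * P = P" and nz: "\<alpha> \<noteq> 0" "1 + a \<noteq> 0" "1 + y \<noteq> 0"
    and K: "K * (1 - c *\<^sub>C u) = 1"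
    and S: "S * (1 - (1 / (\<alpha> * (1 + a))) *\<^sub>C ((P - \<alpha> *\<^sub>C 1) * (K - (1 + a) *\<^sub>C 1))) = 1"
    and Z: "(1 - (c * (1 + a) / (\<alpha> * (1 + y))) *\<^sub>C (P * u)) * Z = 1"
  shows "Z = (1 / (1 + a)) *\<^sub>C (K * S * (1 + y *\<^sub>C P))"
proof -
  define w where "w = c * (1 + a) / (\<alpha> * (1 + y))"
  define x where "x = 1 - c *\<^sub>C u"
  define n where "n = (1 / (\<alpha> * (1 + a))) *\<^sub>C ((P - \<alpha> *\<^sub>C 1) * (K - (1 + a) *\<^sub>C 1))"
  have "(K - (1 + a) *\<^sub>C 1) * x = ((1 + a) * c) *\<^sub>C u - a *\<^sub>C 1"
    using K by (simp add: x_def[symmetric] left_diff_distrib)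
      (simp add: x_def scaleC_diff_right scaleC_scaleC scaleC_add_left)
  then have "n * x = (1 / (\<alpha> * (1 + a))) *\<^sub>C ((P - \<alpha> *\<^sub>C 1) * (((1 + a) * c) *\<^sub>C u - a *\<^sub>C 1))"
    by (simp add: n_def mult.assoc)
  also have "\<dots> = (c / \<alpha>) *\<^sub>C (P * u) - c *\<^sub>C u - (y / (1 + a)) *\<^sub>C P + (a / (1 + a)) *\<^sub>C 1"
  proof -
    define \<nu> k where "\<nu> = 1 / (\<alpha> * (1 + a))" and "k = (1 + a) * c"
    have "1 / (\<alpha> * r) * (\<alpha> * y) = y / r" for r using nz(1) by simp
    then have "\<nu> * a = y / (1 + a)" unfolding \<nu>_def a_def .
    moreover have "\<nu> * k = c / \<alpha>" "\<nu> * (k * \<alpha>) = c" "\<nu> * (a * \<alpha>) = a / (1 + a)"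
      using nz by (simp_all add: \<nu>_def k_def)
    moreover have "\<nu> *\<^sub>C ((P - \<alpha> *\<^sub>C 1) * (k *\<^sub>C u - a *\<^sub>C 1))
        = (\<nu> * k) *\<^sub>C (P * u) - (\<nu> * (k * \<alpha>)) *\<^sub>C u - (\<nu> * a) *\<^sub>C P + (\<nu> * (a * \<alpha>)) *\<^sub>C 1"
      by (simp add: left_diff_distrib right_diff_distrib scaleC_diff_right scaleC_scaleC mult.left_commute mult.commute)
    ultimately show ?thesis by (simp only: \<nu>_def k_def)
  qed
  finally have nx: "n * x = (c / \<alpha>) *\<^sub>C (P * u) - c *\<^sub>C u - (y / (1 + a)) *\<^sub>C P + (a / (1 + a)) *\<^sub>C 1" .
  have "(1 + a) *\<^sub>C ((1 - n) * x) = 1 + y *\<^sub>C P - (c * (1 + a) / \<alpha>) *\<^sub>C (P * u)"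
  proof -
    have "(1 + a) * (c / \<alpha>) = c * (1 + a) / \<alpha>" "(1 + a) * (y / (1 + a)) = y"
      "(1 + a) * (a / (1 + a)) = a"
      using nz by simp_all
    moreover have "(1 - n) * x = 1 - (c / \<alpha>) *\<^sub>C (P * u) + (y / (1 + a)) *\<^sub>C P - (a / (1 + a)) *\<^sub>C 1"
      unfolding left_diff_distrib nx by (simp add: x_def)
    ultimately show ?thesis
      by (simp add: scaleC_diff_right scaleC_add_right scaleC_scaleC scaleC_add_left
          del: times_divide_eq_left times_divide_eq_right)
  qed
  also have "\<dots> = (1 + y *\<^sub>C P) * (1 - w *\<^sub>C (P * u))"
  proof -
    have "(1 + y *\<^sub>C P) * (1 - w *\<^sub>C (P * u)) = 1 + y *\<^sub>C P - (w * (1 + y)) *\<^sub>C (P * u)"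
      using P by (simp add: algebra_simps scaleC_scaleC scaleC_add_left scaleC_add_right scaleC_diff_right flip: mult.assoc[of P P])
    moreover have "w * (1 + y) = c * (1 + a) / \<alpha>" using nz by (simp add: w_def)
    ultimately show ?thesis by simp
  qed
  finally have fact: "(1 + y *\<^sub>C P) * (1 - w *\<^sub>C (P * u)) = (1 + a) *\<^sub>C ((1 - n) * x)" by simp
  \<comment> \<open>K is a left inverse of 1 - c u, S one of 1 - n, and Z a right inverse of 1 - w P
    u. Inserting the last pair brings in the factorised product, which then cancels against K and
    S.\<close>
  have "K * S * (1 + y *\<^sub>C P) = K * S * (1 + y *\<^sub>C P) * ((1 - w *\<^sub>C (P * u)) * Z)" using Z by (simp add: w_def)
  also have "\<dots> = K * S * ((1 + y *\<^sub>C P) * (1 - w *\<^sub>C (P * u))) * Z" by (simp only: mult.assoc)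
  also have "\<dots> = (1 + a) *\<^sub>C (K * (S * (1 - n)) * x * Z)" unfolding fact by (simp add: mult.assoc)
  also have "S * (1 - n) = 1" using S by (simp add: n_def)
  also have "K * 1 * x = 1" using K by (simp add: x_def)
  finally show ?thesis using nz by (simp add: scaleC_scaleC)
qed

context free_pair
begin

lemma centred_shift:
  assumes f: "\<And>n::nat. f n \<in> (if i then A else B)" "f \<longlonglongrightarrow> a"
  shows "a - \<tau> a *\<^sub>C 1 \<in> centred i"
proof -
  have 1: "f n - \<tau> (f n) *\<^sub>C 1 \<in> letters i" for n
    using f(1)[of n] A_M B_M
    by (auto simp: letters_def tau_diff tau_scaleC tau_one star_closed A.closed_diff A.closed_scaleC A.closed_one
        B.closed_diff B.closed_scaleC B.closed_one split: if_splits)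
  have "f n \<in> M" for n using f(1)[of n] A_M B_M by (auto split: if_splits)
  then have 2: "(\<lambda>n. f n - \<tau> (f n) *\<^sub>C 1) \<longlonglongrightarrow> a - \<tau> a *\<^sub>C 1"
    by (intro tendsto_diff f(2) tendsto_scaleC_left_bop tau_tendsto)
  show ?thesis unfolding centred_def using 1 2 by (intro CollectI exI conjI allI)
qed

text \<open>The series hypothesis says that the resolvent K of c u has trace 1 + a. The norm bound
  comes from K - 1 = c u K and norm K \<le> 1 + norm (K - 1); it is the quantity appearing in
  \<open>small_parameter\<close>.\<close>

lemma resolvent_centred:
  assumes u: "u \<in> B" "unitary u" and c: "cmod c < 1"
    and a: "(\<lambda>n. c ^ Suc n * \<tau> (u ^ Suc n)) sums a"
  obtains K where "(1 - c *\<^sub>C u) * K = 1" "K * (1 - c *\<^sub>C u) = 1" "K - (1 + a) *\<^sub>C 1 \<in> centred False"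
    "norm (K - (1 + a) *\<^sub>C 1) \<le> cmod c / (1 - cmod c) + cmod a"
proof -
  have cu: "norm (c *\<^sub>C u) \<le> cmod c"
    using norm_scaleC_bop[of c u] mult_left_mono[OF norm_unitary_le[OF u(2)], of "cmod c"] by simp
  obtain K where K: "(\<lambda>k. (c *\<^sub>C u) ^ k) sums K" "(1 - c *\<^sub>C u) * K = 1" "K * (1 - c *\<^sub>C u) = 1"
    by (rule bop_geometric[OF le_less_trans[OF cu c]])
  have uM: "u \<in> M" using u B_M by blast
  have "(\<lambda>k. \<tau> ((c *\<^sub>C u) ^ k)) sums \<tau> K"
    using uM by (intro sums_in_M(2)[OF _ K(1)]) (simp add: star_closed)
  then have "(\<lambda>k. c ^ k * \<tau> (u ^ k)) sums \<tau> K"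
    using uM by (simp add: scaleC_power tau_scaleC closed_power)
  moreover have "(\<lambda>k. c ^ k * \<tau> (u ^ k)) sums (a + 1)"
    using sums_Suc_iff[of "\<lambda>k. c ^ k * \<tau> (u ^ k)" a] a by (simp add: tau_one)
  ultimately have \<tau>K: "\<tau> K = 1 + a" using sums_unique2 by (metis add.commute)
  have "(\<Sum>k<n. (c *\<^sub>C u) ^ k) \<in> (if False then A else B)" for n
    using u(1) by (simp add: B.closed_sum B.closed_power B.closed_scaleC)
  then have cen: "K - (1 + a) *\<^sub>C 1 \<in> centred False"
    using centred_shift[of "\<lambda>n. \<Sum>k<n. (c *\<^sub>C u) ^ k" False K] K(1) by (simp add: sums_def \<tau>K)
  have "K - 1 = c *\<^sub>C u * K" using K(2) by (simp add: left_diff_distrib algebra_simps)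
  then have "norm (K - 1) \<le> cmod c * norm K"
    using norm_mult_ineq[of "c *\<^sub>C u" K] mult_right_mono[OF cu, of "norm K"] by simp
  also have "norm K \<le> 1 + norm (K - 1)"
    using norm_triangle_ineq[of 1 "K - 1"] norm_bop_one[where 'h = 'h] by simp
  finally have "norm (K - 1) \<le> cmod c * (1 + norm (K - 1))" by (simp add: mult_left_mono)
  then have "norm (K - 1) \<le> cmod c / (1 - cmod c)" using c by (simp add: field_simps)
  moreover have "norm (a *\<^sub>C (1 :: 'h bop)) \<le> cmod a"
    using norm_scaleC_bop[of a "1 :: 'h bop"] mult_left_mono[OF norm_bop_one[where 'h = 'h], of "cmod a"] by simp
  moreover have eq: "K - (1 + a) *\<^sub>C 1 = (K - 1) - a *\<^sub>C 1" by (simp add: scaleC_add_left)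
  ultimately have "norm (K - (1 + a) *\<^sub>C 1) \<le> cmod c / (1 - cmod c) + cmod a"
    unfolding eq using norm_triangle_ineq4[of "K - 1" "a *\<^sub>C (1 :: 'h bop)"] by linarith
  with K(2,3) cen show ?thesis using that by blast
qed

text \<open>The last condition says that \<open>c\<close> is the value at \<open>\<alpha> y\<close> of the inverse of the moment
  series of \<open>u\<close>; the others make the Neumann series of all factors converge.\<close>

definition small_parameter :: "real \<Rightarrow> 'h bop \<Rightarrow> complex \<Rightarrow> complex \<Rightarrow> bool" where
  "small_parameter \<alpha> u c y \<longleftrightarrow> cmod c < 1 \<and> 1 + of_real \<alpha> * y \<noteq> 0 \<and> 1 + y \<noteq> 0 \<and>
     cmod (c * (1 + of_real \<alpha> * y) / (of_real \<alpha> * (1 + y))) < 1 \<and>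
     2 / (\<alpha> * cmod (1 + of_real \<alpha> * y)) * (cmod c / (1 - cmod c) + cmod (of_real \<alpha> * y)) < 1 \<and>
     (\<lambda>n. c ^ Suc n * \<tau> (u ^ Suc n)) sums (of_real \<alpha> * y)"

lemma compressed_resolvent_expansion:
  assumes P: "P \<in> A" "adj P = P" "P * P = P" "\<tau> P = of_real \<alpha>" and \<alpha>: "0 < \<alpha>" "\<alpha> \<le> 1"
    and u: "u \<in> B" "unitary u" and y: "small_parameter \<alpha> u c y"
  defines "w \<equiv> c * (1 + of_real \<alpha> * y) / (of_real \<alpha> * (1 + y))" and "a \<equiv> 1 + of_real \<alpha> * y"
    and "p \<equiv> P - of_real \<alpha> *\<^sub>C 1"
  obtains v S where "v \<in> centred False" "(\<lambda>k. ((1 / (of_real \<alpha> * a)) *\<^sub>C (p * v)) ^ k) sums S"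
    "(\<lambda>m. (w *\<^sub>C (P * u)) ^ m) sums ((1 / a) *\<^sub>C ((v + a *\<^sub>C 1) * S * (y *\<^sub>C p + a *\<^sub>C 1)))"
    "(1 - c *\<^sub>C u) * (v + a *\<^sub>C 1) = 1" "(v + a *\<^sub>C 1) * (1 - c *\<^sub>C u) = 1"
proof -
  have c: "cmod c < 1" "a \<noteq> 0" "1 + y \<noteq> 0" "cmod w < 1"
    "2 / (\<alpha> * cmod a) * (cmod c / (1 - cmod c) + cmod (of_real \<alpha> * y)) < 1"
    "(\<lambda>n. c ^ Suc n * \<tau> (u ^ Suc n)) sums (of_real \<alpha> * y)"
    using y by (simp_all add: small_parameter_def a_def w_def del: of_real_mult)
  obtain K where K: "(1 - c *\<^sub>C u) * K = 1" "K * (1 - c *\<^sub>C u) = 1"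
    "K - (1 + of_real \<alpha> * y) *\<^sub>C 1 \<in> centred False"
    "norm (K - (1 + of_real \<alpha> * y) *\<^sub>C 1) \<le> cmod c / (1 - cmod c) + cmod (of_real \<alpha> * y)"
    by (rule resolvent_centred[OF u c(1,6)])
  define v where "v = K - a *\<^sub>C 1"
  have v: "v \<in> centred False" "norm v \<le> cmod c / (1 - cmod c) + cmod (of_real \<alpha> * y)" "v + a *\<^sub>C 1 = K"
    using K by (simp_all add: v_def a_def)
  let ?\<nu> = "1 / (of_real \<alpha> * a)"
  have "norm (of_real \<alpha> *\<^sub>C (1 :: 'h bop)) \<le> cmod (of_real \<alpha>) * norm (1 :: 'h bop)"
    by (rule norm_scaleC_bop)
  also have "\<dots> \<le> cmod (of_real \<alpha>) * 1" by (intro mult_left_mono norm_bop_one) simp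
  \<comment> \<open>The origin of the constant 2 in \<open>small_parameter\<close>.\<close>
  finally have "norm p \<le> 2"
    using norm_triangle_ineq4[of P "of_real \<alpha> *\<^sub>C 1"] norm_projection_le[OF P(2,3)] \<alpha> by (simp add: p_def)
  then have "norm p * norm v \<le> 2 * norm v" by (intro mult_right_mono) simp_all
  then have "norm (p * v) \<le> 2 * norm v" using norm_mult_ineq[of p v] by linarith
  then have "norm (?\<nu> *\<^sub>C (p * v)) \<le> cmod ?\<nu> * (2 * norm v)"
    using norm_scaleC_bop[of ?\<nu> "p * v"] mult_left_mono[of "norm (p * v)" "2 * norm v" "cmod ?\<nu>"] by simp
  also have "\<dots> = 2 / (\<alpha> * cmod a) * norm v" using \<alpha> by (simp add: norm_divide norm_mult)
  also have "\<dots> \<le> 2 / (\<alpha> * cmod a) * (cmod c / (1 - cmod c) + cmod (of_real \<alpha> * y))"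
    using v(2) \<alpha> by (intro mult_left_mono) simp_all
  also have "\<dots> < 1" by (rule c(5))
  finally have "norm (?\<nu> *\<^sub>C (p * v)) < 1" .
  then obtain S where S: "(\<lambda>k. (?\<nu> *\<^sub>C (p * v)) ^ k) sums S" "(1 - ?\<nu> *\<^sub>C (p * v)) * S = 1"
    "S * (1 - ?\<nu> *\<^sub>C (p * v)) = 1"
    by (rule bop_geometric)
  have "norm (P * u) \<le> 1 * 1"
    by (rule order_trans[OF norm_mult_ineq]) (intro mult_mono norm_projection_le[OF P(2,3)] norm_unitary_le u(2), simp_all)
  then have "norm (w *\<^sub>C (P * u)) \<le> cmod w * 1"
    using norm_scaleC_bop[of w "P * u"] mult_left_mono[of "norm (P * u)" 1 "cmod w"] by simp
  then have "norm (w *\<^sub>C (P * u)) < 1" using c(4) by simp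
  then obtain Z where Z: "(\<lambda>m. (w *\<^sub>C (P * u)) ^ m) sums Z" "(1 - w *\<^sub>C (P * u)) * Z = 1"
    "Z * (1 - w *\<^sub>C (P * u)) = 1"
    by (rule bop_geometric)
  have "Z = (1 / a) *\<^sub>C (K * S * (1 + y *\<^sub>C P))"
    unfolding a_def
    by (rule compressed_resolvent) (use P \<alpha> c K S Z in \<open>simp_all add: a_def w_def p_def v_def\<close>)
  moreover have "1 + y *\<^sub>C P = y *\<^sub>C p + a *\<^sub>C 1"
    by (simp add: p_def a_def scaleC_diff_right scaleC_add_left scaleC_scaleC mult.commute)
  ultimately show ?thesis using that[OF v(1) S(1)] Z(1) K(1,2) v(3) by simp
qed

text \<open>The abstract trace formula applies with \<sigma> = \<tau>(p^2) and \<theta> = \<tau>(v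
  v'). The former is the variance of a projection of trace \<alpha>; the latter is read off from
  \<open>resolvent_product\<close> after subtracting the means a and b.\<close>

lemma trace_compressed_resolvents:
  assumes P: "P \<in> A" "adj P = P" "P * P = P" "\<tau> P = of_real \<alpha>" and \<alpha>: "0 < \<alpha>" "\<alpha> \<le> 1"
    and u: "u \<in> B" "unitary u" and y: "small_parameter \<alpha> u c y" and z: "small_parameter \<alpha> (adj u) c' z"
    and X: "(\<lambda>m. ((c * (1 + of_real \<alpha> * y) / (of_real \<alpha> * (1 + y))) *\<^sub>C (P * u)) ^ m) sums X"
    and X': "(\<lambda>m. ((c' * (1 + of_real \<alpha> * z) / (of_real \<alpha> * (1 + z))) *\<^sub>C (P * adj u)) ^ m) sums X'"
  defines "a \<equiv> 1 + of_real \<alpha> * y" and "b \<equiv> 1 + of_real \<alpha> * z" and "\<sigma> \<equiv> complex_of_real (\<alpha> * (1 - \<alpha>))"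
  defines "\<theta> \<equiv> (a + b - 1) / (1 - c * c') - a * b"
  defines "\<rho> \<equiv> (1 / (of_real \<alpha> * a)) * (1 / (of_real \<alpha> * b)) * \<sigma> * \<theta>"
  shows "\<rho> \<noteq> 1" "c * c' \<noteq> 1"
    "\<tau> (X * X') = (a\<^sup>2 * b\<^sup>2 + (y * b * (a * z * \<sigma> + b * (1 / (of_real \<alpha> * b)) * \<sigma> * \<theta>)
        + a * (a * z * (1 / (of_real \<alpha> * a)) * \<theta> * \<sigma> + b * \<theta>)) / (1 - \<rho>)) / (a * b)"
proof -
  define p where "p = P - of_real \<alpha> *\<^sub>C 1"
  obtain v S where v: "v \<in> centred False" "(\<lambda>k. ((1 / (of_real \<alpha> * a)) *\<^sub>C (p * v)) ^ k) sums S"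
    "(\<lambda>m. ((c * a / (of_real \<alpha> * (1 + y))) *\<^sub>C (P * u)) ^ m) sums
      ((1 / a) *\<^sub>C ((v + a *\<^sub>C 1) * S * (y *\<^sub>C p + a *\<^sub>C 1)))"
    "(1 - c *\<^sub>C u) * (v + a *\<^sub>C 1) = 1" "(v + a *\<^sub>C 1) * (1 - c *\<^sub>C u) = 1"
    by (rule compressed_resolvent_expansion[OF P \<alpha> u y, folded a_def p_def])
  have u': "adj u \<in> B" "unitary (adj u)" using u B.closed_adj by simp_all
  obtain v' S' where v': "v' \<in> centred False" "(\<lambda>k. ((1 / (of_real \<alpha> * b)) *\<^sub>C (p * v')) ^ k) sums S'"
    "(\<lambda>m. ((c' * b / (of_real \<alpha> * (1 + z))) *\<^sub>C (P * adj u)) ^ m) sums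
      ((1 / b) *\<^sub>C ((v' + b *\<^sub>C 1) * S' * (z *\<^sub>C p + b *\<^sub>C 1)))"
    "(1 - c' *\<^sub>C adj u) * (v' + b *\<^sub>C 1) = 1" "(v' + b *\<^sub>C 1) * (1 - c' *\<^sub>C adj u) = 1"
    by (rule compressed_resolvent_expansion[OF P \<alpha> u' z, folded b_def p_def])
  have p: "p \<in> centred True"
    unfolding p_def P(4)[symmetric] by (rule centred_shift[of "\<lambda>_. P"]) (use P in simp_all)
  have pp: "p * p = \<sigma> *\<^sub>C 1 + (1 - 2 * of_real \<alpha>) *\<^sub>C p"
  proof -
    have "p * p = P - of_real \<alpha> *\<^sub>C P - of_real \<alpha> *\<^sub>C P + (of_real \<alpha> * of_real \<alpha>) *\<^sub>C 1"
      using P(3) by (simp add: p_def algebra_simps scaleC_scaleC scaleC_diff_right)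
    moreover have "\<sigma> = of_real \<alpha> - of_real \<alpha> * of_real \<alpha>" by (simp add: \<sigma>_def algebra_simps)
    then have "\<sigma> *\<^sub>C (1 :: 'h bop) = of_real \<alpha> *\<^sub>C 1 - (of_real \<alpha> * of_real \<alpha>) *\<^sub>C 1"
      by (simp only: scaleC_diff_left)
    moreover have "(1 - 2 * of_real \<alpha>) *\<^sub>C p = p - of_real \<alpha> *\<^sub>C p - of_real \<alpha> *\<^sub>C p"
    proof -
      have "1 - 2 * of_real \<alpha> = 1 - of_real \<alpha> - (of_real \<alpha> :: complex)" by simp
      then show ?thesis by (simp only: scaleC_diff_left scaleC_one)
    qed
    moreover have "of_real \<alpha> *\<^sub>C p = of_real \<alpha> *\<^sub>C P - (of_real \<alpha> * of_real \<alpha>) *\<^sub>C 1"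
      by (simp add: p_def scaleC_diff_right scaleC_scaleC)
    ultimately show ?thesis by (simp add: p_def)
  qed
  have cc: "cmod c < 1" "cmod c' < 1" "a \<noteq> 0" "b \<noteq> 0" using y z by (simp_all add: small_parameter_def a_def b_def)
  have "cmod (c * c') \<le> 1 * cmod c'" unfolding norm_mult using cc by (intro mult_right_mono) simp_all
  then show q: "c * c' \<noteq> 1" using cc by auto
  define e where "e = 1 / (1 - c * c')"
  have vv: "v * v' = \<theta> *\<^sub>C 1 + (e - b) *\<^sub>C v + (e - a) *\<^sub>C v'"
  proof -
    have "(v + a *\<^sub>C 1) * (v' + b *\<^sub>C 1) = e *\<^sub>C ((1 - c * c') *\<^sub>C ((v + a *\<^sub>C 1) * (v' + b *\<^sub>C 1)))"
      using q by (simp add: e_def scaleC_scaleC)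
    also have "\<dots> = e *\<^sub>C ((v + a *\<^sub>C 1) + (v' + b *\<^sub>C 1) - 1)"
      unfolding resolvent_product[OF u(2) v(5) v'(4)] ..
    also have "\<dots> = e *\<^sub>C v + e *\<^sub>C v' + (e * (a + b - 1)) *\<^sub>C 1"
      by (simp add: scaleC_add_right scaleC_diff_right scaleC_scaleC distrib_left right_diff_distrib
          scaleC_add_left scaleC_diff_left)
    finally have "v * v' = e *\<^sub>C v + e *\<^sub>C v' + (e * (a + b - 1)) *\<^sub>C 1 - b *\<^sub>C v - a *\<^sub>C v' - (a * b) *\<^sub>C 1"
      by (simp add: distrib_left distrib_right scaleC_scaleC scaleC_add_right algebra_simps)
    moreover have "\<theta> = e * (a + b - 1) - a * b" by (simp add: \<theta>_def e_def)
    ultimately show ?thesis by (simp add: scaleC_diff_left)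
  qed
  note T = trace_geometric_product[OF p v(1) v'(1) v(2) v'(2) pp vv]
  show "\<rho> \<noteq> 1" using T(1) by (simp add: \<rho>_def)
  have M: "v \<in> M" "v' \<in> M" "p \<in> M" "S \<in> M" "S' \<in> M"
    using centred_M p v(1) v'(1) geometric_begins(5)[OF p v(1,2)] geometric_begins(5)[OF p v'(1,2)] by auto
  have "X = (1 / a) *\<^sub>C ((v + a *\<^sub>C 1) * S * (y *\<^sub>C p + a *\<^sub>C 1))"
    "X' = (1 / b) *\<^sub>C ((v' + b *\<^sub>C 1) * S' * (z *\<^sub>C p + b *\<^sub>C 1))"
    using sums_unique2[OF X[folded a_def] v(3)] sums_unique2[OF X'[folded b_def] v'(3)] by simp_all
  then have "\<tau> (X * X') = (1 / b) * ((1 / a) *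
      \<tau> ((v + a *\<^sub>C 1) * S * (y *\<^sub>C p + a *\<^sub>C 1) * ((v' + b *\<^sub>C 1) * S' * (z *\<^sub>C p + b *\<^sub>C 1))))"
    using M by (simp only: scaleC_mult_left scaleC_mult_right tau_scaleC closed_mult closed_scaleC closed_add closed_one)
  then show "\<tau> (X * X') = (a\<^sup>2 * b\<^sup>2 + (y * b * (a * z * \<sigma> + b * (1 / (of_real \<alpha> * b)) * \<sigma> * \<theta>)
        + a * (a * z * (1 / (of_real \<alpha> * a)) * \<theta> * \<sigma> + b * \<theta>)) / (1 - \<rho>)) / (a * b)"
    unfolding T(2) \<rho>_def by (simp add: mult.commute)
qed

end

text \<open>\<open>phi\<close> is an unordered sum over pairs. A geometric majorant makes it
  absolutely summable, so it may be evaluated row by row, each row being an ordinary Neumann series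
  under \<tau>.\<close>

lemma (in tracial_vna) tau_double_series:
  assumes x: "x \<in> M" "norm x < 1" "(\<lambda>m. x ^ m) sums X"
    and x': "x' \<in> M" "norm x' < 1" "(\<lambda>n. x' ^ n) sums X'"
  shows "((\<lambda>(m, n). \<tau> (x ^ m * x' ^ n)) has_sum \<tau> (X * X')) UNIV"
proof -
  have X': "X' \<in> M" using sums_in_M(1)[OF closed_power[OF x'(1)] x'(3)] .
  have bd: "cmod (\<tau> (x ^ m * x' ^ n)) \<le> 2 * (norm x ^ m * norm x' ^ n)" for m n
  proof -
    have "cmod (\<tau> (x ^ m * x' ^ n)) \<le> 2 * norm (x ^ m * x' ^ n)"
      using x x' by (intro tau_bounded closed_mult closed_power)
    also have "norm (x ^ m * x' ^ n) \<le> norm x ^ m * norm x' ^ n"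
      by (rule order_trans[OF norm_mult_ineq]) (intro mult_mono norm_bop_power, simp_all)
    finally show ?thesis by simp
  qed
  have geo: "((\<lambda>n. k * norm y ^ n) has_sum (k * (1 / (1 - norm y)))) UNIV" if "norm y < 1" "0 \<le> k"
    for y :: "'h bop" and k
    using that by (intro norm_summable_imp_has_sum sums_mult geometric_sums)
      (auto simp: norm_mult norm_power intro!: summable_mult summable_geometric)
  have "(\<lambda>(m, n). 2 * (norm x ^ m * norm x' ^ n)) summable_on (SIGMA m:UNIV. UNIV)"
  proof (rule summable_on_SigmaI)
    show "((\<lambda>n. case (m, n) of (m, n) \<Rightarrow> 2 * (norm x ^ m * norm x' ^ n)) has_sum
        (2 * (1 / (1 - norm x')) * norm x ^ m)) UNIV" for m :: nat
      using geo[OF x'(2), of "2 * norm x ^ m"] by (simp add: mult_ac)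
    show "(\<lambda>m::nat. 2 * (1 / (1 - norm x')) * norm x ^ m) summable_on UNIV"
      using geo[OF x(2), of "2 * (1 / (1 - norm x'))"] x'(2) by (auto simp: summable_on_def)
  qed auto
  then have "(\<lambda>(m, n). norm (\<tau> (x ^ m * x' ^ n))) summable_on (SIGMA m:UNIV. UNIV)"
    using Infinite_Sum.abs_summable_on_comparison_test'[of "\<lambda>(m, n). 2 * (norm x ^ m * norm x' ^ n)" "SIGMA m:UNIV. UNIV"
        "\<lambda>(m, n). \<tau> (x ^ m * x' ^ n)"] bd by (auto simp: case_prod_unfold)
  then have sm: "(\<lambda>(m, n). \<tau> (x ^ m * x' ^ n)) summable_on (SIGMA m:UNIV. UNIV)"
    using abs_summable_summable[of "\<lambda>(m, n). \<tau> (x ^ m * x' ^ n)" "SIGMA m:UNIV. UNIV"] by (simp add: case_prod_unfold)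
  have "((\<lambda>(m, n). \<tau> (x ^ m * x' ^ n)) has_sum \<tau> (X * X')) (SIGMA m:UNIV. UNIV)"
  proof (rule has_sum_SigmaI[OF _ _ sm])
    fix m :: nat
    have "(\<lambda>n. x ^ m * x' ^ n) sums (x ^ m * X')"
      by (rule bounded_linear.sums[OF bounded_linear_mult_right x'(3)])
    then have "(\<lambda>n. \<tau> (x ^ m * x' ^ n)) sums \<tau> (x ^ m * X')"
      using x x' by (intro sums_in_M(2) closed_mult closed_power)
    moreover have "summable (\<lambda>n. norm (\<tau> (x ^ m * x' ^ n)))"
    proof (rule summable_comparison_test')
      show "summable (\<lambda>n. 2 * (norm x ^ m * norm x' ^ n))"
        using x'(2) by (intro summable_mult summable_geometric) simp
    qed (use bd[of m] in simp)
    ultimately show "((\<lambda>n. case (m, n) of (m, n) \<Rightarrow> \<tau> (x ^ m * x' ^ n)) has_sum \<tau> (x ^ m * X')) UNIV"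
      using norm_summable_imp_has_sum by auto
  next
    have "(\<lambda>m. x ^ m * X') sums (X * X')"
      by (rule bounded_linear.sums[OF bounded_linear_mult_left x(3)])
    then have 1: "(\<lambda>m. \<tau> (x ^ m * X')) sums \<tau> (X * X')"
      using x X' by (intro sums_in_M(2) closed_mult closed_power)
    have 2: "summable (\<lambda>m. norm (\<tau> (x ^ m * X')))"
    proof (rule summable_comparison_test')
      show "summable (\<lambda>m. 2 * (norm x ^ m * norm X'))"
        using x(2) by (intro summable_mult summable_mult2 summable_geometric) simp
      fix m
      have "cmod (\<tau> (x ^ m * X')) \<le> 2 * norm (x ^ m * X')"
        using x X' by (intro tau_bounded closed_mult closed_power)
      also have "norm (x ^ m * X') \<le> norm x ^ m * norm X'"
        by (rule order_trans[OF norm_mult_ineq]) (intro mult_mono norm_bop_power, simp_all)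
      finally show "norm (norm (\<tau> (x ^ m * X'))) \<le> 2 * (norm x ^ m * norm X')" by simp
    qed
    show "((\<lambda>m. \<tau> (x ^ m * X')) has_sum \<tau> (X * X')) UNIV"
      by (rule norm_summable_imp_has_sum[OF 2 1])
  qed
  then show ?thesis by simp
qed

text \<open>Clearing denominators turns the trace formula into \<Phi> D = W, where W = s \<alpha>^2
  (1 + y)(1 + z) is free of \<open>q\<close> and D = \<alpha>^2 y z + \<alpha> s - q a b; so
  -1/\<Phi> = - D / W. The exponential enters only through q a b = \<alpha>^2 y z E.\<close>

lemma generating_function_identity:
  fixes \<alpha> y z q E \<Phi> :: complex
  defines "a \<equiv> 1 + \<alpha> * y" and "b \<equiv> 1 + \<alpha> * z" and "s \<equiv> 1 + \<alpha> * y + \<alpha> * z" and "\<sigma> \<equiv> \<alpha> * (1 - \<alpha>)"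
  defines "\<theta> \<equiv> (a + b - 1) / (1 - q) - a * b"
  defines "\<rho> \<equiv> (1 / (\<alpha> * a)) * (1 / (\<alpha> * b)) * \<sigma> * \<theta>"
  defines "\<Phi> \<equiv> (a\<^sup>2 * b\<^sup>2 + (y * b * (a * z * \<sigma> + b * (1 / (\<alpha> * b)) * \<sigma> * \<theta>)
        + a * (a * z * (1 / (\<alpha> * a)) * \<theta> * \<sigma> + b * \<theta>)) / (1 - \<rho>)) / (a * b) - 1 + \<alpha>"
  assumes nz: "\<alpha> \<noteq> 0" "a \<noteq> 0" "b \<noteq> 0" "s \<noteq> 0" "1 + y \<noteq> 0" "1 + z \<noteq> 0" "q \<noteq> 1" "\<rho> \<noteq> 1"
    and q: "q * (a * b) = \<alpha>\<^sup>2 * (y * z) * E"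
  shows "- 1 / \<Phi> = y * z * (E - 1) / (s * (1 + y) * (1 + z)) - 1 / (\<alpha> * (1 + y) * (1 + z))"
proof -
  define D where "D = \<alpha>\<^sup>2 * (y * z) + \<alpha> * s - q * (a * b)"
  define W where "W = s * \<alpha>\<^sup>2 * ((1 + y) * (1 + z))"
  define r where "r = 1 - q"
  define \<theta>1 where "\<theta>1 = s - a * b * r"
  have r: "r \<noteq> 0" using nz by (simp add: r_def)
  have \<theta>: "\<theta> = \<theta>1 / r"
    using r by (simp add: \<theta>_def \<theta>1_def a_def b_def s_def diff_divide_distrib r_def[symmetric])
  have \<rho>: "\<rho> = (1 - \<alpha>) * \<theta>1 / (\<alpha> * (a * b) * r)"
    using nz r by (simp add: \<rho>_def \<sigma>_def \<theta>)
  \<comment> \<open>The determinant of the linear system, cleared of denominators.\<close>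
  have D: "(1 - \<rho>) * (\<alpha> * (a * b) * r) = D"
  proof -
    have "(1 - x / k) * k = k - x" if "k \<noteq> 0" for x k :: complex using that by (simp add: left_diff_distrib)
    then have "(1 - \<rho>) * (\<alpha> * (a * b) * r) = \<alpha> * (a * b) * r - (1 - \<alpha>) * \<theta>1"
      unfolding \<rho> using nz(1-3) r by simp
    then show ?thesis unfolding D_def \<theta>1_def r_def a_def b_def s_def by (simp add: algebra_simps power2_eq_square)
  qed
  have D0: "D \<noteq> 0" using D nz r by auto
  have inv: "1 / (1 - \<rho>) = \<alpha> * (a * b) * r / D"
    unfolding D[symmetric] using nz r by simp
  define U where "U = a * b * (y * z) * \<sigma> + \<theta> * (y * b * (1 - \<alpha>) + a * z * (1 - \<alpha>) + a * b)"
  have "y * b * (a * z * \<sigma> + b * (1 / (\<alpha> * b)) * \<sigma> * \<theta>) + a * (a * z * (1 / (\<alpha> * a)) * \<theta> * \<sigma> + b * \<theta>) = U"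
  proof -
    have \<sigma>1: "1 / \<alpha> * \<sigma> = 1 - \<alpha>" "b * (1 / (\<alpha> * b)) = 1 / \<alpha>" "a * (1 / (\<alpha> * a)) = 1 / \<alpha>"
      using nz by (simp_all add: \<sigma>_def)
    have "b * (1 / (\<alpha> * b)) * \<sigma> * \<theta> = (1 - \<alpha>) * \<theta>" unfolding \<sigma>1 ..
    moreover have "a * z * (1 / (\<alpha> * a)) * \<theta> * \<sigma> = (1 / \<alpha> * \<sigma>) * z * \<theta>"
      unfolding \<sigma>1(3)[symmetric] by (simp only: mult_ac)
    ultimately show ?thesis unfolding \<sigma>1(1) U_def by (simp only:) (simp add: algebra_simps)
  qed
  then have "\<Phi> = (a\<^sup>2 * b\<^sup>2 + U * (1 / (1 - \<rho>))) / (a * b) - 1 + \<alpha>"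
    by (simp add: \<Phi>_def)
  also have "\<dots> = a * b + U * (\<alpha> * r / D) - 1 + \<alpha>"
    unfolding inv using nz D0 by (simp add: field_simps power2_eq_square)
  finally have "\<Phi> * D = (a * b - 1 + \<alpha>) * D + \<alpha> * (r * U)"
    using D0 by (simp add: field_simps)
  also have "r * U = r * (a * b * (y * z) * \<sigma>) + \<theta>1 * (y * b * (1 - \<alpha>) + a * z * (1 - \<alpha>) + a * b)"
    using r by (simp add: U_def \<theta> distrib_left)
  also have "(a * b - 1 + \<alpha>) * D + \<alpha> * (r * (a * b * (y * z) * \<sigma>)
      + \<theta>1 * (y * b * (1 - \<alpha>) + a * z * (1 - \<alpha>) + a * b)) = W"
    unfolding D_def W_def \<theta>1_def r_def a_def b_def s_def \<sigma>_def by algebra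
  finally have \<Phi>: "\<Phi> * D = W" .
  have W0: "W \<noteq> 0" using nz by (simp add: W_def)
  have "(y * z * (E - 1) / (s * (1 + y) * (1 + z)) - 1 / (\<alpha> * (1 + y) * (1 + z))) * W
      = \<alpha>\<^sup>2 * (y * z) * (E - 1) - \<alpha> * s"
  proof -
    have "x / (s * g * h) * (s * \<alpha>\<^sup>2 * (g * h)) = x * \<alpha>\<^sup>2" "1 / (\<alpha> * g * h) * (s * \<alpha>\<^sup>2 * (g * h)) = \<alpha> * s"
      if "g \<noteq> 0" "h \<noteq> 0" for x g h
      using that nz(1,4) by (simp_all add: power2_eq_square)
    from this[OF nz(5,6)] show ?thesis
      unfolding W_def left_diff_distrib[of _ _ "s * \<alpha>\<^sup>2 * ((1 + y) * (1 + z))"] by (simp only: mult_ac)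
  qed
  also have "\<dots> = - D" by (simp add: D_def q right_diff_distrib)
  finally have "(y * z * (E - 1) / (s * (1 + y) * (1 + z)) - 1 / (\<alpha> * (1 + y) * (1 + z))) * W = - D" .
  then have "y * z * (E - 1) / (s * (1 + y) * (1 + z)) - 1 / (\<alpha> * (1 + y) * (1 + z)) = - D / W"
    by (simp only: nonzero_eq_divide_eq[OF W0])
  moreover have "- 1 / \<Phi> = - D / W" using \<Phi> W0 D0 by (auto simp: field_simps)
  ultimately show ?thesis by simp
qed

section \<open>The generating function near the origin\<close>

context free_pair
begin

text \<open>Apart from the series, every condition follows from f y < 1 for functions f continuous
  at 0 with f 0 = 0, since \<open>\<xi>\<close> vanishes at 0; even 1 + x \<noteq> 0 follows from
  |x| < 1.\<close>

lemma eventually_small_parameter: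
  fixes t :: real
  defines "\<xi> \<equiv> \<lambda>a. a * exp (of_real t * a + of_real t / 2) / (1 + a)"
  assumes \<alpha>: "0 < \<alpha>"
    and m: "\<forall>\<^sub>F a in nhds 0. (\<lambda>n. \<xi> a ^ Suc n * \<tau> (u ^ Suc n)) sums a"
  shows "\<forall>\<^sub>F y in nhds 0. small_parameter \<alpha> u (\<xi> (of_real \<alpha> * y)) y"
proof -
  have near: "\<forall>\<^sub>F y in nhds 0. f y < 1" if "isCont f 0" "f 0 = 0" for f :: "complex \<Rightarrow> real"
  proof -
    have "(f \<longlongrightarrow> f 0) (nhds 0)" using that(1) unfolding isCont_def tendsto_at_iff_tendsto_nhds .
    from order_tendstoD(2)[OF this, of 1] show ?thesis using that by simp
  qed
  have cont: "isCont (\<lambda>y. \<xi> (of_real \<alpha> * y)) 0" unfolding \<xi>_def by (intro continuous_intros) simp_all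
  have \<xi>0: "\<xi> 0 = 0" by (simp add: \<xi>_def)
  have 1: "\<forall>\<^sub>F y in nhds 0. cmod (\<xi> (of_real \<alpha> * y)) < 1"
    by (rule near) (intro continuous_intros cont, simp add: \<xi>0)
  have 2: "\<forall>\<^sub>F y in nhds 0. cmod (of_real \<alpha> * y) < 1" "\<forall>\<^sub>F y in nhds 0. cmod y < 1"
    by (rule near; simp)+
  have 3: "\<forall>\<^sub>F y in nhds 0. cmod (\<xi> (of_real \<alpha> * y) * (1 + of_real \<alpha> * y) / (of_real \<alpha> * (1 + y))) < 1"
    by (rule near) (use \<alpha> in \<open>intro continuous_intros cont\<close>, use \<alpha> \<xi>0 in simp_all)
  have 4: "\<forall>\<^sub>F y in nhds 0. 2 / (\<alpha> * cmod (1 + of_real \<alpha> * y)) *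
      (cmod (\<xi> (of_real \<alpha> * y)) / (1 - cmod (\<xi> (of_real \<alpha> * y))) + cmod (of_real \<alpha> * y)) < 1"
    by (rule near) (intro continuous_intros cont, use \<alpha> \<xi>0 in simp_all)
  have "filterlim (\<lambda>y. of_real \<alpha> * y) (nhds (of_real \<alpha> * 0)) (nhds (0 :: complex))"
    by (intro tendsto_mult_left) (rule filterlim_ident)
  then have "filterlim (\<lambda>y. of_real \<alpha> * y) (nhds 0) (nhds (0 :: complex))" by simp
  from eventually_compose_filterlim[OF m this] 1 2 3 4 show ?thesis
  proof eventually_elim
    case (elim y)
    have nz: "1 + x \<noteq> 0" if "cmod x < 1" for x :: complex
    proof
      assume "1 + x = 0"
      then have "x = - 1" by (simp add: eq_neg_iff_add_eq_0 add.commute)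
      then show False using that by simp
    qed
    show ?case unfolding small_parameter_def
      using elim nz[of y] nz[of "of_real \<alpha> * y"] by simp
  qed
qed

text \<open>The factor e^(t(m+n)/2) is absorbed into \<open>w\<close> and \<open>w'\<close>, so
  \<open>phi\<close> is the double series of \<tau>(X X') except at (0, 0): there the series has
  \<tau>(1) = 1 but \<open>R_coeff\<close> prescribes \<alpha>, hence the correction - 1 +
  \<alpha>.\<close>

lemma phi_compressed:
  fixes t :: real
  assumes P: "P \<in> A" "adj P = P" "P * P = P" and u: "Y t = u" "u \<in> B" "unitary u"
    and w: "w = of_real (exp (t / 2)) * y" "cmod w < 1" and w': "w' = of_real (exp (t / 2)) * z" "cmod w' < 1"
  obtains X X' where "(\<lambda>m. (w *\<^sub>C (P * u)) ^ m) sums X" "(\<lambda>m. (w' *\<^sub>C (P * adj u)) ^ m) sums X'"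
    "phi \<tau> \<alpha> P Y t y z = \<tau> (X * X') - 1 + of_real \<alpha>"
proof -
  have PM: "P \<in> M" "u \<in> M" using P u A_M B_M by auto
  have small: "norm (c *\<^sub>C (P * v)) < 1" if "cmod c < 1" "unitary v" for c v
  proof -
    have "norm (P * v) \<le> 1 * 1"
      by (rule order_trans[OF norm_mult_ineq]) (intro mult_mono norm_projection_le[OF P(2,3)] norm_unitary_le that, simp_all)
    then have "norm (c *\<^sub>C (P * v)) \<le> cmod c * 1"
      using norm_scaleC_bop[of c "P * v"] mult_left_mono[of "norm (P * v)" 1 "cmod c"] by simp
    then show ?thesis using that by simp
  qed
  have s: "norm (w *\<^sub>C (P * u)) < 1" "norm (w' *\<^sub>C (P * adj u)) < 1"
    using small w w' u by simp_all
  obtain X where X: "(\<lambda>m. (w *\<^sub>C (P * u)) ^ m) sums X" "(1 - w *\<^sub>C (P * u)) * X = 1" "X * (1 - w *\<^sub>C (P * u)) = 1"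
    by (rule bop_geometric[OF s(1)])
  obtain X' where X': "(\<lambda>m. (w' *\<^sub>C (P * adj u)) ^ m) sums X'" "(1 - w' *\<^sub>C (P * adj u)) * X' = 1"
    "X' * (1 - w' *\<^sub>C (P * adj u)) = 1"
    by (rule bop_geometric[OF s(2)])
  have 1: "((\<lambda>(m, n). \<tau> ((w *\<^sub>C (P * u)) ^ m * (w' *\<^sub>C (P * adj u)) ^ n)) has_sum \<tau> (X * X')) UNIV"
    using PM s by (intro tau_double_series X X') (simp_all add: star_closed)
  have 2: "((\<lambda>(m, n). if m = 0 \<and> n = 0 then of_real \<alpha> - 1 else 0) has_sum (complex_of_real \<alpha> - 1)) (UNIV :: (nat \<times> nat) set)"
    by (rule has_sum_finite_neutralI[of "{(0, 0)}"]) (auto split: if_splits)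
  have "R_coeff \<tau> \<alpha> P Y t m n * y ^ m * z ^ n
      = \<tau> ((w *\<^sub>C (P * u)) ^ m * (w' *\<^sub>C (P * adj u)) ^ n) + (if m = 0 \<and> n = 0 then of_real \<alpha> - 1 else 0)" for m n
  proof (cases "m = 0 \<and> n = 0")
    case False
    have "exp (t * real (m + n) / 2) = exp (t / 2) ^ m * exp (t / 2) ^ n"
    proof -
      have "exp (t * real (m + n) / 2) = exp (real (m + n) * (t / 2))" by (simp add: mult.commute)
      also have "\<dots> = exp (t / 2) ^ (m + n)" by (rule exp_of_nat_mult)
      finally show ?thesis by (simp only: power_add)
    qed
    then show ?thesis using False PM
      by (auto simp: R_coeff_def u(1) w(1) w'(1) scaleC_power scaleC_scaleC tau_scaleC closed_mult closed_power closed_adj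
          power_mult_distrib)
  qed (simp add: R_coeff_def tau_one)
  then have "phi \<tau> \<alpha> P Y t y z = \<tau> (X * X') + (of_real \<alpha> - 1)"
    unfolding phi_def using has_sum_add[OF 1 2] by (intro infsumI) (simp add: case_prod_unfold)
  then show ?thesis using that[OF X(1) X'(1)] by simp
qed

end

lemma (in tracial_vna) sums_adj_power:
  assumes u: "u \<in> M" and s: "(\<lambda>n. cnj c ^ Suc n * \<tau> (u ^ Suc n)) sums cnj a"
  shows "(\<lambda>n. c ^ Suc n * \<tau> (adj u ^ Suc n)) sums a"
proof -
  have "cnj (cnj c ^ Suc n * \<tau> (u ^ Suc n)) = c ^ Suc n * \<tau> (adj u ^ Suc n)" for n
    using tau_adj[OF closed_power[OF u], of "Suc n"] by (simp del: power_Suc)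
  moreover have "(\<lambda>n. cnj (cnj c ^ Suc n * \<tau> (u ^ Suc n))) sums cnj (cnj a)"
    using s by (simp only: sums_cnj)
  ultimately show ?thesis by (simp only: complex_cnj_cnj)
qed

theorem proposition3p3:
  fixes M :: "'h::chilbert_space bop set"
    and \<tau> :: "'h bop \<Rightarrow> complex"
    and \<alpha> t :: real
    and P :: "'h bop"
    and Y :: "real \<Rightarrow> 'h bop"
  assumes "von_neumann_algebra M"
    and "faithful_tracial_state M \<tau>"
    and "0 < \<alpha>" and "\<alpha> \<le> 1"
    and "P \<in> M" and "adj P = P" and "P * P = P" and "\<tau> P = complex_of_real \<alpha>"
    and "free_unitary_BM M \<tau> Y"
    and "star_free \<tau> {P} (Y ` {0..})"
    and "0 \<le> t"
  shows "\<forall>\<^sub>F (y, z) in nhds (0, 0).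
    g_fun \<tau> \<alpha> P Y t y z =
      y * z * (exp (of_real t * (1 + of_real \<alpha> * y + of_real \<alpha> * z)) - 1) /
        ((1 + of_real \<alpha> * y + of_real \<alpha> * z) * (1 + y) * (1 + z))
      - 1 / (of_real \<alpha> * (1 + y) * (1 + z))"
proof -
  obtain F X where FX: "filtration M F" "free_additive_BM \<tau> F X"
    "\<forall>t\<ge>0. Y t \<in> F t \<and> adj (Y t) * Y t = 1 \<and> Y t * adj (Y t) = 1" "Y 0 = 1"
    "\<forall>t\<ge>0. \<exists>I J. has_free_stochastic_integral M \<tau> F X Y t I \<and> (Y has_integral J) {0..t} \<and>
           Y t = 1 + \<i> *\<^sub>C I - (1/2) *\<^sub>R J"
    using assms(9) unfolding free_unitary_BM_def by blast
  interpret unitary_BM M \<tau> F X Y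
    using assms(1,2) FX by unfold_locales (auto simp: unitary_def)
  define B where "B = unital_star_subalgebra hull (Y ` {0..})"
  interpret FP: free_pair M \<tau> "unital_star_subalgebra hull {P}" B
    unfolding B_def using assms(5,10) Y_M by (intro star_free_pair) auto
  define u where "u = Y t"
  have u: "u \<in> B" "unitary u" "u \<in> M"
    using assms(11) Y_unitary Y_M by (auto simp: u_def B_def intro: hull_inc)
  have P: "P \<in> unital_star_subalgebra hull {P}" by (rule hull_inc) simp
  \<comment> \<open>The inverse of the unscaled moment series of \<open>Y t\<close>; its value at
    \<alpha> y serves as the parameter c of the factorisation.\<close>
  define \<xi> where "\<xi> a = a * exp (of_real t * a + of_real t / 2) / (1 + a)" for a :: complex
  have m: "\<forall>\<^sub>F a in nhds 0. (\<lambda>n. \<xi> a ^ Suc n * \<tau> (u ^ Suc n)) sums a"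
    using moment_series[OF assms(11)] unfolding \<xi>_def u_def .
  have "filterlim cnj (nhds (cnj 0)) (nhds 0)" by (intro tendsto_cnj) (rule filterlim_ident)
  then have "filterlim cnj (nhds 0) (nhds 0)" by simp
  from eventually_compose_filterlim[OF m this]
  have m': "\<forall>\<^sub>F a in nhds 0. (\<lambda>n. \<xi> a ^ Suc n * \<tau> (adj u ^ Suc n)) sums a"
  proof eventually_elim
    case (elim a)
    \<comment> \<open>The moments of \<open>adj u\<close> are the conjugates of those of
      \<open>u\<close>, and \<open>\<xi>\<close> commutes with conjugation, so both have the same
      inverse series.\<close>
    have "\<xi> (cnj a) = cnj (\<xi> a)" by (simp add: \<xi>_def exp_cnj)
    then show ?case using elim by (intro sums_adj_power u) (simp only:)
  qed
  \<comment> \<open>The bound 1/2 for both variables keeps 1 + \<alpha> y + \<alpha> z different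
    from 0.\<close>
  have near: "\<forall>\<^sub>F y in nhds 0. cmod (of_real \<alpha> * y) < 1 / 2"
  proof -
    have "((\<lambda>y. cmod (of_real \<alpha> * y)) \<longlongrightarrow> cmod (of_real \<alpha> * 0)) (nhds (0 :: complex))"
      by (intro tendsto_intros filterlim_ident)
    from order_tendstoD(2)[OF this, of "1 / 2"] show ?thesis by simp
  qed
  have y: "\<forall>\<^sub>F y in nhds 0. FP.small_parameter \<alpha> u (\<xi> (of_real \<alpha> * y)) y \<and> cmod (of_real \<alpha> * y) < 1 / 2"
    using FP.eventually_small_parameter[OF assms(3) m[unfolded \<xi>_def]] near unfolding \<xi>_def by (rule eventually_conj)
  have z: "\<forall>\<^sub>F z in nhds 0. FP.small_parameter \<alpha> (adj u) (\<xi> (of_real \<alpha> * z)) z \<and> cmod (of_real \<alpha> * z) < 1 / 2"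
    using FP.eventually_small_parameter[OF assms(3) m'[unfolded \<xi>_def]] near unfolding \<xi>_def by (rule eventually_conj)
  have "\<forall>\<^sub>F (y, z) in nhds 0 \<times>\<^sub>F nhds 0.
      (FP.small_parameter \<alpha> u (\<xi> (of_real \<alpha> * y)) y \<and> cmod (of_real \<alpha> * y) < 1 / 2) \<and>
      (FP.small_parameter \<alpha> (adj u) (\<xi> (of_real \<alpha> * z)) z \<and> cmod (of_real \<alpha> * z) < 1 / 2)"
    using eventually_prodI[OF y z] by (simp add: case_prod_unfold)
  then show ?thesis unfolding nhds_prod
  proof (rule eventually_mono, clarify)
    fix y z :: complex
    define w where "w x = \<xi> (of_real \<alpha> * x) * (1 + of_real \<alpha> * x) / (of_real \<alpha> * (1 + x))" for x
    assume y: "FP.small_parameter \<alpha> u (\<xi> (of_real \<alpha> * y)) y" "cmod (of_real \<alpha> * y) < 1 / 2"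
      and z: "FP.small_parameter \<alpha> (adj u) (\<xi> (of_real \<alpha> * z)) z" "cmod (of_real \<alpha> * z) < 1 / 2"
    have nz: "1 + of_real \<alpha> * y \<noteq> 0" "1 + y \<noteq> 0" "1 + of_real \<alpha> * z \<noteq> 0" "1 + z \<noteq> 0" "cmod (w y) < 1" "cmod (w z) < 1"
      using y z by (auto simp: FP.small_parameter_def w_def)
    have \<alpha>: "complex_of_real \<alpha> \<noteq> 0" using assms(3) by simp
    \<comment> \<open>The factor 1 + \<alpha> x cancels, and the substitution of
      \<open>g_fun\<close> appears: the argument of \<open>phi\<close>, scaled by e^(t/2), is the
      coefficient w of the factorisation.\<close>
    have w: "w x = of_real (exp (t / 2)) * (x * exp (of_real (\<alpha> * t) * x) / (1 + x))"
      if "1 + of_real \<alpha> * x \<noteq> 0" for x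
      using that \<alpha> by (simp add: w_def \<xi>_def exp_add exp_of_real[symmetric] mult_ac)
    obtain X X' where XX': "(\<lambda>m. (w y *\<^sub>C (P * u)) ^ m) sums X" "(\<lambda>m. (w z *\<^sub>C (P * adj u)) ^ m) sums X'"
      "phi \<tau> \<alpha> P Y t (y * exp (of_real (\<alpha> * t) * y) / (1 + y)) (z * exp (of_real (\<alpha> * t) * z) / (1 + z))
        = \<tau> (X * X') - 1 + of_real \<alpha>"
      by (rule FP.phi_compressed[where Y = Y and t = t and u = u and w = "w y" and w' = "w z"
            and y = "y * exp (of_real (\<alpha> * t) * y) / (1 + y)" and z = "z * exp (of_real (\<alpha> * t) * z) / (1 + z)",
            OF P assms(6,7) u_def[symmetric] u(1,2) w[OF nz(1)] nz(5) w[OF nz(3)] nz(6)])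
    note T = FP.trace_compressed_resolvents[OF P assms(6,7,8,3,4) u(1,2) y(1) z(1) XX'(1,2)[unfolded w_def]]
    have s: "1 + of_real \<alpha> * y + of_real \<alpha> * z \<noteq> 0"
    proof
      assume "1 + of_real \<alpha> * y + of_real \<alpha> * z = 0"
      then have "of_real \<alpha> * y + of_real \<alpha> * z = - 1" by (simp add: eq_neg_iff_add_eq_0 add_ac)
      then show False using norm_triangle_ineq[of "of_real \<alpha> * y" "of_real \<alpha> * z"] y(2) z(2) by simp
    qed
    \<comment> \<open>The two factors e^(t/2) combine to e^t, so the exponential of the claim is a
      rescaled product of the two parameters c and c'.\<close>
    have q: "\<xi> (of_real \<alpha> * y) * \<xi> (of_real \<alpha> * z) * ((1 + of_real \<alpha> * y) * (1 + of_real \<alpha> * z))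
        = (of_real \<alpha>)\<^sup>2 * (y * z) * exp (of_real t * (1 + of_real \<alpha> * y + of_real \<alpha> * z))"
    proof -
      have "exp (of_real t * (1 + of_real \<alpha> * y + of_real \<alpha> * z))
        = exp (of_real t * (of_real \<alpha> * y) + of_real t / 2) * exp (of_real t * (of_real \<alpha> * z) + of_real t / 2)"
        unfolding exp_add[symmetric] by (simp add: algebra_simps)
      then show ?thesis using nz by (simp add: \<xi>_def power2_eq_square mult_ac)
    qed
    have \<sigma>: "complex_of_real (\<alpha> * (1 - \<alpha>)) = of_real \<alpha> * (1 - of_real \<alpha>)" by simp
    show "g_fun \<tau> \<alpha> P Y t y z =
        y * z * (exp (of_real t * (1 + of_real \<alpha> * y + of_real \<alpha> * z)) - 1) /
        ((1 + of_real \<alpha> * y + of_real \<alpha> * z) * (1 + y) * (1 + z))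
      - 1 / (of_real \<alpha> * (1 + y) * (1 + z))"
      unfolding g_fun_def f_fun_def XX'(3) T(3) \<sigma>
      by (rule generating_function_identity[OF \<alpha> nz(1,3) s nz(2,4) T(2) T(1)[unfolded \<sigma>] q])
  qed
qed

end
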